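(* Let $p,q$ be relatively prime positive integers. Let $\lambda_0$ be a parameter value, and let $$f_\lambda(x_1,x_2)=(\mu_1(\lambda)x_1,\mu_2(\lambda)x_2)+\sum_{|k|=2}^{\infty}a_k(\lambda)x^k,\qquad a_k(\lambda)\in\mathbb{C}^2,\ \mu_1\neq\mu_2,$$ be a family of local analytic diffeomorphisms of $\mathbb{C}^2$ near $0$ fixing $0$, the series being absolutely convergent on a polydisk $D\subset\mathbb{C}^2$ at $0$. Suppose that $f_\lambda$ has a hyperbolic fixed point at $0$ with a $q:-p$ resonance in modulus at $\lambda=\lambda_0$, i.e. $|\mu_1(\lambda_0)|^p=|\mu_2(\lambda_0)|^{-q}$. Let $\alpha_0=(r_0,s_0)$ be the integer solution of $qr_0-ps_0=1$ with $0\le r_0\le p$, $0\le s_0\le q$, and let $\alpha_1=(p,q)-\alpha_0$. Let $N\in\mathbb{N}$ be given, and write $u=x_1^px_2^q$. Then there is an analytic change of variables $h_\lambda$ near $0$ such that $g_\lambda=h_\lambda^{-1}\circ f_\lambda\circ h_\lambda$ has the form $g_\lambda(x_1,x_2)=(g_{\lambda,1}(x_1,x_2),g_{\lambda,2}(x_1,x_2))$ with, for $i=1,2$, $$g_{\lambda,i}(x_1,x_2)=x_i\Big[\mu_i(\lambda)+b^0_i(u,\lambda)+u\sum_{k=1}^{\infty}u^{Nk}\big(x^{k\alpha_0}b^{0k}_i(u,\lambda)+x^{k\alpha_1}b^{1k}_i(u,\lambda)\big)\Big],$$ where moreover: (i) the functions $b^0_i,\ b^{0k}_i,\ b^{1k}_i$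 are locally analytic in $u$, $i=1,2$; (ii) all the occurring power series, expressed in the variables $x_1,x_2$, converge on some polydisk at $0$; (iii) if the family $f_\lambda$ depends analytically on $\lambda$ near $\lambda_0$, then this is also the case for $h_\lambda$, $g_\lambda$, $b^0_i$, $b^{0k}_i$ and $b^{1k}_i$.
   Context: Multi-index notation: for $k=(k_1,k_2)\in\mathbb{N}^2$ (with $0\in\mathbb{N}$) and $x=(x_1,x_2)\in\mathbb{C}^2$, $x^k=x_1^{k_1}x_2^{k_2}$ and $|k|=k_1+k_2$. Parameter: the coefficients of the power series are functions of a parameter $\lambda$, all defined on some sufficiently small neighbourhood $\Lambda$ of the given value $\lambda_0$. These functions are considered in a space endowed with some supremum norm; one can for example think of the space of functions that are analytic inside a polydisk and continuous on the boundary. $\mu_1(\lambda),\mu_2(\lambda)$ are the eigenvalues of the linear part of $f_\lambda$ at $0$; the fixed point $0$ is hyperbolic if they have modulus different from $1$. Under the resonance condition above, a hyperbolic fixed point is a saddle at $\lambda=\lambda_0$.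
   Formalization: The formal theorem assumes that the eigenvalues μ_1(λ), μ_2(λ) are continuous at λ_0; without this the values of the family at λ ≠ λ_0 are unconstrained by the saddle condition and the claim fails. *)

theory Defs
  imports "HOL-Complex_Analysis.Complex_Analysis"
begin

text \<open>\<open>$\<close> is to denote vector components only.\<close>
no_notation fps_nth (infixl \<open>$\<close> 75)

definition polydisk :: "real^2 \<Rightarrow> (complex^2) set" where
  "polydisk R = {x. \<forall>i. cmod (x $ i) < R $ i}"

definition mpow :: "complex^2 \<Rightarrow> nat \<times> nat \<Rightarrow> complex" where
  "mpow x k = x $ 1 ^ fst k * x $ 2 ^ snd k"

definition mdeg :: "nat \<times> nat \<Rightarrow> nat" where
  "mdeg k = fst k + snd k"

text \<open>
  The coefficients \<open>c k\<close> are functions of the parameter and are measured in the supremum norm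
  over \<open>\<Lambda>\<close>. The series is \<open>\<Sum>k\<in>K. c k l * x^(e k)\<close>; the exponent map \<open>e\<close> allows series that are
  indexed by something else than their exponents.
\<close>

definition abs_conv ::
  "'l set \<Rightarrow> real^2 \<Rightarrow> 'k set \<Rightarrow> ('k \<Rightarrow> nat \<times> nat) \<Rightarrow> ('k \<Rightarrow> 'l \<Rightarrow> 'b::real_normed_vector) \<Rightarrow> bool" where
  "abs_conv \<Lambda> R K e c \<longleftrightarrow>
     (\<forall>k\<in>K. bounded (c k ` \<Lambda>)) \<and>
     (\<forall>x\<in>polydisk R. (\<lambda>k. (SUP l\<in>\<Lambda>. norm (c k l)) * cmod (mpow x (e k))) summable_on K)"

definition power_series_family ::
  "'l set \<Rightarrow> real^2 \<Rightarrow> ('l \<Rightarrow> complex^2 \<Rightarrow> complex^2) \<Rightarrow> (nat \<times> nat \<Rightarrow> 'l \<Rightarrow> complex^2) \<Rightarrow> bool" where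
  "power_series_family \<Lambda> R F c \<longleftrightarrow>
     abs_conv \<Lambda> R UNIV (\<lambda>k. k) c \<and>
     (\<forall>l\<in>\<Lambda>. \<forall>x\<in>polydisk R. F l x = (\<Sum>\<^sub>\<infinity>k. mpow x k *s c k l))"

text \<open>
  Analyticity in several complex variables on an open set: the total derivative exists and is
  complex linear, i.e. it is given by a complex gradient \<open>D\<close>.
\<close>

definition mv_analytic_on :: "(complex^'n \<Rightarrow> complex) \<Rightarrow> (complex^'n) set \<Rightarrow> bool" where
  "mv_analytic_on F U \<longleftrightarrow>
     open U \<and> (\<forall>z\<in>U. \<exists>D. (F has_derivative (\<lambda>v. \<Sum>i\<in>UNIV. D $ i * v $ i)) (at z))"

definition analytic_diffeo_on :: "(complex^2 \<Rightarrow> complex^2) \<Rightarrow> (complex^2) set \<Rightarrow> bool" where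
  "analytic_diffeo_on F U \<longleftrightarrow>
     inj_on F U \<and>
     (\<forall>i. mv_analytic_on (\<lambda>x. F x $ i) U) \<and>
     (\<forall>i. mv_analytic_on (\<lambda>y. inv_into U F y $ i) (F ` U))"

text \<open>
  Analytic dependence of a family of power series on the parameter near \<open>l0\<close>: all its
  coefficients are analytic on one common neighbourhood of \<open>l0\<close>. Together with the convergence
  in supremum norm this amounts to joint analyticity in the variables and the parameter.
\<close>

definition coeffs_analytic_near :: "complex^'m \<Rightarrow> 'k set \<Rightarrow> ('k \<Rightarrow> complex^'m \<Rightarrow> complex) \<Rightarrow> bool" where
  "coeffs_analytic_near l0 K c \<longleftrightarrow> (\<exists>U. open U \<and> l0 \<in> U \<and> (\<forall>k\<in>K. mv_analytic_on (c k) U))"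

text \<open>
  \<open>b\<close> is analytic in the single variable \<open>u\<close> for \<open>cmod u < \<delta>\<close>, with Taylor coefficients \<open>\<beta> j\<close>
  depending on the parameter.
\<close>

definition analytic_in_u ::
  "'l set \<Rightarrow> real \<Rightarrow> (complex \<Rightarrow> 'l \<Rightarrow> complex) \<Rightarrow> (nat \<Rightarrow> 'l \<Rightarrow> complex) \<Rightarrow> bool" where
  "analytic_in_u \<Lambda> \<delta> b \<beta> \<longleftrightarrow>
     (\<forall>l\<in>\<Lambda>. (\<lambda>u. b u l) analytic_on ball 0 \<delta> \<and>
       (\<forall>u\<in>ball 0 \<delta>. ((\<lambda>j. \<beta> j l * u ^ j) has_sum b u l) UNIV))"

end

theory Submission
  imports Defs
begin

text \<open>
  Write \<open>h = id + H\<close> and \<open>g = L + G\<close> with \<open>L\<close> the linear part. In the equation \<open>f \<circ> h = h \<circ> g\<close> the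
  coefficient of \<open>x\<^sub>i x\<^sup>\<nu>\<close> in \<open>H\<close> carries the divisor \<open>\<mu>\<^sub>i (1 - \<mu>\<^sup>\<nu>)\<close>. Put \<open>m = q \<nu>\<^sub>1 - p \<nu>\<^sub>2\<close>; at \<open>\<lambda>\<^sub>0\<close> the
  modulus of \<open>\<mu>\<^sup>\<nu>\<close> is \<open>exp (\<tau> m)\<close>. The monomials to be removed satisfy \<open>\<bar>\<nu>\<bar> \<le> B \<bar>m\<bar>\<close>, so there \<open>\<mu>\<^sup>\<nu>\<close> is
  exponentially small or large in \<open>\<bar>\<nu>\<bar>\<close>, uniformly for \<open>\<lambda>\<close> near \<open>\<lambda>\<^sub>0\<close>. The exponentially small ones
  can be removed in a weighted sum norm: the gain \<open>\<mu>\<^sup>\<nu>\<close> compensates the loss of domain in \<open>H \<circ> g\<close>.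
  The large ones are small for the inverse map. Since the exponents that survive the first step lie
  in a half-plane, hence form a monoid, one inverts, removes the remaining ones by the same
  argument without creating new terms, and inverts again.

  All equations are of the form \<open>X = \<Phi> X\<close> where the coefficients of \<open>\<Phi> X\<close> of degree \<open>n\<close> depend
  algebraically on those of \<open>X\<close> of degree less than \<open>n\<close>. So the solutions depend analytically on the
  parameter whenever the data do.
\<close>

text \<open>At a saddle no polydisk is mapped into itself by \<open>g\<close>, so composition with
  \<open>g\<close> is not bounded in a sum norm of fixed radius. It becomes bounded on series
  supported where \<open>\<mu>\<^sup>\<nu>\<close> is small, which is why supports are carried
  through the whole construction.

  Among the exponents that are kept, the degree is unbounded for given \<open>m\<close>, so an
  arbitrarily small change of the parameter can bring the modulus of
  \<open>\<mu>\<^sup>\<nu>\<close> to 1. For a removed exponent, a change of the moduli by a factor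
  \<open>a\<close> costs at most \<open>a ^ (n * B + 1)\<close>, where \<open>n = |m|\<close>,
  against the gain \<open>\<theta> ^ n\<close> with \<open>\<theta> = exp (- |\<tau>|)\<close>.
  Every slope \<open>N\<close> is allowed, with \<open>B = (p + q) * (N + 1)\<close>, at the price
  of a smaller parameter neighbourhood.

  The removed exponents have one side with \<open>m > 0\<close> and one with \<open>m < 0\<close>.
  The set \<open>Ha\<close> cuts off the former and \<open>Hb\<close> the latter; the sign of
  \<open>\<tau>\<close> decides which side is contracted by \<open>\<mu>\<close> and hence treated
  first.\<close>

no_notation Infinite_Set_Sum.abs_summable_on (infix \<open>abs'_summable'_on\<close> 50)
declare split_paired_All [simp del] split_paired_Ex [simp del]

type_synonym 'l ser = "nat \<times> nat \<Rightarrow> 'l \<Rightarrow> complex"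

text \<open>Values in \<open>ennreal\<close> make every rearrangement a case of Tonelli's theorem.
  Summability of complex families is recovered afterwards from finiteness of such a sum.\<close>

abbreviation nnsum :: "('k \<Rightarrow> ennreal) \<Rightarrow> ennreal" where
  "nnsum f \<equiv> \<integral>\<^sup>+k. f k \<partial>count_space UNIV"

subsection \<open>Sums of extended nonnegative reals over exponents\<close>

lemma finite_mdeg [simp]: "finite {k. mdeg k \<le> n}"
proof -
  have "{k. mdeg k \<le> n} \<subseteq> {..n} \<times> {..n}" by (auto simp: mdeg_def)
  then show ?thesis by (rule finite_subset) simp
qed

lemma sum_le_nnsum:
  assumes "finite F" shows "sum f F \<le> nnsum f"
proof -
  have "sum f F = (\<integral>\<^sup>+k. (if k \<in> F then f k else 0) \<partial>count_space UNIV)"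
    by (subst nn_integral_count_space'[OF assms]) (auto intro: sum.cong)
  also have "\<dots> \<le> nnsum f" by (intro nn_integral_mono) auto
  finally show ?thesis .
qed

text \<open>Monotone convergence along the exhaustion by degree. This suits a limit whose
  truncations coincide with truncations of varying series, as in
  \<open>causal_fixpoint\<close>.\<close>

lemma nnsum_le:
  fixes f :: "nat \<times> nat \<Rightarrow> ennreal"
  assumes "\<And>n. (\<Sum>k | mdeg k \<le> n. f k) \<le> C"
  shows "nnsum f \<le> C"
proof -
  define g where "g n k = (if mdeg k \<le> n then f k else 0)" for n k
  have "nnsum f = (\<integral>\<^sup>+k. (SUP n. g n k) \<partial>count_space UNIV)"
  proof (intro nn_integral_cong antisym)
    fix k
    show "f k \<le> (SUP n. g n k)"
      by (rule SUP_upper2[of "mdeg k"]) (auto simp: g_def)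
    show "(SUP n. g n k) \<le> f k"
      by (rule SUP_least) (simp add: g_def)
  qed
  also have "\<dots> = (SUP n. nnsum (g n))"
    by (intro nn_integral_monotone_convergence_SUP) (auto simp: incseq_def le_fun_def g_def)
  also have "\<dots> \<le> C"
  proof (rule SUP_least)
    fix n
    have "nnsum (g n) = (\<Sum>k | mdeg k \<le> n. f k)"
      by (subst nn_integral_count_space'[of "{k. mdeg k \<le> n}"]) (auto simp: g_def intro: sum.cong)
    then show "nnsum (g n) \<le> C" using assms by simp
  qed
  finally show ?thesis .
qed

lemma nnsum_swap:
  fixes f :: "'a::countable \<Rightarrow> 'b \<Rightarrow> ennreal"
  shows "nnsum (\<lambda>x. nnsum (\<lambda>y. f y x)) = nnsum (\<lambda>y. nnsum (\<lambda>x. f y x))"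
  by (rule nn_integral_count_space_nn_integral) auto

lemma abs_summable_if_nnsum:
  fixes f :: "'k \<Rightarrow> 'b::real_normed_vector"
  assumes "nnsum (\<lambda>k. ennreal (norm (f k))) \<le> ennreal C" "C \<ge> 0"
  shows "f abs_summable_on UNIV" "infsum (\<lambda>k. norm (f k)) UNIV \<le> C"
proof -
  have *: "(\<Sum>k\<in>F. norm (f k)) \<le> C" if "finite F" for F
  proof -
    have "ennreal (\<Sum>k\<in>F. norm (f k)) = (\<Sum>k\<in>F. ennreal (norm (f k)))"
      by (subst sum_ennreal) auto
    also have "\<dots> \<le> ennreal C" using sum_le_nnsum[OF that] assms(1) by (rule order_trans)
    finally show ?thesis using assms(2) by (simp add: ennreal_le_iff)
  qed
  show 1: "f abs_summable_on UNIV"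
    by (rule nonneg_bdd_above_summable_on) (auto intro!: bdd_aboveI2[where M = C] *)
  show "infsum (\<lambda>k. norm (f k)) UNIV \<le> C"
    by (rule infsum_le_finite_sums[OF 1]) (use * in auto)
qed

subsection \<open>Weighted norms of families of power series\<close>

definition csup :: "'l set \<Rightarrow> ('l \<Rightarrow> complex) \<Rightarrow> ennreal" where
  "csup L c = (SUP l\<in>L. ennreal (cmod (c l)))"

text \<open>The supremum over the parameter stands inside the sum, so a finite norm means absolute
  convergence on the closed polydisk of radius \<open>\<rho>\<close>, uniformly on \<open>L\<close>.
  A weighted sum norm of this kind is submultiplicative.\<close>

definition nrm :: "'l set \<Rightarrow> real \<Rightarrow> 'l ser \<Rightarrow> ennreal" where
  "nrm L \<rho> X = nnsum (\<lambda>k. csup L (X k) * ennreal (\<rho> ^ mdeg k))"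

text \<open>The Cauchy product; for \<open>i\<close> in the box the componentwise difference
  \<open>k - i\<close> is not truncated.\<close>

definition cnv :: "'l ser \<Rightarrow> 'l ser \<Rightarrow> 'l ser" where
  "cnv X Y = (\<lambda>k l. \<Sum>i\<in>{..fst k} \<times> {..snd k}. X i l * Y (k - i) l)"

definition unit_ser :: "'l ser" where
  "unit_ser = (\<lambda>k l. if k = 0 then 1 else 0)"

text \<open>The monomial with exponent \<open>(a, b)\<close> in the series \<open>v 1\<close> and
  \<open>v 2\<close>, built one factor at a time so that inductions treat a single product.\<close>

fun pw :: "(2 \<Rightarrow> 'l ser) \<Rightarrow> nat \<Rightarrow> nat \<Rightarrow> 'l ser" where
  "pw v 0 0 = unit_ser"
| "pw v 0 (Suc b) = cnv (v 2) (pw v 0 b)"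
| "pw v (Suc a) b = cnv (v 1) (pw v a b)"

definition ei :: "2 \<Rightarrow> nat \<times> nat" where
  "ei i = (if i = 1 then (1, 0) else (0, 1))"

text \<open>For \<open>G (a, b) = pw g a b\<close> with \<open>g\<close> vanishing at \<open>0\<close> this is the composition of \<open>h\<close> with \<open>g\<close>;
  the cut-off at \<open>mdeg j\<close> then only omits zero terms.\<close>
definition lcomb :: "'l ser \<Rightarrow> (nat \<times> nat \<Rightarrow> 'l ser) \<Rightarrow> 'l ser" where
  "lcomb h G = (\<lambda>j l. \<Sum>k | mdeg k \<le> mdeg j. h k l * G k j l)"

abbreviation cmp :: "'l ser \<Rightarrow> (2 \<Rightarrow> 'l ser) \<Rightarrow> 'l ser" where
  "cmp h g \<equiv> lcomb h (\<lambda>k. pw g (fst k) (snd k))"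

lemma csup_upper: "l \<in> L \<Longrightarrow> ennreal (cmod (c l)) \<le> csup L c"
  unfolding csup_def by (rule SUP_upper)

lemma csup_least: "(\<And>l. l \<in> L \<Longrightarrow> ennreal (cmod (c l)) \<le> C) \<Longrightarrow> csup L c \<le> C"
  unfolding csup_def by (rule SUP_least)

lemma csup_zero [simp]: "csup L (\<lambda>l. 0) = 0"
  by (rule antisym[OF csup_least]) auto

lemma csup_const_le: "csup L (\<lambda>l. c) \<le> ennreal (cmod c)"
  by (rule csup_least) auto

lemma csup_add: "csup L (\<lambda>l. c l + d l) \<le> csup L c + csup L d"
proof (rule csup_least)
  fix l assume l: "l \<in> L"
  have "ennreal (cmod (c l + d l)) \<le> ennreal (cmod (c l)) + ennreal (cmod (d l))"
    by (metis ennreal_leI ennreal_plus norm_ge_zero norm_triangle_ineq)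
  also have "\<dots> \<le> csup L c + csup L d" by (intro add_mono csup_upper l)
  finally show "ennreal (cmod (c l + d l)) \<le> csup L c + csup L d" .
qed

lemma csup_uminus [simp]: "csup L (\<lambda>l. - c l) = csup L c"
  by (simp add: csup_def)

lemma csup_mult: "csup L (\<lambda>l. c l * d l) \<le> csup L c * csup L d"
proof (rule csup_least)
  fix l assume l: "l \<in> L"
  have "ennreal (cmod (c l * d l)) = ennreal (cmod (c l)) * ennreal (cmod (d l))"
    by (simp add: norm_mult ennreal_mult)
  also have "\<dots> \<le> csup L c * csup L d" by (intro mult_mono csup_upper l) auto
  finally show "ennreal (cmod (c l * d l)) \<le> csup L c * csup L d" .
qed

lemma csup_sum: "csup L (\<lambda>l. \<Sum>i\<in>I. c i l) \<le> (\<Sum>i\<in>I. csup L (c i))"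
proof (induction I rule: infinite_finite_induct)
  case (insert x F)
  then show ?case
    using csup_add[of L "c x" "\<lambda>l. \<Sum>i\<in>F. c i l"] by (auto intro: order_trans add_left_mono)
qed auto

lemma csup_mono:
  assumes "\<And>l. l \<in> L \<Longrightarrow> cmod (c l) \<le> C * cmod (d l)" "C \<ge> 0"
  shows "csup L c \<le> ennreal C * csup L d"
proof (rule csup_least)
  fix l assume l: "l \<in> L"
  have "ennreal (cmod (c l)) \<le> ennreal (C * cmod (d l))"
    by (rule ennreal_leI) (rule assms(1)[OF l])
  also have "\<dots> = ennreal C * ennreal (cmod (d l))" using assms(2) by (simp add: ennreal_mult)
  also have "\<dots> \<le> ennreal C * csup L d" by (intro mult_left_mono csup_upper l) auto
  finally show "ennreal (cmod (c l)) \<le> ennreal C * csup L d" .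
qed

lemma nrm_add: "nrm L \<rho> (\<lambda>k l. X k l + Y k l) \<le> nrm L \<rho> X + nrm L \<rho> Y"
proof -
  have "nrm L \<rho> (\<lambda>k l. X k l + Y k l) \<le>
      nnsum (\<lambda>k. csup L (X k) * ennreal (\<rho> ^ mdeg k) + csup L (Y k) * ennreal (\<rho> ^ mdeg k))"
    unfolding nrm_def distrib_right[symmetric]
    by (intro nn_integral_mono mult_right_mono csup_add) auto
  also have "\<dots> = nrm L \<rho> X + nrm L \<rho> Y" unfolding nrm_def by (intro nn_integral_add) auto
  finally show ?thesis .
qed

lemma nrm_uminus [simp]: "nrm L \<rho> (\<lambda>k l. - X k l) = nrm L \<rho> X"
  by (simp add: nrm_def)

lemma nrm_diff: "nrm L \<rho> (\<lambda>k l. X k l - Y k l) \<le> nrm L \<rho> X + nrm L \<rho> Y"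
  using nrm_add[of L \<rho> X "\<lambda>k l. - Y k l"] by simp

lemma nrm_bound:
  assumes "\<And>k l. l \<in> L \<Longrightarrow> cmod (X k l) \<le> C * cmod (Y k l)" "C \<ge> 0"
  shows "nrm L \<rho> X \<le> ennreal C * nrm L \<rho> Y"
proof -
  have "nrm L \<rho> X \<le> nnsum (\<lambda>k. ennreal C * (csup L (Y k) * ennreal (\<rho> ^ mdeg k)))"
    unfolding nrm_def mult.assoc[symmetric]
    by (intro nn_integral_mono mult_right_mono csup_mono assms) auto
  also have "\<dots> = ennreal C * nrm L \<rho> Y" unfolding nrm_def by (intro nn_integral_cmult) auto
  finally show ?thesis .
qed

lemma nrm_unit_ser: "\<rho> \<ge> 0 \<Longrightarrow> nrm L \<rho> unit_ser \<le> 1"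
proof -
  have "nrm L \<rho> unit_ser \<le> nnsum (\<lambda>k::nat \<times> nat. if k = 0 then 1 else 0)"
    unfolding nrm_def unit_ser_def
    by (rule nn_integral_mono) (auto simp: mdeg_def intro: order_trans[OF csup_const_le])
  also have "\<dots> = (\<Sum>k\<in>{0::nat \<times> nat}. 1)" by (subst nn_integral_count_space'[of "{0}"]) auto
  finally show ?thesis by simp
qed

text \<open>Subtraction of natural numbers truncates at 0; the equation holds exactly when neither
  component is cut off.\<close>

lemma box_iff: "i \<in> {..fst k} \<times> {..snd k} \<longleftrightarrow> i + (k - i) = (k::nat \<times> nat)"
  by (cases i; cases k) auto

lemma mdeg_add [simp]: "mdeg (i + j) = mdeg i + mdeg j"
  by (simp add: mdeg_def)

lemma mdeg_0 [simp]: "mdeg 0 = 0"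
  by (simp add: mdeg_def)

lemma mdeg_eq_0 [simp]: "mdeg k = 0 \<longleftrightarrow> k = 0"
  by (cases k) (auto simp: mdeg_def zero_prod_def)

lemma mdeg_box: "i \<in> {..fst k} \<times> {..snd k} \<Longrightarrow> mdeg k = mdeg i + mdeg (k - i)"
  using mdeg_add[of i "k - i"] by (simp only: box_iff)

text \<open>Tonelli's theorem after the substitution \<open>k = i + j\<close>.\<close>

lemma nnsum_box:
  fixes F :: "nat \<times> nat \<Rightarrow> nat \<times> nat \<Rightarrow> ennreal"
  shows "nnsum (\<lambda>k. \<Sum>i\<in>{..fst k} \<times> {..snd k}. F i (k - i)) = nnsum (\<lambda>i. nnsum (F i))"
proof -
  let ?B = "\<lambda>k::nat \<times> nat. {..fst k} \<times> {..snd k}"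
  have "nnsum (\<lambda>k. \<Sum>i\<in>?B k. F i (k - i)) =
      nnsum (\<lambda>k. nnsum (\<lambda>i. if i \<in> ?B k then F i (k - i) else 0))"
  proof (rule nn_integral_cong)
    fix k :: "nat \<times> nat"
    show "(\<Sum>i\<in>?B k. F i (k - i)) = nnsum (\<lambda>i. if i \<in> ?B k then F i (k - i) else 0)"
      by (subst nn_integral_count_space'[of "?B k"]) auto
  qed
  also have "\<dots> = nnsum (\<lambda>i. nnsum (\<lambda>k. if i \<in> ?B k then F i (k - i) else 0))"
    by (rule nnsum_swap)
  also have "\<dots> = nnsum (\<lambda>i. nnsum (F i))"
  proof (rule nn_integral_cong)
    fix i :: "nat \<times> nat"
    let ?K = "{k. i \<in> ?B k}"
    have "nnsum (\<lambda>k. if i \<in> ?B k then F i (k - i) else 0) = (\<integral>\<^sup>+k. F i (k - i) \<partial>count_space ?K)"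
      by (subst nn_integral_count_space_indicator) (auto intro!: nn_integral_cong simp: indicator_def)
    also have "\<dots> = (\<integral>\<^sup>+j. F i ((i + j) - i) \<partial>count_space UNIV)"
    proof (rule nn_integral_bij_count_space[symmetric])
      show "bij_betw (\<lambda>j. i + j) UNIV ?K"
        by (rule bij_betw_byWitness[where f' = "\<lambda>k. k - i"]) (auto simp: box_iff)
    qed
    finally show "nnsum (\<lambda>k. if i \<in> ?B k then F i (k - i) else 0) = nnsum (F i)" by simp
  qed
  finally show ?thesis .
qed

lemma nrm_cnv:
  assumes "\<rho> \<ge> 0" shows "nrm L \<rho> (cnv X Y) \<le> nrm L \<rho> X * nrm L \<rho> Y"
proof -
  let ?x = "\<lambda>X k. csup L (X k) * ennreal (\<rho> ^ mdeg k)"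
  have "nrm L \<rho> (cnv X Y) \<le> nnsum (\<lambda>k. \<Sum>i\<in>{..fst k} \<times> {..snd k}. ?x X i * ?x Y (k - i))"
    unfolding nrm_def
  proof (rule nn_integral_mono)
    fix k
    have "csup L (cnv X Y k) \<le> (\<Sum>i\<in>{..fst k} \<times> {..snd k}. csup L (X i) * csup L (Y (k - i)))"
      unfolding cnv_def by (rule order_trans[OF csup_sum sum_mono]) (rule csup_mult)
    then have "csup L (cnv X Y k) * ennreal (\<rho> ^ mdeg k) \<le>
        (\<Sum>i\<in>{..fst k} \<times> {..snd k}. csup L (X i) * csup L (Y (k - i))) * ennreal (\<rho> ^ mdeg k)"
      by (rule mult_right_mono) auto
    also have "\<dots> = (\<Sum>i\<in>{..fst k} \<times> {..snd k}. ?x X i * ?x Y (k - i))"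
      unfolding sum_distrib_right
    proof (rule sum.cong)
      fix i assume "i \<in> {..fst k} \<times> {..snd k}"
      then have "ennreal (\<rho> ^ mdeg k) = ennreal (\<rho> ^ mdeg i) * ennreal (\<rho> ^ mdeg (k - i))"
        using assms by (simp add: mdeg_box power_add ennreal_mult)
      then show "csup L (X i) * csup L (Y (k - i)) * ennreal (\<rho> ^ mdeg k) = ?x X i * ?x Y (k - i)"
        by (simp add: mult_ac)
    qed simp
    finally show "?x (cnv X Y) k \<le> (\<Sum>i\<in>{..fst k} \<times> {..snd k}. ?x X i * ?x Y (k - i))" .
  qed
  also have "\<dots> = nnsum (\<lambda>i. nnsum (\<lambda>j. ?x X i * ?x Y j))" by (rule nnsum_box)
  also have "\<dots> = nrm L \<rho> X * nrm L \<rho> Y"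
    unfolding nrm_def by (simp add: nn_integral_cmult nn_integral_multc)
  finally show ?thesis .
qed

text \<open>Both recursion equations of \<open>pw\<close> multiply by one factor \<open>v i\<close>
  and raise the exponent by \<open>ei i\<close>. Two families run in parallel so that powers of
  \<open>v\<close> can be compared with powers of \<open>w\<close>; a statement about one family
  takes \<open>Q\<close> constant in one argument.\<close>

lemma pw_induct2 [case_names unit step]:
  assumes "Q 0 unit_ser unit_ser"
    and "\<And>i k X Y. Q k X Y \<Longrightarrow> Q (ei i + k) (cnv (v i) X) (cnv (w i) Y)"
  shows "Q (a, b) (pw v a b) (pw w a b)"
proof (induction a)
  case 0
  show ?case
  proof (induction b)
    case (Suc b)
    then show ?case using assms(2)[of "(0, b)" _ _ 2] by (simp add: ei_def)
  qed (use assms(1) in \<open>simp add: zero_prod_def\<close>)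
next
  case (Suc a)
  then show ?case using assms(2)[of "(a, b)" _ _ 1] by (simp add: ei_def)
qed

lemma nrm_pw:
  assumes "\<rho> \<ge> 0" "\<And>i. nrm L \<rho> (v i) \<le> V i"
  shows "nrm L \<rho> (pw v a b) \<le> V 1 ^ a * V 2 ^ b"
proof -
  have "nrm L \<rho> (pw v a b) \<le> V 1 ^ fst (a, b) * V 2 ^ snd (a, b)"
  proof (rule pw_induct2[where Q = "\<lambda>k X Y. nrm L \<rho> X \<le> V 1 ^ fst k * V 2 ^ snd k"])
    fix i k and X :: "_ ser"
    assume X: "nrm L \<rho> X \<le> V 1 ^ fst k * V 2 ^ snd k"
    have "nrm L \<rho> (cnv (v i) X) \<le> V i * (V 1 ^ fst k * V 2 ^ snd k)"
      by (rule order_trans[OF nrm_cnv[OF assms(1)] mult_mono[OF assms(2) X]]) auto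
    then show "nrm L \<rho> (cnv (v i) X) \<le> V 1 ^ fst (ei i + k) * V 2 ^ snd (ei i + k)"
      using exhaust_2[of i] by (auto simp: ei_def mult_ac)
  qed (use assms in \<open>simp add: nrm_unit_ser\<close>)
  then show ?thesis by simp
qed

lemma nrm_lcomb:
  assumes "\<rho> \<ge> 0"
  shows "nrm L \<rho> (lcomb h G) \<le> nnsum (\<lambda>k. csup L (h k) * nrm L \<rho> (G k))"
proof -
  have "nrm L \<rho> (lcomb h G) \<le>
      nnsum (\<lambda>j. nnsum (\<lambda>k. csup L (h k) * (csup L (G k j) * ennreal (\<rho> ^ mdeg j))))"
    unfolding nrm_def
  proof (rule nn_integral_mono)
    fix j
    let ?f = "\<lambda>k. csup L (h k) * (csup L (G k j) * ennreal (\<rho> ^ mdeg j))"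
    have "csup L (lcomb h G j) \<le> (\<Sum>k | mdeg k \<le> mdeg j. csup L (h k) * csup L (G k j))"
      unfolding lcomb_def by (rule order_trans[OF csup_sum sum_mono]) (rule csup_mult)
    then have "csup L (lcomb h G j) * ennreal (\<rho> ^ mdeg j) \<le>
        (\<Sum>k | mdeg k \<le> mdeg j. csup L (h k) * csup L (G k j)) * ennreal (\<rho> ^ mdeg j)"
      by (rule mult_right_mono) auto
    also have "\<dots> = (\<Sum>k | mdeg k \<le> mdeg j. ?f k)"
      by (simp add: sum_distrib_right mult.assoc)
    also have "\<dots> \<le> nnsum ?f" by (rule sum_le_nnsum) simp
    finally show "csup L (lcomb h G j) * ennreal (\<rho> ^ mdeg j) \<le> nnsum ?f" .
  qed
  also have "\<dots> = nnsum (\<lambda>k. nnsum (\<lambda>j. csup L (h k) * (csup L (G k j) * ennreal (\<rho> ^ mdeg j))))"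
    by (rule nnsum_swap)
  also have "\<dots> = nnsum (\<lambda>k. csup L (h k) * nrm L \<rho> (G k))"
    unfolding nrm_def by (simp add: nn_integral_cmult)
  finally show ?thesis .
qed


subsection \<open>Evaluation\<close>

definition ev :: "'l ser \<Rightarrow> 'l \<Rightarrow> complex^2 \<Rightarrow> complex" where
  "ev X l x = (\<Sum>\<^sub>\<infinity>k. X k l * mpow x k)"

definition cpoly :: "real \<Rightarrow> (complex^2) set" where
  "cpoly \<rho> = {x. \<forall>i. cmod (x $ i) \<le> \<rho>}"

lemma mpow_add: "mpow x (i + j) = mpow x i * mpow x j"
  by (simp add: mpow_def power_add)

lemma mpow_0 [simp]: "mpow x 0 = 1"
  by (simp add: mpow_def)

lemma mpow_bound:
  assumes "x \<in> cpoly \<rho>" shows "cmod (mpow x k) \<le> \<rho> ^ mdeg k"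
proof -
  have "cmod (x $ 1) ^ fst k * cmod (x $ 2) ^ snd k \<le> \<rho> ^ fst k * \<rho> ^ snd k"
    using assms order_trans[OF norm_ge_zero, of "x $ 1" \<rho>]
    by (intro mult_mono power_mono zero_le_power) (auto simp: cpoly_def)
  then show ?thesis by (simp add: mpow_def mdeg_def norm_mult norm_power power_add)
qed

lemma nnsum_ev:
  assumes "l \<in> L" "x \<in> cpoly \<rho>"
  shows "nnsum (\<lambda>k. ennreal (cmod (X k l * mpow x k))) \<le> nrm L \<rho> X"
  unfolding nrm_def
proof (rule nn_integral_mono)
  fix k
  have "ennreal (cmod (X k l * mpow x k)) = ennreal (cmod (X k l)) * ennreal (cmod (mpow x k))"
    by (simp add: norm_mult ennreal_mult)
  also have "\<dots> \<le> csup L (X k) * ennreal (\<rho> ^ mdeg k)"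
    using assms by (intro mult_mono csup_upper ennreal_leI mpow_bound) auto
  finally show "ennreal (cmod (X k l * mpow x k)) \<le> csup L (X k) * ennreal (\<rho> ^ mdeg k)" .
qed

lemma abs_summable_if_nnsum_finite:
  fixes f :: "'k \<Rightarrow> 'b::real_normed_vector"
  assumes "nnsum (\<lambda>k. ennreal (norm (f k))) < \<infinity>"
  shows "f abs_summable_on UNIV"
  using assms abs_summable_if_nnsum(1)[of f "enn2real (nnsum (\<lambda>k. ennreal (norm (f k))))"]
  by (simp add: less_top)

lemma ev_summable:
  assumes "nrm L \<rho> X < \<infinity>" "l \<in> L" "x \<in> cpoly \<rho>"
  shows "(\<lambda>k. X k l * mpow x k) abs_summable_on UNIV"
  by (rule abs_summable_if_nnsum_finite) (rule le_less_trans[OF nnsum_ev[OF assms(2,3)] assms(1)])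

lemma ev_has_sum:
  assumes "nrm L \<rho> X < \<infinity>" "l \<in> L" "x \<in> cpoly \<rho>"
  shows "((\<lambda>k. X k l * mpow x k) has_sum ev X l x) UNIV"
  unfolding ev_def using abs_summable_summable[OF ev_summable[OF assms]] by (rule has_sum_infsum)

lemma ev_bound:
  assumes "nrm L \<rho> X \<le> ennreal C" "C \<ge> 0" "l \<in> L" "x \<in> cpoly \<rho>"
  shows "cmod (ev X l x) \<le> C"
proof -
  have "nnsum (\<lambda>k. ennreal (cmod (X k l * mpow x k))) \<le> ennreal C"
    using nnsum_ev[OF assms(3,4)] assms(1) by (rule order_trans)
  note * = abs_summable_if_nnsum[OF this assms(2)]
  show ?thesis
    unfolding ev_def by (rule order_trans[OF norm_infsum_bound[OF *(1)] *(2)])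
qed

lemma ev_add:
  assumes "nrm L \<rho> X < \<infinity>" "nrm L \<rho> Y < \<infinity>" "l \<in> L" "x \<in> cpoly \<rho>"
  shows "ev (\<lambda>k l. X k l + Y k l) l x = ev X l x + ev Y l x"
  unfolding ev_def[of "\<lambda>k l. X k l + Y k l"]
  using has_sum_add[OF ev_has_sum[OF assms(1,3,4)] ev_has_sum[OF assms(2,3,4)]]
  by (intro infsumI) (simp add: ring_distribs)

lemma ev_uminus: "ev (\<lambda>k l. - X k l) l x = - ev X l x"
  unfolding ev_def by (simp add: infsum_uminus)

lemma ev_diff:
  assumes "nrm L \<rho> X < \<infinity>" "nrm L \<rho> Y < \<infinity>" "l \<in> L" "x \<in> cpoly \<rho>"
  shows "ev (\<lambda>k l. X k l - Y k l) l x = ev X l x - ev Y l x"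
  using ev_add[of L \<rho> X "\<lambda>k l. - Y k l" l x] assms by (simp add: ev_uminus)

lemma ev_cmult: "ev (\<lambda>k l. c l * X k l) l x = c l * ev X l x"
  unfolding ev_def mult.assoc by (rule infsum_cmult_right')

lemma ev_unit_ser [simp]: "ev unit_ser l x = 1"
proof -
  have "ev unit_ser l x = (\<Sum>\<^sub>\<infinity>k\<in>{0}. unit_ser k l * mpow x k)"
    unfolding ev_def by (rule infsum_cong_neutral) (auto simp: unit_ser_def)
  then show ?thesis by (simp add: unit_ser_def)
qed

text \<open>The Cauchy product theorem: the absolutely summable family \<open>a i * b j\<close> is
  summed once as a product and once along \<open>i + j = k\<close>.\<close>

lemma ev_cnv:
  assumes "nrm L \<rho> X < \<infinity>" "nrm L \<rho> Y < \<infinity>" "l \<in> L" "x \<in> cpoly \<rho>"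
  shows "ev (cnv X Y) l x = ev X l x * ev Y l x"
proof -
  define a where "a k = X k l * mpow x k" for k
  define b where "b k = Y k l * mpow x k" for k
  let ?B = "\<lambda>k::nat \<times> nat. {..fst k} \<times> {..snd k}"
  have a: "a abs_summable_on UNIV" and b: "b abs_summable_on UNIV"
    unfolding a_def b_def by (rule ev_summable[OF assms(1,3,4)], rule ev_summable[OF assms(2-4)])
  have ab: "(\<lambda>(i, j). a i * b j) abs_summable_on UNIV \<times> UNIV"
    unfolding Infinite_Sum.abs_summable_on_Sigma_iff using a b
    by (auto simp: norm_mult infsum_cmult_right' infsum_nonneg
        intro!: summable_on_cmult_right summable_on_cmult_left)
  have bij: "bij_betw (\<lambda>(k, i). (i, k - i)) (Sigma UNIV ?B) (UNIV \<times> UNIV)"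
    by (rule bij_betw_byWitness[where f' = "\<lambda>(i, j). (i + j, i)"]) (auto simp: box_iff)
  have ab': "(\<lambda>(k, i). a i * b (k - i)) summable_on Sigma UNIV ?B"
    using summable_on_reindex_bij_betw[OF bij, of "\<lambda>(i, j). a i * b j"] abs_summable_summable[OF ab]
    by (simp add: case_prod_unfold)
  have "ev (cnv X Y) l x = (\<Sum>\<^sub>\<infinity>k. \<Sum>\<^sub>\<infinity>i\<in>?B k. a i * b (k - i))"
    unfolding ev_def
  proof (rule infsum_cong)
    fix k
    have "cnv X Y k l * mpow x k = (\<Sum>i\<in>?B k. a i * b (k - i))"
      unfolding cnv_def sum_distrib_right
    proof (rule sum.cong)
      fix i assume "i \<in> ?B k"
      then have "mpow x k = mpow x i * mpow x (k - i)" by (simp only: box_iff flip: mpow_add)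
      then show "X i l * Y (k - i) l * mpow x k = a i * b (k - i)" by (simp add: a_def b_def)
    qed simp
    then show "cnv X Y k l * mpow x k = (\<Sum>\<^sub>\<infinity>i\<in>?B k. a i * b (k - i))" by simp
  qed
  also have "\<dots> = infsum (\<lambda>(k, i). a i * b (k - i)) (Sigma UNIV ?B)"
    by (rule infsum_Sigma'_banach[OF ab'])
  also have "\<dots> = infsum (\<lambda>(i, j). a i * b j) (UNIV \<times> UNIV)"
    using infsum_reindex_bij_betw[OF bij, of "\<lambda>(i, j). a i * b j"] by (simp add: case_prod_unfold)
  also have "\<dots> = (\<Sum>\<^sub>\<infinity>i. \<Sum>\<^sub>\<infinity>j. a i * b j)"
    by (rule infsum_Sigma'_banach[symmetric, OF abs_summable_summable[OF ab]])
  also have "\<dots> = ev X l x * ev Y l x"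
    by (simp add: infsum_cmult_right' infsum_cmult_left' ev_def a_def b_def)
  finally show ?thesis .
qed

lemma nrm_pw_finite:
  assumes "\<rho> \<ge> 0" "\<And>i. nrm L \<rho> (v i) < \<infinity>"
  shows "nrm L \<rho> (pw v a b) < \<infinity>"
proof -
  have "nrm L \<rho> (pw v a b) \<le> nrm L \<rho> (v 1) ^ a * nrm L \<rho> (v 2) ^ b"
    by (rule nrm_pw) (use assms in auto)
  also have "\<dots> < \<infinity>"
    using assms(2)[of 1] assms(2)[of 2] by (auto simp: ennreal_mult_less_top power_less_top_ennreal)
  finally show ?thesis .
qed

lemma ev_pw:
  assumes "\<rho> \<ge> 0" "\<And>i. nrm L \<rho> (v i) < \<infinity>" "l \<in> L" "x \<in> cpoly \<rho>"
  shows "ev (pw v a b) l x = mpow (\<chi> i. ev (v i) l x) (a, b)"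
proof -
  let ?Q = "\<lambda>k X Y. nrm L \<rho> X < \<infinity> \<and> ev X l x = mpow (\<chi> i. ev (v i) l x) k"
  have "?Q (a, b) (pw v a b) (pw v a b)"
  proof (rule pw_induct2[where Q = ?Q])
    show "?Q 0 unit_ser unit_ser"
      using nrm_unit_ser[OF assms(1), of L] by (auto intro: le_less_trans)
    fix i k and X Y :: "_ ser" assume X: "?Q k X Y"
    then have "nrm L \<rho> (v i) * nrm L \<rho> X < \<infinity>" using assms(2)[of i] by (simp add: ennreal_mult_less_top)
    then have "nrm L \<rho> (cnv (v i) X) < \<infinity>" by (rule le_less_trans[OF nrm_cnv[OF assms(1)]])
    moreover have "ev (cnv (v i) X) l x = mpow (\<chi> i. ev (v i) l x) (ei i + k)"
      using X exhaust_2[of i] by (auto simp: ev_cnv[OF assms(2) _ assms(3,4)] mpow_def ei_def)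
    ultimately show "?Q (ei i + k) (cnv (v i) X) (cnv (v i) Y)" ..
  qed
  then show ?thesis by simp
qed

text \<open>Interchange of the sums over \<open>k\<close> and \<open>j\<close>. By
  \<open>ord\<close> the column of \<open>j\<close> only contains \<open>k\<close> with
  \<open>mdeg k \<le> mdeg j\<close>, so the cut-off in \<open>lcomb\<close> loses nothing.\<close>

lemma ev_lcomb:
  assumes fin: "nnsum (\<lambda>k. csup L (h k) * nrm L \<rho> (G k)) < \<infinity>"
    and ord: "\<And>k j. mdeg j < mdeg k \<Longrightarrow> G k j l = 0"
    and l: "l \<in> L" and x: "x \<in> cpoly \<rho>"
  shows "((\<lambda>k. h k l * ev (G k) l x) has_sum ev (lcomb h G) l x) UNIV"
proof -
  define F where "F = (\<lambda>(k, j). h k l * (G k j l * mpow x j))"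
  have "nnsum (\<lambda>k. nnsum (\<lambda>j. ennreal (cmod (F (k, j))))) \<le> nnsum (\<lambda>k. csup L (h k) * nrm L \<rho> (G k))"
  proof (rule nn_integral_mono)
    fix k
    have "nnsum (\<lambda>j. ennreal (cmod (F (k, j)))) =
        ennreal (cmod (h k l)) * nnsum (\<lambda>j. ennreal (cmod (G k j l * mpow x j)))"
      by (subst nn_integral_cmult[symmetric]) (auto simp: F_def norm_mult ennreal_mult)
    also have "\<dots> \<le> csup L (h k) * nrm L \<rho> (G k)"
      by (intro mult_mono csup_upper nnsum_ev l x) auto
    finally show "nnsum (\<lambda>j. ennreal (cmod (F (k, j)))) \<le> csup L (h k) * nrm L \<rho> (G k)" .
  qed
  then have "nnsum (\<lambda>p. ennreal (cmod (F p))) < \<infinity>"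
    using fin unfolding nn_integral_fst_count_space[where f = "\<lambda>p. ennreal (cmod (F p))"]
    by (rule le_less_trans)
  then have F: "F summable_on UNIV \<times> UNIV"
    using abs_summable_if_nnsum_finite abs_summable_summable by fastforce
  have F': "(\<lambda>(k, j). F (k, j)) summable_on UNIV \<times> UNIV" using F by simp
  have row: "(\<Sum>\<^sub>\<infinity>j. F (k, j)) = h k l * ev (G k) l x" for k
    by (simp add: F_def ev_def infsum_cmult_right')
  have col: "(\<Sum>\<^sub>\<infinity>k. F (k, j)) = lcomb h G j l * mpow x j" for j
  proof -
    have "(\<Sum>\<^sub>\<infinity>k. F (k, j)) = (\<Sum>\<^sub>\<infinity>k\<in>{k. mdeg k \<le> mdeg j}. F (k, j))"
      by (rule infsum_cong_neutral) (auto simp: F_def ord)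
    then show ?thesis by (simp add: F_def lcomb_def sum_distrib_right mult.assoc)
  qed
  have "(\<lambda>k. \<Sum>\<^sub>\<infinity>j. F (k, j)) summable_on UNIV"
    using summable_on_Sigma_banach[of "\<lambda>k j. F (k, j)" UNIV "\<lambda>_. UNIV"] F by simp
  moreover have "(\<Sum>\<^sub>\<infinity>k. \<Sum>\<^sub>\<infinity>j. F (k, j)) = (\<Sum>\<^sub>\<infinity>j. \<Sum>\<^sub>\<infinity>k. F (k, j))"
    by (rule infsum_swap_banach[OF F'])
  ultimately show ?thesis unfolding row col by (simp add: has_sum_iff ev_def)
qed

subsection \<open>Orders, supports and coefficient algebras\<close>

lemma cnv_order:
  assumes "\<And>k. mdeg k < m \<Longrightarrow> X k l = 0" "\<And>k. mdeg k < n \<Longrightarrow> Y k l = 0" "mdeg k < m + n"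
  shows "cnv X Y k l = 0"
  unfolding cnv_def
proof (rule sum.neutral, rule ballI)
  fix i assume "i \<in> {..fst k} \<times> {..snd k}"
  from mdeg_box[OF this] have "mdeg i < m \<or> mdeg (k - i) < n" using assms(3) by linarith
  then show "X i l * Y (k - i) l = 0" using assms(1,2) by (metis mult_zero_left mult_zero_right)
qed

lemma mdeg_ei [simp]: "mdeg (ei i) = 1"
  by (simp add: ei_def mdeg_def)

lemma pw_order:
  assumes "\<And>i. v i 0 l = 0" "mdeg k < a + b"
  shows "pw v a b k l = 0"
proof -
  have v: "mdeg k < 1 \<Longrightarrow> v i k l = 0" for i k using assms(1) by simp
  have "\<forall>k. mdeg k < mdeg (a, b) \<longrightarrow> pw v a b k l = 0"
  proof (rule pw_induct2[where Q = "\<lambda>e X Y. \<forall>k. mdeg k < mdeg e \<longrightarrow> X k l = 0"])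
    fix i e and X :: "_ ser" assume "\<forall>k. mdeg k < mdeg e \<longrightarrow> X k l = 0"
    then show "\<forall>k. mdeg k < mdeg (ei i + e) \<longrightarrow> cnv (v i) X k l = 0"
      using cnv_order[of 1 "v i" l "mdeg e" X, OF v] by simp
  qed simp
  then show ?thesis using assms(2) by (simp add: mdeg_def)
qed

text \<open>In a nonzero term the first factor has degree at least 1 and the second at least
  \<open>s\<close>. Hence the first has degree below \<open>n\<close>, the second degree below
  \<open>n + s - 1\<close>, and both lie where agreement is assumed.\<close>

lemma cnv_agree:
  assumes v0: "v 0 l = 0" and w0: "w 0 l = 0"
    and vw: "\<And>k. mdeg k < n \<Longrightarrow> v k l = w k l"
    and X: "\<And>k. mdeg k < s \<Longrightarrow> X k l = 0" and Y: "\<And>k. mdeg k < s \<Longrightarrow> Y k l = 0"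
    and XY: "\<And>k. mdeg k + 1 < n + s \<Longrightarrow> X k l = Y k l"
    and k: "mdeg k < n + s"
  shows "cnv v X k l = cnv w Y k l"
  unfolding cnv_def
proof (rule sum.cong)
  fix i assume "i \<in> {..fst k} \<times> {..snd k}"
  from mdeg_box[OF this] have d: "mdeg k = mdeg i + mdeg (k - i)" .
  consider "i = 0" | "mdeg (k - i) < s" | "mdeg i > 0" "mdeg (k - i) \<ge> s" by fastforce
  then show "v i l * X (k - i) l = w i l * Y (k - i) l"
  proof cases
    case 3
    then have "v i l = w i l" "X (k - i) l = Y (k - i) l" using d k by (auto intro!: vw XY)
    then show ?thesis by simp
  qed (use v0 w0 X Y in auto)
qed simp

text \<open>Each of the \<open>a + b\<close> factors takes up degree at least 1, so a single factor
  enters only with degree at most \<open>mdeg k - (a + b - 1)\<close>, which is below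
  \<open>n\<close>.\<close>

lemma pw_agree:
  assumes v0: "\<And>i. v i 0 l = 0" and w0: "\<And>i. w i 0 l = 0"
    and vw: "\<And>i k. mdeg k < n \<Longrightarrow> v i k l = w i k l"
    and k: "mdeg k + 1 < n + (a + b)"
  shows "pw v a b k l = pw w a b k l"
proof -
  let ?Q = "\<lambda>e X Y. (\<forall>k. mdeg k < mdeg e \<longrightarrow> X k l = 0 \<and> Y k l = 0) \<and>
    (\<forall>k. mdeg k + 1 < n + mdeg e \<longrightarrow> X k l = Y k l)"
  have v: "mdeg k < 1 \<Longrightarrow> v i k l = 0" "mdeg k < 1 \<Longrightarrow> w i k l = 0" for i k using v0 w0 by simp_all
  have "?Q (a, b) (pw v a b) (pw w a b)"
  proof (rule pw_induct2[where Q = ?Q])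
    fix i e and X Y :: "_ ser" assume XY: "?Q e X Y"
    then have "mdeg k < n + mdeg e \<Longrightarrow> cnv (v i) X k l = cnv (w i) Y k l" for k
      by (intro cnv_agree[where n = n and s = "mdeg e"] v0 w0 vw) auto
    then show "?Q (ei i + e) (cnv (v i) X) (cnv (w i) Y)"
      using cnv_order[of 1 "v i" l "mdeg e" X, OF v(1)] cnv_order[of 1 "w i" l "mdeg e" Y, OF v(2)] XY
      by auto
  qed simp
  then show ?thesis using k by (simp add: mdeg_def)
qed

definition monoid_set :: "'a::monoid_add set \<Rightarrow> bool" where
  "monoid_set M \<longleftrightarrow> 0 \<in> M \<and> (\<forall>x\<in>M. \<forall>y\<in>M. x + y \<in> M)"

text \<open>Integers are used because \<open>k - ei i\<close> has an entry -1 when the variable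
  \<open>x_i\<close> does not occur in the monomial.\<close>

definition emb :: "nat \<times> nat \<Rightarrow> int \<times> int" where
  "emb k = (int (fst k), int (snd k))"

text \<open>\<open>X\<close> is the monomial with exponent \<open>v\<close> times a Laurent series
  with exponents in \<open>M\<close>. For the component \<open>i\<close> of a map, \<open>v\<close>
  is \<open>emb (ei i)\<close>, so that \<open>M\<close> describes the bracket that multiplies
  \<open>x_i\<close>.\<close>

definition supp :: "(int \<times> int) set \<Rightarrow> int \<times> int \<Rightarrow> 'l ser \<Rightarrow> bool" where
  "supp M v X \<longleftrightarrow> (\<forall>k l. X k l \<noteq> 0 \<longrightarrow> emb k - v \<in> M)"

lemma emb_add: "emb (j + k) = emb j + emb k"
  by (simp add: emb_def)

lemma supp_cnv:
  assumes M: "monoid_set M" and "supp M v X" "supp M w Y"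
  shows "supp M (v + w) (cnv X Y)"
  unfolding supp_def
proof (intro allI impI)
  fix k l assume "cnv X Y k l \<noteq> 0"
  then obtain i where i: "i \<in> {..fst k} \<times> {..snd k}" "X i l * Y (k - i) l \<noteq> 0"
    unfolding cnv_def by (meson sum.not_neutral_contains_not_neutral)
  then have "emb i - v \<in> M" "emb (k - i) - w \<in> M"
    using assms(2,3) unfolding supp_def mult_eq_0_iff by blast+
  then have "emb i - v + (emb (k - i) - w) \<in> M" using M by (auto simp: monoid_set_def)
  moreover have "emb k = emb i + emb (k - i)" using i(1) by (simp only: box_iff flip: emb_add)
  ultimately show "emb k - (v + w) \<in> M" by (simp add: algebra_simps)
qed

lemma supp_unit_ser: "monoid_set M \<Longrightarrow> supp M 0 unit_ser"
  by (auto simp: supp_def unit_ser_def emb_def monoid_set_def zero_prod_def)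

lemma supp_pw:
  assumes M: "monoid_set M" and v: "\<And>i. supp M (emb (ei i)) (v i)"
  shows "supp M (emb (a, b)) (pw v a b)"
proof (rule pw_induct2[where Q = "\<lambda>e X Y. supp M (emb e) X"])
  show "supp M (emb 0) unit_ser" using supp_unit_ser[OF M] by (simp add: emb_def zero_prod_def)
  show "supp M (emb (ei i + e)) (cnv (v i) X)" if "supp M (emb e) X" for i e and X :: "_ ser"
    unfolding emb_add by (rule supp_cnv[OF M v that])
qed

text \<open>Stability of a monoid of exponents under composition; this is what prevents inversion
  and the second removal from creating new exponents.\<close>

lemma supp_lcomb:
  assumes M: "monoid_set M" and h: "supp M w h" and G: "\<And>k. supp M (emb k) (G k)"
  shows "supp M w (lcomb h G)"
  unfolding supp_def
proof (intro allI impI)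
  fix j l assume "lcomb h G j l \<noteq> 0"
  then obtain k where "h k l * G k j l \<noteq> 0"
    unfolding lcomb_def by (meson sum.not_neutral_contains_not_neutral)
  then have "emb k - w \<in> M" "emb j - emb k \<in> M"
    using h G unfolding supp_def mult_eq_0_iff by blast+
  then have "emb k - w + (emb j - emb k) \<in> M" using M unfolding monoid_set_def by blast
  moreover have "emb k - w + (emb j - emb k) = emb j - w" by simp
  ultimately show "emb j - w \<in> M" by (simp only:)
qed

lemma supp_diff: "supp M v X \<Longrightarrow> supp M v Y \<Longrightarrow> supp M v (\<lambda>k l. X k l - Y k l)"
  unfolding supp_def by (metis diff_self)

text \<open>The admissible dependence of coefficients on the parameter. It is instantiated both with
  all functions and with the functions analytic on \<open>L\<close>, so one construction serves
  both. Inversion asks for nonvanishing on \<open>L\<close> only, where the divisors are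
  controlled.\<close>

locale coef_algebra =
  fixes A :: "('l \<Rightarrow> complex) set" and L :: "'l set"
  assumes const: "(\<lambda>l. z) \<in> A"
    and add: "c \<in> A \<Longrightarrow> d \<in> A \<Longrightarrow> (\<lambda>l. c l + d l) \<in> A"
    and mult: "c \<in> A \<Longrightarrow> d \<in> A \<Longrightarrow> (\<lambda>l. c l * d l) \<in> A"
    and inv: "c \<in> A \<Longrightarrow> (\<And>l. l \<in> L \<Longrightarrow> c l \<noteq> 0) \<Longrightarrow> (\<lambda>l. inverse (c l)) \<in> A"
begin

lemma minus: "c \<in> A \<Longrightarrow> (\<lambda>l. - c l) \<in> A"
  using mult[OF const[of "-1"], of c] by simp

lemma diff: "c \<in> A \<Longrightarrow> d \<in> A \<Longrightarrow> (\<lambda>l. c l - d l) \<in> A"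
  using add[of c "\<lambda>l. - d l"] minus by simp

lemma divide: "c \<in> A \<Longrightarrow> d \<in> A \<Longrightarrow> (\<And>l. l \<in> L \<Longrightarrow> d l \<noteq> 0) \<Longrightarrow> (\<lambda>l. c l / d l) \<in> A"
  using mult[OF _ inv, of c d] by (simp add: divide_inverse)

lemma sum: "(\<And>i. i \<in> I \<Longrightarrow> c i \<in> A) \<Longrightarrow> (\<lambda>l. \<Sum>i\<in>I. c i l) \<in> A"
  by (induction I rule: infinite_finite_induct) (auto intro: const add)

lemma power: "c \<in> A \<Longrightarrow> (\<lambda>l. c l ^ n) \<in> A"
  by (induction n) (auto intro: const mult)

lemma cnv: "(\<And>k. X k \<in> A) \<Longrightarrow> (\<And>k. Y k \<in> A) \<Longrightarrow> cnv X Y k \<in> A"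
  unfolding cnv_def by (intro sum mult)

lemma pw:
  assumes "\<And>i k. v i k \<in> A"
  shows "pw v a b k \<in> A"
proof -
  have "\<forall>k. pw v a b k \<in> A"
    by (rule pw_induct2[where Q = "\<lambda>e X Y. \<forall>k. X k \<in> A"])
      (use assms in \<open>auto simp: unit_ser_def intro: const cnv\<close>)
  then show ?thesis by blast
qed

lemma lcomb: "(\<And>k. h k \<in> A) \<Longrightarrow> (\<And>k j. G k j \<in> A) \<Longrightarrow> lcomb h G j \<in> A"
  unfolding lcomb_def by (intro sum mult)

end

text \<open>Every monomial present has degree at least \<open>n\<close>, so shrinking the radius
  gains the \<open>n\<close>-th power of the ratio. With \<open>n = 2\<close> nonlinear terms become
  small compared with \<open>\<rho>\<close>; with \<open>n = 1\<close> a map fixing 0 can be made to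
  land in a given polydisk.\<close>

lemma nrm_scale:
  assumes "\<And>k l. mdeg k < n \<Longrightarrow> l \<in> L \<Longrightarrow> X k l = 0" "0 \<le> \<rho>" "\<rho> \<le> r" "0 < r"
  shows "nrm L \<rho> X \<le> ennreal ((\<rho> / r) ^ n) * nrm L r X"
  unfolding nrm_def
proof (subst nn_integral_cmult[symmetric], simp, rule nn_integral_mono)
  fix k
  show "csup L (X k) * ennreal (\<rho> ^ mdeg k) \<le>
      ennreal ((\<rho> / r) ^ n) * (csup L (X k) * ennreal (r ^ mdeg k))"
  proof (cases "mdeg k < n")
    case True
    then have "csup L (X k) \<le> csup L (\<lambda>l. 0)"
      unfolding csup_def using assms(1) by (intro SUP_mono) auto
    then show ?thesis by simp
  next
    case False
    have "\<rho> ^ mdeg k = (\<rho> / r) ^ mdeg k * r ^ mdeg k" using assms by (simp add: power_divide)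
    also have "\<dots> \<le> (\<rho> / r) ^ n * r ^ mdeg k"
      using False assms by (intro mult_right_mono power_decreasing) auto
    finally have "ennreal (\<rho> ^ mdeg k) \<le> ennreal ((\<rho> / r) ^ n) * ennreal (r ^ mdeg k)"
      using assms by (simp add: ennreal_leI flip: ennreal_mult)
    then have "csup L (X k) * ennreal (\<rho> ^ mdeg k) \<le>
        csup L (X k) * (ennreal ((\<rho> / r) ^ n) * ennreal (r ^ mdeg k))"
      by (rule mult_left_mono) simp
    then show ?thesis by (simp add: mult_ac)
  qed
qed

lemma nrm_mono:
  assumes "0 \<le> \<rho>" "\<rho> \<le> r"
  shows "nrm L \<rho> X \<le> nrm L r X"
  unfolding nrm_def using assms
  by (intro nn_integral_mono mult_left_mono ennreal_leI power_mono) auto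

text \<open>Submultiplicativity bounds the power with exponent \<open>k\<close> by
  \<open>s ^ mdeg k\<close>, which is the weight of the norm of radius \<open>s\<close>.\<close>

lemma nnsum_cmp:
  assumes "\<rho> \<ge> 0" "s \<ge> 0" "\<And>i. nrm L \<rho> (v i) \<le> ennreal s"
  shows "nnsum (\<lambda>k. csup L (h k) * nrm L \<rho> (pw v (fst k) (snd k))) \<le> nrm L s h"
  unfolding nrm_def[of L s]
proof (intro nn_integral_mono mult_left_mono)
  fix k
  have "nrm L \<rho> (pw v (fst k) (snd k)) \<le> ennreal s ^ fst k * ennreal s ^ snd k"
    by (rule nrm_pw[where V = "\<lambda>_. ennreal s"]) (use assms in auto)
  then show "nrm L \<rho> (pw v (fst k) (snd k)) \<le> ennreal (s ^ mdeg k)"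
    using assms by (simp add: mdeg_def power_add ennreal_power flip: ennreal_mult)
qed simp

lemma nrm_cmp:
  assumes "\<rho> \<ge> 0" "s \<ge> 0" "\<And>i. nrm L \<rho> (v i) \<le> ennreal s"
  shows "nrm L \<rho> (cmp h v) \<le> nrm L s h"
  using nrm_lcomb[OF assms(1)] nnsum_cmp[OF assms] by (rule order_trans)

lemma ev_cmp:
  assumes "\<rho> \<ge> 0" "s \<ge> 0" "\<And>i. nrm L \<rho> (v i) \<le> ennreal s" "nrm L s h < \<infinity>"
    and "\<And>i. v i 0 l = 0" "l \<in> L" "x \<in> cpoly \<rho>"
  shows "ev (cmp h v) l x = ev h l (\<chi> i. ev (v i) l x)"
proof -
  have v: "nrm L \<rho> (v i) < \<infinity>" for i
    using assms(3)[of i] by (rule le_less_trans) simp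
  have "((\<lambda>k. h k l * ev (pw v (fst k) (snd k)) l x) has_sum ev (cmp h v) l x) UNIV"
    by (rule ev_lcomb[OF le_less_trans[OF nnsum_cmp[OF assms(1-3)] assms(4)]])
      (use assms in \<open>auto intro: pw_order simp: mdeg_def\<close>)
  then show ?thesis
    using ev_pw[OF assms(1) v assms(6,7)] by (simp add: ev_def[of h] infsumI)
qed

text \<open>Multiplying in one factor gives the difference \<open>(v - w) X + w (X - Y)\<close>, of
  norm at most \<open>\<theta> D B + W \<theta> B \<le> \<theta> V B\<close>. The slack
  \<open>D + W \<le> V\<close> absorbs the factor \<open>a + b\<close> that a derivative estimate
  would produce.\<close>

lemma nrm_pw_diff:
  assumes "\<rho> \<ge> 0" "\<And>i. nrm L \<rho> (v i) \<le> V i" "\<And>i. nrm L \<rho> (w i) \<le> W i"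
    and "\<And>i. nrm L \<rho> (\<lambda>k l. v i k l - w i k l) \<le> \<theta> * D i" "\<And>i. D i + W i \<le> V i"
  shows "nrm L \<rho> (\<lambda>k l. pw v a b k l - pw w a b k l) \<le> \<theta> * (V 1 ^ a * V 2 ^ b)"
proof -
  have step: "nrm L \<rho> (\<lambda>k l. cnv (v i) X k l - cnv (w i) Y k l) \<le> \<theta> * (V i * B)"
    if X: "nrm L \<rho> X \<le> B" and XY: "nrm L \<rho> (\<lambda>k l. X k l - Y k l) \<le> \<theta> * B" for i X Y B
  proof -
    have eq: "(\<lambda>k l. cnv (v i) X k l - cnv (w i) Y k l) =
        (\<lambda>k l. cnv (\<lambda>k l. v i k l - w i k l) X k l + cnv (w i) (\<lambda>k l. X k l - Y k l) k l)"
      by (simp add: cnv_def fun_eq_iff flip: sum_subtractf sum.distrib) (simp add: algebra_simps)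
    have "nrm L \<rho> (\<lambda>k l. cnv (v i) X k l - cnv (w i) Y k l) \<le> (\<theta> * D i) * B + W i * (\<theta> * B)"
      unfolding eq
      by (rule order_trans[OF nrm_add add_mono];
          rule order_trans[OF nrm_cnv[OF assms(1)] mult_mono]) (use assms X XY in auto)
    also have "\<dots> = \<theta> * ((D i + W i) * B)" by (simp add: algebra_simps)
    also have "\<dots> \<le> \<theta> * (V i * B)" by (intro mult_left_mono mult_right_mono assms) auto
    finally show ?thesis .
  qed
  let ?Q = "\<lambda>k X Y. nrm L \<rho> X \<le> V 1 ^ fst k * V 2 ^ snd k \<and>
    nrm L \<rho> (\<lambda>k l. X k l - Y k l) \<le> \<theta> * (V 1 ^ fst k * V 2 ^ snd k)"
  have "?Q (a, b) (pw v a b) (pw w a b)"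
  proof (rule pw_induct2[where Q = ?Q])
    fix i k and X Y :: "_ ser" assume XY: "?Q k X Y"
    have "V i * (V 1 ^ fst k * V 2 ^ snd k) = V 1 ^ fst (ei i + k) * V 2 ^ snd (ei i + k)"
      using exhaust_2[of i] by (auto simp: ei_def mult_ac)
    moreover have "nrm L \<rho> (cnv (v i) X) \<le> V i * (V 1 ^ fst k * V 2 ^ snd k)"
      by (rule order_trans[OF nrm_cnv[OF assms(1)] mult_mono[OF assms(2)]]) (use XY in auto)
    moreover have "nrm L \<rho> (\<lambda>k l. cnv (v i) X k l - cnv (w i) Y k l) \<le>
        \<theta> * (V i * (V 1 ^ fst k * V 2 ^ snd k))"
      by (rule step) (use XY in auto)
    ultimately show "?Q (ei i + k) (cnv (v i) X) (cnv (w i) Y)" by simp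
  qed (simp_all add: nrm_unit_ser assms(1), simp add: nrm_def)
  then show ?thesis by simp
qed

text \<open>The iterates of \<open>\<Phi>\<close> at \<open>0\<close> stabilise degree by degree, so no completeness is needed.\<close>
lemma causal_fixpoint:
  fixes L :: "'l set" and \<rho> :: real
    and \<Phi> :: "('c \<Rightarrow> 'l ser) \<Rightarrow> 'c \<Rightarrow> 'l ser" and E :: "'c \<Rightarrow> ennreal"
    and P :: "'c \<Rightarrow> nat \<times> nat \<Rightarrow> ('l \<Rightarrow> complex) \<Rightarrow> bool"
  defines "B \<equiv> {X. \<forall>c. nrm L \<rho> (X c) \<le> E c \<and> (\<forall>k. P c k (X c k))}"
  assumes ball: "\<And>X. X \<in> B \<Longrightarrow> \<Phi> X \<in> B"
    and causal: "\<And>X Y n c k. X \<in> B \<Longrightarrow> Y \<in> B \<Longrightarrow> (\<And>c k. mdeg k < n \<Longrightarrow> X c k = Y c k) \<Longrightarrow>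
      mdeg k \<le> n \<Longrightarrow> \<Phi> X c k = \<Phi> Y c k"
    and zero: "\<And>c k. P c k (\<lambda>_. 0)"
  shows "\<exists>X\<in>B. \<Phi> X = X"
proof -
  define Z where "Z n = (\<Phi> ^^ n) (\<lambda>_ _ _. 0)" for n
  have ZB: "Z n \<in> B" for n
    by (induction n) (auto simp: Z_def ball, auto simp: B_def zero nrm_def)
  have Z_Suc: "Z (Suc n) = \<Phi> (Z n)" for n
    by (simp add: Z_def)
  have Z_step: "mdeg k < n \<Longrightarrow> Z (Suc n) c k = Z n c k" for n c k
  proof (induction n arbitrary: c k)
    case (Suc n)
    show ?case
      unfolding Z_Suc[of "Suc n"] unfolding Z_Suc[of n]
      by (rule causal[where n = n, OF ball[OF ZB] ZB])
        (use Suc in \<open>simp_all add: Z_Suc less_Suc_eq_le\<close>)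
  qed simp
  have Z_stable: "Z m c k = Z n c k" if "mdeg k < n" "n \<le> m" for m n c k
    using that(2) by (induction m rule: dec_induct) (use Z_step that in auto)
  define X where "X c k = Z (Suc (mdeg k)) c k" for c k
  have XZ: "X c k = Z n c k" if "mdeg k < n" for c k n
    unfolding X_def by (rule Z_stable[symmetric]) (use that in auto)
  have XB: "X \<in> B"
    unfolding B_def
  proof (intro CollectI allI conjI)
    fix c
    \<comment> \<open>Up to degree \<open>n\<close> the limit coincides with the iterate
      \<open>Z (Suc n)\<close>, so every truncated sum inherits the bound.\<close>
    show "nrm L \<rho> (X c) \<le> E c"
      unfolding nrm_def
    proof (rule nnsum_le)
      fix n
      have "(\<Sum>k | mdeg k \<le> n. csup L (X c k) * ennreal (\<rho> ^ mdeg k)) =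
          (\<Sum>k | mdeg k \<le> n. csup L (Z (Suc n) c k) * ennreal (\<rho> ^ mdeg k))"
        by (intro sum.cong) (auto simp: XZ[of _ "Suc n"])
      also have "\<dots> \<le> nrm L \<rho> (Z (Suc n) c)" unfolding nrm_def by (rule sum_le_nnsum) simp
      also have "\<dots> \<le> E c" using ZB by (auto simp: B_def)
      finally show "(\<Sum>k | mdeg k \<le> n. csup L (X c k) * ennreal (\<rho> ^ mdeg k)) \<le> E c" .
    qed
    show "P c k (X c k)" for k using ZB unfolding B_def X_def by blast
  qed
  have "\<Phi> X c k = X c k" for c k
  proof -
    have "\<Phi> X c k = \<Phi> (Z (mdeg k)) c k" by (rule causal[OF XB ZB, where n = "mdeg k"]) (auto simp: XZ)
    also have "\<dots> = X c k" by (simp add: X_def Z_def)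
    finally show ?thesis .
  qed
  then show ?thesis using XB by blast
qed

section \<open>Maps with a diagonal linear part\<close>

definition lin :: "(2 \<Rightarrow> 'l \<Rightarrow> complex) \<Rightarrow> 2 \<Rightarrow> 'l ser" where
  "lin \<mu> i = (\<lambda>k l. if k = ei i then \<mu> i l else 0)"

definition full :: "(2 \<Rightarrow> 'l \<Rightarrow> complex) \<Rightarrow> (2 \<Rightarrow> 'l ser) \<Rightarrow> 2 \<Rightarrow> 'l ser" where
  "full \<mu> X i = (\<lambda>k l. lin \<mu> i k l + X i k l)"

definition EV :: "(2 \<Rightarrow> 'l ser) \<Rightarrow> 'l \<Rightarrow> complex^2 \<Rightarrow> complex^2" where
  "EV v l x = (\<chi> i. ev (v i) l x)"

abbreviation emap :: "(2 \<Rightarrow> 'l \<Rightarrow> complex) \<Rightarrow> (2 \<Rightarrow> 'l ser) \<Rightarrow> 'l \<Rightarrow> complex^2 \<Rightarrow> complex^2" where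
  "emap \<mu> X \<equiv> EV (full \<mu> X)"

abbreviation ones :: "2 \<Rightarrow> 'l \<Rightarrow> complex" where
  "ones \<equiv> \<lambda>_ _. 1"

definition ord2 :: "'l ser \<Rightarrow> bool" where
  "ord2 X \<longleftrightarrow> (\<forall>k l. mdeg k < 2 \<longrightarrow> X k l = 0)"

lemma mpow_ei [simp]: "mpow x (ei i) = x $ i"
  using exhaust_2[of i] by (auto simp: mpow_def ei_def)

lemma nrm_lin:
  assumes "\<And>l. l \<in> L \<Longrightarrow> cmod (\<mu> i l) \<le> m" "\<rho> \<ge> 0" "m \<ge> 0"
  shows "nrm L \<rho> (lin \<mu> i) \<le> ennreal (m * \<rho>)"
proof -
  have "nrm L \<rho> (lin \<mu> i) = (\<Sum>k\<in>{ei i}. csup L (lin \<mu> i k) * ennreal (\<rho> ^ mdeg k))"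
    unfolding nrm_def by (subst nn_integral_count_space'[of "{ei i}"]) (auto simp: lin_def)
  also have "\<dots> = csup L (\<mu> i) * ennreal \<rho>" by (simp add: lin_def)
  also have "\<dots> \<le> ennreal m * ennreal \<rho>"
    by (intro mult_right_mono csup_least ennreal_leI assms) auto
  finally show ?thesis using assms by (simp add: ennreal_mult)
qed

lemma ev_lin: "ev (lin \<mu> i) l x = \<mu> i l * x $ i"
proof -
  have "ev (lin \<mu> i) l x = (\<Sum>\<^sub>\<infinity>k\<in>{ei i}. lin \<mu> i k l * mpow x k)"
    unfolding ev_def by (rule infsum_cong_neutral) (auto simp: lin_def)
  then show ?thesis by (simp add: lin_def)
qed

lemma full_0: "ord2 (X i) \<Longrightarrow> full \<mu> X i 0 l = 0"
  by (cases "i = 1") (simp_all add: full_def lin_def ord2_def ei_def zero_prod_def mdeg_def)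

lemma supp_full: "monoid_set M \<Longrightarrow> supp M (emb (ei i)) (X i) \<Longrightarrow> supp M (emb (ei i)) (full \<mu> X i)"
  by (auto simp: supp_def full_def lin_def monoid_set_def)

lemma (in coef_algebra) lin: "\<mu> i \<in> A \<Longrightarrow> lin \<mu> i k \<in> A"
  by (cases "k = ei i") (auto simp: lin_def intro: const)

lemma (in coef_algebra) full: "\<mu> i \<in> A \<Longrightarrow> X i k \<in> A \<Longrightarrow> full \<mu> X i k \<in> A"
  unfolding full_def by (intro add lin)

lemma nrm_full:
  assumes "\<And>l. l \<in> L \<Longrightarrow> cmod (\<mu> i l) \<le> m" "\<rho> \<ge> 0" "m \<ge> 0" "nrm L \<rho> (X i) \<le> ennreal (c * \<rho>)" "c \<ge> 0"
  shows "nrm L \<rho> (full \<mu> X i) \<le> ennreal ((m + c) * \<rho>)"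
proof -
  have "nrm L \<rho> (full \<mu> X i) \<le> ennreal (m * \<rho>) + ennreal (c * \<rho>)"
    unfolding full_def by (rule order_trans[OF nrm_add add_mono]) (use assms in \<open>auto intro: nrm_lin\<close>)
  then show ?thesis using assms by (simp add: distrib_right)
qed

lemma nrm_subset: "L' \<subseteq> L \<Longrightarrow> nrm L' \<rho> X \<le> nrm L \<rho> X"
  unfolding nrm_def csup_def by (intro nn_integral_mono mult_right_mono SUP_subset_mono) auto

lemma EV_full:
  assumes "nrm L \<rho> (X i) < \<infinity>" "l \<in> L" "x \<in> cpoly \<rho>" "\<rho> \<ge> 0"
  shows "emap \<mu> X l x $ i = \<mu> i l * x $ i + ev (X i) l x"
proof -
  \<comment> \<open>\<open>\<mu> i\<close> may be unbounded on \<open>L\<close>; over the single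
    parameter \<open>l\<close> the norm of the linear part is finite.\<close>
  have "nrm {l} \<rho> (X i) < \<infinity>"
    using nrm_subset[of "{l}" L \<rho> "X i"] assms(1,2) by (auto intro: le_less_trans)
  moreover have "nrm {l} \<rho> (lin \<mu> i) < \<infinity>"
    by (rule le_less_trans[OF nrm_lin[of _ \<mu> i "cmod (\<mu> i l)"]]) (use assms in auto)
  ultimately show ?thesis
    using ev_add[of "{l}" \<rho> "lin \<mu> i" "X i" l x] assms by (simp add: EV_def full_def ev_lin)
qed


subsection \<open>Solving the conjugacy equation\<close>

lemma ennreal_bound_obtain:
  assumes "\<And>i::2. f i < (\<infinity>::ennreal)"
  obtains N where "N > 0" "\<And>i. f i \<le> ennreal N"
proof -
  \<comment> \<open>The summand 1 keeps \<open>N\<close> positive, so that radii can be defined by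
    dividing by it.\<close>
  define N where "N = enn2real (f 1) + enn2real (f 2) + 1"
  have "f i \<le> ennreal N" for i
  proof -
    have "f i = ennreal (enn2real (f i))" using assms[of i] by (simp add: less_top)
    also have "\<dots> \<le> ennreal N" using exhaust_2[of i] by (auto simp: N_def intro!: ennreal_leI)
    finally show ?thesis .
  qed
  moreover have "N > 0" by (simp add: N_def add_nonneg_pos)
  ultimately show ?thesis using that by blast
qed

lemma ord2_lcomb: "ord2 h \<Longrightarrow> ord2 (lcomb h G)"
  unfolding ord2_def lcomb_def by (auto intro!: sum.neutral)

text \<open>Since \<open>F\<close> has order 2, only products of at least two factors occur, and in
  these a factor enters only with degree below the total degree. This is the causality of
  \<open>F \<circ> h\<close>.\<close>

lemma cmp_agree:
  assumes F: "ord2 F" and v0: "\<And>i. v i 0 l = 0" and w0: "\<And>i. w i 0 l = 0"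
    and vw: "\<And>i k. mdeg k < n \<Longrightarrow> v i k l = w i k l" and j: "mdeg j \<le> n"
  shows "cmp F v j l = cmp F w j l"
  unfolding lcomb_def
proof (rule sum.cong)
  fix k
  show "F k l * pw v (fst k) (snd k) j l = F k l * pw w (fst k) (snd k) j l"
  proof (cases "mdeg k < 2")
    case False
    then have "pw v (fst k) (snd k) j l = pw w (fst k) (snd k) j l"
      by (intro pw_agree[where n = n] v0 w0 vw) (use j in \<open>auto simp: mdeg_def\<close>)
    then show ?thesis by simp
  qed (use F in \<open>simp add: ord2_def\<close>)
qed simp

lemma EV_cpoly:
  assumes "\<And>i. nrm L \<rho> (v i) \<le> ennreal s" "s \<ge> 0" "l \<in> L" "x \<in> cpoly \<rho>"
  shows "EV v l x \<in> cpoly s"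
  using ev_bound[OF assms(1-4)] by (simp add: cpoly_def EV_def)

context coef_algebra
begin

definition good :: "(int \<times> int) set \<Rightarrow> real \<Rightarrow> (2 \<Rightarrow> 'l ser) \<Rightarrow> bool" where
  "good M r F \<longleftrightarrow> (\<forall>i. ord2 (F i) \<and> (\<forall>k. F i k \<in> A) \<and> supp M (emb (ei i)) (F i) \<and> nrm L r (F i) < \<infinity>)"

lemma good_mono:
  assumes "good M r F" "0 \<le> \<rho>" "\<rho> \<le> r" "M \<subseteq> M'"
  shows "good M' \<rho> F"
  unfolding good_def
proof (intro allI conjI)
  fix i
  show "nrm L \<rho> (F i) < \<infinity>"
    using assms(1) unfolding good_def by (metis le_less_trans[OF nrm_mono[OF assms(2,3)]])
  show "supp M' (emb (ei i)) (F i)" using assms(1,4) unfolding good_def supp_def by blast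
qed (use assms(1) in \<open>auto simp: good_def\<close>)

text \<open>With \<open>\<iota> = 1 / \<mu>\<close> the nonlinear part solves
  \<open>X = - \<iota> (F \<circ> (\<iota> + X))\<close>. The right-hand side is quadratically small
  in the radius, and the monoid \<open>M\<close> is preserved because composition preserves
  it.\<close>

lemma right_inverse:
  assumes M: "monoid_set M" and F: "good M r F" and r: "r > 0"
    and \<mu>A: "\<And>i. \<mu> i \<in> A" and \<mu>: "\<And>i l. l \<in> L \<Longrightarrow> \<kappa> \<le> cmod (\<mu> i l)" and \<kappa>: "\<kappa> > 0"
  shows "\<exists>\<rho> G. \<rho> > 0 \<and> good M \<rho> G \<and>
    (\<forall>l\<in>L. \<forall>x\<in>cpoly \<rho>. emap \<mu> F l (EV (full (\<lambda>i l. inverse (\<mu> i l)) G) l x) = x)"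
proof -
  define \<iota> where "\<iota> = (\<lambda>i l. inverse (\<mu> i l))"
  have \<iota>A: "\<iota> i \<in> A" for i
    unfolding \<iota>_def
  proof (intro inv \<mu>A)
    show "\<mu> i l \<noteq> 0" if "l \<in> L" for l using \<mu>[OF that, of i] \<kappa> by auto
  qed
  have \<iota>: "cmod (\<iota> i l) \<le> 1 / \<kappa>" if "l \<in> L" for i l
    using \<mu>[OF that, of i] \<kappa> by (simp add: \<iota>_def norm_inverse inverse_eq_divide frac_le norm_divide)
  obtain N where N: "N > 0" "\<And>i. nrm L r (F i) \<le> ennreal N"
    using F ennreal_bound_obtain[of "\<lambda>i. nrm L r (F i)"] by (auto simp: good_def)
  \<comment> \<open>The norm of \<open>\<iota> + X\<close> is at most \<open>c * \<rho>\<close>: the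
    linear part contributes \<open>1 / \<kappa>\<close> and \<open>X\<close>, taken from the ball of
    radius \<open>\<rho>\<close>, contributes 1.\<close>
  define c where "c = 1 / \<kappa> + 1"
  have c: "c > 1" using \<kappa> by (simp add: c_def)
  \<comment> \<open>The first entry keeps \<open>c * \<rho>\<close> within the domain
    \<open>r\<close>; the second makes the quadratic bound for \<open>F\<close>, multiplied by
    \<open>1 / \<kappa>\<close>, at most \<open>\<rho>\<close>.\<close>
  define \<rho> where "\<rho> = min (r / c) (\<kappa> * r\<^sup>2 / (c\<^sup>2 * N))"
  have \<rho>: "\<rho> > 0" using r c \<kappa> N by (simp add: \<rho>_def)
  have cr: "c * \<rho> \<le> r" using c by (simp add: \<rho>_def min_def field_simps)
  have small: "1 / \<kappa> * ((c * \<rho> / r)\<^sup>2 * N) \<le> \<rho>"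
  proof -
    have "\<rho> \<le> \<kappa> * r\<^sup>2 / (c\<^sup>2 * N)" by (simp add: \<rho>_def)
    then have "\<rho> * (c\<^sup>2 * N) \<le> \<kappa> * r\<^sup>2" using c N by (simp add: field_simps)
    then have "\<rho> * (\<rho> * (c\<^sup>2 * N)) \<le> \<rho> * (\<kappa> * r\<^sup>2)" using \<rho> by (intro mult_left_mono) auto
    then show ?thesis using \<kappa> r by (simp add: field_simps power2_eq_square)
  qed
  \<comment> \<open>Order, support and membership in \<open>A\<close> are imposed on each
    coefficient separately, so they pass to a limit in which each coefficient is eventually
    constant.\<close>
  define P where "P i k z \<longleftrightarrow> z \<in> A \<and> (mdeg k < 2 \<longrightarrow> z = (\<lambda>_. 0)) \<and> ((\<exists>l. z l \<noteq> 0) \<longrightarrow> emb k - emb (ei i) \<in> M)"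
    for i k z
  define B where "B = {X. \<forall>i. nrm L \<rho> (X i) \<le> ennreal \<rho> \<and> (\<forall>k. P i k (X i k))}"
  have B: "ord2 (X i)" "X i k \<in> A" "supp M (emb (ei i)) (X i)" "nrm L \<rho> (X i) \<le> ennreal \<rho>"
    if "X \<in> B" for X i k
  proof -
    from that have *: "nrm L \<rho> (X i) \<le> ennreal \<rho>" "\<And>k. P i k (X i k)" by (simp_all add: B_def)
    show "ord2 (X i)" "X i k \<in> A" "supp M (emb (ei i)) (X i)" "nrm L \<rho> (X i) \<le> ennreal \<rho>"
      using * by (auto simp: P_def ord2_def supp_def)
  qed
  have nv: "nrm L \<rho> (full \<iota> X i) \<le> ennreal (c * \<rho>)" if "X \<in> B" for X i
    unfolding c_def by (rule nrm_full) (use \<iota> \<kappa> \<rho> B(4)[OF that] in auto)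
  define \<Phi> where "\<Phi> X i = (\<lambda>k l. - \<iota> i l * cmp (F i) (full \<iota> X) k l)" for X i
  have nF: "nrm L \<rho> (cmp (F i) (full \<iota> X)) \<le> ennreal ((c * \<rho> / r)\<^sup>2 * N)" if "X \<in> B" for X i
  proof -
    have "nrm L \<rho> (cmp (F i) (full \<iota> X)) \<le> nrm L (c * \<rho>) (F i)"
      by (rule nrm_cmp) (use nv[OF that] \<rho> c in auto)
    also have "\<dots> \<le> ennreal ((c * \<rho> / r)\<^sup>2) * nrm L r (F i)"
      by (rule nrm_scale) (use F \<rho> c cr r in \<open>auto simp: good_def ord2_def\<close>)
    also have "\<dots> \<le> ennreal ((c * \<rho> / r)\<^sup>2) * ennreal N" by (intro mult_left_mono N) auto
    finally show ?thesis using N by (simp add: ennreal_mult)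
  qed
  have "\<exists>X\<in>B. \<Phi> X = X"
    unfolding B_def
  proof (rule causal_fixpoint, fold B_def)
    fix X assume X: "X \<in> B"
    have "nrm L \<rho> (\<Phi> X i) \<le> ennreal \<rho>" for i
    proof -
      have "nrm L \<rho> (\<Phi> X i) \<le> ennreal (1 / \<kappa>) * nrm L \<rho> (cmp (F i) (full \<iota> X))"
        unfolding \<Phi>_def
      proof (rule nrm_bound)
        fix k l assume l: "l \<in> L"
        show "cmod (- \<iota> i l * cmp (F i) (full \<iota> X) k l) \<le> 1 / \<kappa> * cmod (cmp (F i) (full \<iota> X) k l)"
          unfolding norm_mult norm_minus_cancel by (intro mult_right_mono \<iota> l) simp
      qed (use \<kappa> in simp)
      also have "\<dots> \<le> ennreal (1 / \<kappa>) * ennreal ((c * \<rho> / r)\<^sup>2 * N)"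
        by (intro mult_left_mono nF X) auto
      also have "\<dots> = ennreal (1 / \<kappa> * ((c * \<rho> / r)\<^sup>2 * N))"
        using \<kappa> N by (intro ennreal_mult[symmetric]) auto
      also have "\<dots> \<le> ennreal \<rho>" by (rule ennreal_leI[OF small])
      finally show ?thesis .
    qed
    moreover have "P i k (\<Phi> X i k)" for i k
    proof -
      have "ord2 (cmp (F i) (full \<iota> X))" by (rule ord2_lcomb) (use F in \<open>auto simp: good_def\<close>)
      moreover have "supp M (emb (ei i)) (cmp (F i) (full \<iota> X))"
      proof (rule supp_lcomb[OF M])
        show "supp M (emb k) (pw (full \<iota> X) (fst k) (snd k))" for k
          using supp_pw[OF M supp_full[where X = X and \<mu> = \<iota>, OF M B(3)[OF X]], of "fst k" "snd k"] by simp
      qed (use F in \<open>simp add: good_def\<close>)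
      moreover have "cmp (F i) (full \<iota> X) k \<in> A"
        by (intro lcomb pw full \<iota>A B(2)[OF X]) (use F in \<open>auto simp: good_def\<close>)
      ultimately show ?thesis
        unfolding P_def \<Phi>_def ord2_def supp_def by (auto intro!: mult minus \<iota>A)
    qed
    ultimately show "\<Phi> X \<in> B" by (simp add: B_def)
  next
    fix X Y n i k
    assume XY: "X \<in> B" "Y \<in> B" "\<And>i k. mdeg k < n \<Longrightarrow> X i k = Y i k" "mdeg k \<le> n"
    have "cmp (F i) (full \<iota> X) k l = cmp (F i) (full \<iota> Y) k l" for l
    proof (rule cmp_agree[where n = n])
      show "full \<iota> X i k l = full \<iota> Y i k l" if "mdeg k < n" for i k
        using XY(3)[OF that] by (simp add: full_def)
    qed (use F XY in \<open>auto simp: good_def intro!: full_0 B(1)\<close>)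
    then show "\<Phi> X i k = \<Phi> Y i k" by (simp add: \<Phi>_def)
  next
    show "P i k (\<lambda>_. 0)" for i k by (simp add: P_def const)
  qed
  then obtain X where X: "X \<in> B" "\<Phi> X = X" by blast
  have fin: "nrm L \<rho> (X i) < \<infinity>" for i using B(4)[OF X(1), of i] by (rule le_less_trans) simp
  have "good M \<rho> X" unfolding good_def using B[OF X(1)] fin by auto
  moreover have "emap \<mu> F l (emap \<iota> X l x) = x" if l: "l \<in> L" and x: "x \<in> cpoly \<rho>" for l x
  proof -
    define y where "y = emap \<iota> X l x"
    have y: "y \<in> cpoly (c * \<rho>)"
      unfolding y_def by (rule EV_cpoly[OF nv[OF X(1)]]) (use c \<rho> l x in auto)
    have nF: "nrm L (c * \<rho>) (F i) < \<infinity>" for i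
      using good_mono[OF F _ cr order_refl] c \<rho> by (auto simp: good_def)
    have "emap \<mu> F l y $ i = x $ i" for i
    proof -
      have "\<mu> i l \<noteq> 0" using \<mu>[OF l, of i] \<kappa> by auto
      have "ev (X i) l x = ev (\<Phi> X i) l x" using X(2) by simp
      also have "\<dots> = - \<iota> i l * ev (cmp (F i) (full \<iota> X)) l x"
        unfolding \<Phi>_def using ev_cmult[of "\<lambda>l. - \<iota> i l"] by simp
      also have "ev (cmp (F i) (full \<iota> X)) l x = ev (F i) l y"
        unfolding y_def EV_def
        by (rule ev_cmp[where s = "c * \<rho>"])
          (use \<rho> c nv[OF X(1)] nF l x B(1)[OF X(1)] in \<open>auto intro!: full_0\<close>)
      finally have 1: "ev (X i) l x = - \<iota> i l * ev (F i) l y" .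
      have 2: "y $ i = \<iota> i l * x $ i + ev (X i) l x"
        unfolding y_def by (rule EV_full[OF fin l x]) (use \<rho> in auto)
      have "emap \<mu> F l y $ i = \<mu> i l * y $ i + ev (F i) l y"
        by (rule EV_full[OF nF l y]) (use c \<rho> in auto)
      then show ?thesis unfolding 2 1 using \<open>\<mu> i l \<noteq> 0\<close> by (simp add: \<iota>_def field_simps)
    qed
    then show ?thesis by (simp add: vec_eq_iff y_def)
  qed
  ultimately show ?thesis using \<rho> unfolding \<iota>_def by blast
qed

end

text \<open>Coefficients of \<open>H\<close> of the top degree \<open>n\<close> drop out: they meet
  the degree \<open>n\<close> part of a difference of two \<open>n\<close>-fold products, which
  vanishes because \<open>v\<close> and \<open>w\<close> have the same linear part. This makes
  \<open>H \<circ> g - H \<circ> L\<close> causal although \<open>H \<circ> g\<close> alone is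
  not.\<close>

lemma lcomb_diff_agree:
  assumes H: "ord2 H" "ord2 H'" and HH': "\<And>k. mdeg k < n \<Longrightarrow> H k l = H' k l"
    and v0: "\<And>i. v i 0 l = 0" "\<And>i. v' i 0 l = 0" "\<And>i. w i 0 l = 0"
    and vv': "\<And>i k. mdeg k < n \<Longrightarrow> v i k l = v' i k l"
    and vw: "\<And>i k. mdeg k < 2 \<Longrightarrow> v i k l = w i k l" "\<And>i k. mdeg k < 2 \<Longrightarrow> v' i k l = w i k l"
    and j: "mdeg j \<le> n"
  shows "lcomb H (\<lambda>k j l. pw v (fst k) (snd k) j l - pw w (fst k) (snd k) j l) j l =
    lcomb H' (\<lambda>k j l. pw v' (fst k) (snd k) j l - pw w (fst k) (snd k) j l) j l"
  unfolding lcomb_def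
proof (rule sum.cong)
  fix k assume "k \<in> {k. mdeg k \<le> mdeg j}"
  then have k: "mdeg k \<le> mdeg j" by simp
  let ?d = "\<lambda>v. pw v (fst k) (snd k) j l - pw w (fst k) (snd k) j l"
  consider "mdeg k < 2" | "2 \<le> mdeg k" "mdeg k < n" | "2 \<le> mdeg k" "mdeg k = mdeg j" "n = mdeg j"
    using k j by linarith
  then show "H k l * ?d v = H' k l * ?d v'"
  proof cases
    case 1
    then show ?thesis using H by (simp add: ord2_def)
  next
    case 2
    then have "pw v (fst k) (snd k) j l = pw v' (fst k) (snd k) j l"
      by (intro pw_agree[where n = n] v0 vv') (use j in \<open>auto simp: mdeg_def\<close>)
    then show ?thesis using HH' 2 by simp
  next
    case 3
    have "pw v (fst k) (snd k) j l = pw w (fst k) (snd k) j l"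
      "pw v' (fst k) (snd k) j l = pw w (fst k) (snd k) j l"
      by (rule pw_agree[where n = 2]; use v0 vw 3 in \<open>auto simp: mdeg_def\<close>)+
    then show ?thesis by simp
  qed
qed simp

text \<open>Comparing coefficients, \<open>\<mu>\<^sub>i H\<^sub>k - \<mu>\<^sup>k H\<^sub>k - G\<^sub>k = D\<^sub>k\<close>, where \<open>D = (H \<circ> g - H \<circ> L) - F \<circ> h\<close> only involves
  coefficients of lower degree; it is solved for \<open>H\<^sub>k\<close> on \<open>S\<close> and for \<open>G\<^sub>k\<close> elsewhere. The difference
  \<open>H \<circ> g - H \<circ> L\<close> is small because \<open>H\<close> is supported in \<open>S\<close>, where \<open>\<mu>\<^sup>k\<close> is bounded even if \<open>\<mu>\<close> is
  slightly enlarged.\<close>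
lemma has_sum_diff:
  fixes f g :: "'a \<Rightarrow> 'b::topological_ab_group_add"
  assumes "(f has_sum a) A" "(g has_sum b) A"
  shows "((\<lambda>x. f x - g x) has_sum (a - b)) A"
  using has_sum_add[OF assms(1), of "\<lambda>x. - g x" "- b"] assms(2) by (simp add: has_sum_uminus)

text \<open>\<open>C i\<close> bounds the enlarged monomials over all exponents to be removed from
  the component \<open>i\<close>, and \<open>d\<close> then is a lower bound for the divisor
  \<open>\<mu>_i - \<mu>^k\<close> on \<open>L\<close>. The enlargement \<open>\<epsilon>\<close>
  leaves room for the nonlinear part of \<open>g\<close>.\<close>

definition contracting :: "'l set \<Rightarrow> (2 \<Rightarrow> 'l \<Rightarrow> complex) \<Rightarrow> (int \<times> int) set \<Rightarrow> bool" where
  "contracting L \<mu> T \<longleftrightarrow> (\<exists>(m :: 2 \<Rightarrow> real) (C :: 2 \<Rightarrow> real) \<epsilon> d. \<epsilon> > 0 \<and> d > 0 \<and>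
     (\<forall>i. m i \<ge> 0 \<and> C i \<ge> 0 \<and> (\<forall>l\<in>L. cmod (\<mu> i l) \<le> m i \<and> C i + d \<le> cmod (\<mu> i l)) \<and>
       (\<forall>k. mdeg k \<ge> 2 \<and> emb k - emb (ei i) \<in> T \<longrightarrow>
         (m 1 + \<epsilon>) ^ fst k * (m 2 + \<epsilon>) ^ snd k \<le> C i)))"

context coef_algebra
begin

lemma normal_form_step:
  assumes M: "monoid_set M" and F: "good M r F" and r: "r > 0"
    and \<mu>A: "\<And>i. \<mu> i \<in> A" and contracting: "contracting L \<mu> (M \<inter> S)"
  obtains \<rho> H G where "\<rho> > 0" "good M \<rho> H" "good (M - S) \<rho> G"
    "\<And>l x. l \<in> L \<Longrightarrow> x \<in> cpoly \<rho> \<Longrightarrow> emap \<mu> F l (emap ones H l x) =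
      emap ones H l (emap \<mu> G l x)"
proof -
  from contracting obtain m C :: "2 \<Rightarrow> real" and \<eta> d where *: "\<eta> > 0 \<and> d > 0 \<and>
     (\<forall>i. m i \<ge> 0 \<and> C i \<ge> 0 \<and> (\<forall>l\<in>L. cmod (\<mu> i l) \<le> m i \<and> C i + d \<le> cmod (\<mu> i l)) \<and>
       (\<forall>k. mdeg k \<ge> 2 \<and> emb k - emb (ei i) \<in> M \<inter> S \<longrightarrow>
         (m 1 + \<eta>) ^ fst k * (m 2 + \<eta>) ^ snd k \<le> C i))"
    unfolding contracting_def by (elim exE) (rule that)
  then have \<eta>: "\<eta> > 0" and d: "d > 0" and m: "\<And>i. m i \<ge> 0" and C: "\<And>i. C i \<ge> 0"
    and \<mu>m: "\<And>i l. l \<in> L \<Longrightarrow> cmod (\<mu> i l) \<le> m i"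
    and gap: "\<And>i l. l \<in> L \<Longrightarrow> C i + d \<le> cmod (\<mu> i l)"
    and contr: "\<And>i k. mdeg k \<ge> 2 \<Longrightarrow> emb k - emb (ei i) \<in> M \<inter> S \<Longrightarrow>
      (m 1 + \<eta>) ^ fst k * (m 2 + \<eta>) ^ snd k \<le> C i"
    by blast+
  obtain N where N: "N > 0" "\<And>i. nrm L r (F i) \<le> ennreal N"
    using F ennreal_bound_obtain[of "\<lambda>i. nrm L r (F i)"] by (auto simp: good_def)

  \<comment> \<open>Choice of the constants\<close>
  define CC where "CC = C 1 + C 2 + 1"
  have CC: "C i \<le> CC" "CC > 0" for i
    using exhaust_2[of i] C[of 1] C[of 2] by (auto simp: CC_def)
  \<comment> \<open>Solving for \<open>H\<close> divides by at least \<open>d\<close> in modulus,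
    solving for \<open>G\<close> by 1; \<open>d'\<close> serves both.\<close>
  define d' where "d' = min 1 d"
  have d': "d' > 0" "d' \<le> 1" "d' \<le> d" using d by (auto simp: d'_def)
  \<comment> \<open>\<open>\<epsilon> * \<rho>\<close> is the radius of the ball for
    \<open>H\<close> and \<open>G\<close>. The last entry lets
    \<open>H \<circ> g - H \<circ> L\<close> use half of the admissible size
    \<open>d' * (\<epsilon> * \<rho>)\<close>.\<close>
  define \<epsilon> where "\<epsilon> = min (min 1 \<eta>) (d' * \<eta> / (2 * CC))"
  have \<epsilon>: "\<epsilon> > 0" "\<epsilon> \<le> 1" "\<epsilon> \<le> \<eta>" using \<eta> d' CC by (auto simp: \<epsilon>_def)
  have \<epsilon>': "\<epsilon> / \<eta> * CC \<le> d' / 2"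
  proof -
    have "\<epsilon> \<le> d' * \<eta> / (2 * CC)" by (simp add: \<epsilon>_def)
    then show ?thesis using \<eta> CC by (simp add: field_simps)
  qed
  \<comment> \<open>\<open>2 * \<rho> \<le> r\<close> because \<open>h\<close> has norm at most
    \<open>2 * \<rho>\<close>. The second entry confines the quadratic term
    \<open>F \<circ> h\<close> to the other half of the admissible size.\<close>
  define \<rho> where "\<rho> = min (r / 2) (d' * \<epsilon> * r\<^sup>2 / (8 * N))"
  have \<rho>: "\<rho> > 0" "2 * \<rho> \<le> r" using r d' \<epsilon> N by (auto simp: \<rho>_def min_def)
  have small2: "(2 * \<rho> / r)\<^sup>2 * N \<le> d' / 2 * (\<epsilon> * \<rho>)"
  proof -
    have "\<rho> \<le> d' * \<epsilon> * r\<^sup>2 / (8 * N)" by (simp add: \<rho>_def)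
    then have "\<rho> * (8 * N) \<le> d' * \<epsilon> * r\<^sup>2" using N by (simp add: field_simps)
    then have "\<rho> * (\<rho> * (8 * N)) \<le> \<rho> * (d' * \<epsilon> * r\<^sup>2)" using \<rho> by (intro mult_left_mono) auto
    then show ?thesis using r by (simp add: field_simps power2_eq_square)
  qed
  have small: "\<epsilon> / \<eta> * CC * (\<epsilon> * \<rho>) + (2 * \<rho> / r)\<^sup>2 * N \<le> d' * (\<epsilon> * \<rho>)"
  proof -
    have "\<epsilon> / \<eta> * CC * (\<epsilon> * \<rho>) \<le> d' / 2 * (\<epsilon> * \<rho>)" using \<epsilon>' \<epsilon> \<rho> by (intro mult_right_mono) auto
    then show ?thesis using small2 by linarith
  qed

  \<comment> \<open>Unknowns and the fixed point operator\<close>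
  define res where "res i k \<longleftrightarrow> emb k - emb (ei i) \<in> S" for i k
  define pk where "pk k l = \<mu> 1 l ^ fst k * \<mu> 2 l ^ snd k" for k l
  define V where "V k = (m 1 + \<eta>) ^ fst k * (m 2 + \<eta>) ^ snd k" for k :: "nat \<times> nat"
  have pk: "cmod (pk k l) \<le> V k" if "l \<in> L" for k l
  proof -
    have "cmod (\<mu> i l) \<le> m i + \<eta>" "0 \<le> m i + \<eta>" for i
      using \<mu>m[OF that, of i] m[of i] \<eta> by linarith+
    then show ?thesis
      unfolding pk_def V_def norm_mult norm_power
      by (intro mult_mono power_mono mult_nonneg_nonneg zero_le_power) auto
  qed
  have V0: "V k \<ge> 0" for k
    unfolding V_def using m \<eta> by (intro mult_nonneg_nonneg zero_le_power) (auto intro: add_nonneg_nonneg)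
  have div: "d \<le> cmod (\<mu> i l - pk k l)"
    if "l \<in> L" "mdeg k \<ge> 2" "res i k" "emb k - emb (ei i) \<in> M" for i k l
  proof -
    have "cmod (pk k l) \<le> C i" using pk[OF that(1), of k] contr[of k i] that by (auto simp: V_def res_def)
    moreover have "cmod (\<mu> i l) - cmod (pk k l) \<le> cmod (\<mu> i l - pk k l)" by (rule norm_triangle_ineq2)
    ultimately show ?thesis using gap[OF that(1), of i] by linarith
  qed

  \<comment> \<open>The unknowns are one family: \<open>(True, i)\<close> indexes
    \<open>H_i\<close>, supported on the exponents in \<open>S\<close>, and
    \<open>(False, i)\<close> indexes \<open>G_i\<close>, supported on the others.\<close>
  define P where "P c k z \<longleftrightarrow> z \<in> A \<and> (\<forall>l. z l \<noteq> 0 \<longrightarrow>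
      mdeg k \<ge> 2 \<and> emb k - emb (ei (snd c)) \<in> M \<and> fst c = res (snd c) k)" for c :: "bool \<times> 2" and k z
  define B where "B = {X. \<forall>c. nrm L \<rho> (X c) \<le> ennreal (\<epsilon> * \<rho>) \<and> (\<forall>k. P c k (X c k))}"
  have B: "ord2 (X c)" "X c k \<in> A" "supp M (emb (ei (snd c))) (X c)" "nrm L \<rho> (X c) \<le> ennreal (\<epsilon> * \<rho>)"
    "X c k l \<noteq> 0 \<Longrightarrow> fst c = res (snd c) k"
    if "X \<in> B" for X c k l
  proof -
    from that have *: "nrm L \<rho> (X c) \<le> ennreal (\<epsilon> * \<rho>)" "\<And>k. P c k (X c k)" by (simp_all add: B_def)
    show "ord2 (X c)" "X c k \<in> A" "supp M (emb (ei (snd c))) (X c)" "nrm L \<rho> (X c) \<le> ennreal (\<epsilon> * \<rho>)"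
      using * by (auto simp: P_def ord2_def supp_def not_le[symmetric])
    show "X c k l \<noteq> 0 \<Longrightarrow> fst c = res (snd c) k"
      using *(2)[of k] unfolding P_def by blast
  qed
  define hh where "hh X = full ones (\<lambda>i. X (True, i))" for X :: "bool \<times> 2 \<Rightarrow> 'l ser"
  define gg where "gg X = full \<mu> (\<lambda>i. X (False, i))" for X :: "bool \<times> 2 \<Rightarrow> 'l ser"
  define dd where "dd X = (\<lambda>k j l. pw (gg X) (fst k) (snd k) j l - pw (lin \<mu>) (fst k) (snd k) j l)"
    for X :: "bool \<times> 2 \<Rightarrow> 'l ser"
  define D where "D X i = (\<lambda>k l. lcomb (X (True, i)) (dd X) k l - cmp (F i) (hh X) k l)" for X i
  define \<Phi> where "\<Phi> X c = (\<lambda>k l. if fst c \<noteq> res (snd c) k then 0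
      else if fst c then D X (snd c) k l / (\<mu> (snd c) l - pk k l) else - D X (snd c) k l)" for X c

  \<comment> \<open>Norm estimates on the ball\<close>
  have hh0: "hh X i 0 l = 0" and gg0: "gg X i 0 l = 0" if "X \<in> B" for X i l
    using B(1)[OF that] by (auto simp: hh_def gg_def intro!: full_0)
  have lin0: "lin \<mu> i 0 l = 0" for i l
    using full_0[of "\<lambda>_ _ _. 0" i \<mu> l] by (simp add: full_def ord2_def)
  have nhh: "nrm L \<rho> (hh X i) \<le> ennreal (2 * \<rho>)" if "X \<in> B" for X i
  proof -
    have "nrm L \<rho> (hh X i) \<le> ennreal ((1 + \<epsilon>) * \<rho>)"
      unfolding hh_def by (rule nrm_full) (use \<rho> \<epsilon> B(4)[OF that] in auto)
    also have "\<dots> \<le> ennreal (2 * \<rho>)" using \<epsilon> \<rho> by (intro ennreal_leI mult_right_mono) auto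
    finally show ?thesis .
  qed
  have ngg: "nrm L \<rho> (gg X i) \<le> ennreal ((m i + \<eta>) * \<rho>)" if "X \<in> B" for X i
  proof -
    have "nrm L \<rho> (gg X i) \<le> ennreal ((m i + \<epsilon>) * \<rho>)"
      unfolding gg_def by (rule nrm_full) (use \<rho> \<epsilon> \<mu>m m B(4)[OF that] in auto)
    also have "\<dots> \<le> ennreal ((m i + \<eta>) * \<rho>)" using \<epsilon> \<rho> by (intro ennreal_leI mult_right_mono) auto
    finally show ?thesis .
  qed
  have nlin: "nrm L \<rho> (lin \<mu> i) \<le> ennreal (m i * \<rho>)" for i
    by (rule nrm_lin) (use \<mu>m m \<rho> in auto)
  \<comment> \<open>The nonlinear part of \<open>g\<close> has norm at most
    \<open>\<epsilon> * \<rho>\<close>, which is \<open>\<epsilon> / \<eta>\<close> times the slack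
    \<open>\<eta> * \<rho>\<close> between the bound of the linear part and the factors of
    \<open>V\<close>.\<close>
  have ndd: "nrm L \<rho> (dd X k) \<le> ennreal (\<epsilon> / \<eta> * (V k * \<rho> ^ mdeg k))" if "X \<in> B" for X k
  proof -
    have "nrm L \<rho> (dd X k) \<le> ennreal (\<epsilon> / \<eta>) *
        (ennreal ((m 1 + \<eta>) * \<rho>) ^ fst k * ennreal ((m 2 + \<eta>) * \<rho>) ^ snd k)"
      unfolding dd_def
    proof (rule nrm_pw_diff)
      show "nrm L \<rho> (\<lambda>k l. gg X i k l - lin \<mu> i k l) \<le> ennreal (\<epsilon> / \<eta>) * ennreal (\<eta> * \<rho>)" for i
        using B(4)[OF that, of "(False, i)"] \<epsilon> \<eta> \<rho>
        by (simp add: gg_def full_def flip: ennreal_mult)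
      show "ennreal (\<eta> * \<rho>) + ennreal (m i * \<rho>) \<le> ennreal ((m i + \<eta>) * \<rho>)" for i
        using \<eta> \<rho> m[of i] by (simp add: algebra_simps flip: ennreal_plus)
    qed (use \<rho> ngg[OF that] nlin in auto)
    also have "\<dots> = ennreal (\<epsilon> / \<eta> * (V k * \<rho> ^ mdeg k))"
      using m[of 1] m[of 2] \<eta> \<epsilon> \<rho>
      by (simp add: V_def mdeg_def ennreal_power power_mult_distrib power_add mult_ac flip: ennreal_mult)
    finally show ?thesis .
  qed
  have Vbound: "V k \<le> CC" if "X \<in> B" "X (True, i) k l \<noteq> 0" for X i k l
  proof -
    have "\<not> mdeg k < 2" "res i k" "emb k - emb (ei i) \<in> M"
      using B(1,3)[OF that(1), of "(True, i)"] B(5)[OF that(1), of "(True, i)" k l] that(2)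
      by (auto simp: ord2_def supp_def)
    then show ?thesis using contr[of k i] CC(1)[of i] by (auto simp: V_def res_def)
  qed
  \<comment> \<open>\<open>H\<close> only contains removed exponents, for which
    \<open>V k \<le> CC\<close>; therefore its norm at the same radius \<open>\<rho>\<close>
    suffices.\<close>
  have nlc: "nnsum (\<lambda>k. csup L (X (True, i) k) * nrm L \<rho> (dd X k)) \<le>
      ennreal (\<epsilon> / \<eta> * CC * (\<epsilon> * \<rho>))" if X: "X \<in> B" for X i
  proof -
    have "nnsum (\<lambda>k. csup L (X (True, i) k) * nrm L \<rho> (dd X k)) \<le>
        nnsum (\<lambda>k. ennreal (\<epsilon> / \<eta> * CC) * (csup L (X (True, i) k) * ennreal (\<rho> ^ mdeg k)))"
    proof (rule nn_integral_mono)
      fix k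
      show "csup L (X (True, i) k) * nrm L \<rho> (dd X k) \<le>
          ennreal (\<epsilon> / \<eta> * CC) * (csup L (X (True, i) k) * ennreal (\<rho> ^ mdeg k))"
      proof (cases "\<exists>l. X (True, i) k l \<noteq> 0")
        case True
        then have Vk: "V k \<le> CC" using Vbound[OF X] by blast
        have "nrm L \<rho> (dd X k) \<le> ennreal (\<epsilon> / \<eta> * (V k * \<rho> ^ mdeg k))" by (rule ndd[OF X])
        also have "\<dots> \<le> ennreal (\<epsilon> / \<eta> * (CC * \<rho> ^ mdeg k))"
          using Vk \<epsilon> \<eta> \<rho> by (intro ennreal_leI mult_left_mono mult_right_mono) auto
        also have "\<dots> = ennreal (\<epsilon> / \<eta> * CC) * ennreal (\<rho> ^ mdeg k)"
          using \<epsilon> \<eta> \<rho> CC(2) by (simp add: mult.assoc flip: ennreal_mult)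
        finally have "csup L (X (True, i) k) * nrm L \<rho> (dd X k) \<le>
            csup L (X (True, i) k) * (ennreal (\<epsilon> / \<eta> * CC) * ennreal (\<rho> ^ mdeg k))"
          by (rule mult_left_mono) simp
        then show ?thesis by (simp add: mult_ac)
      next
        case False
        then have "X (True, i) k = (\<lambda>l. 0)" by auto
        then show ?thesis by simp
      qed
    qed
    also have "\<dots> = ennreal (\<epsilon> / \<eta> * CC) * nrm L \<rho> (X (True, i))"
      unfolding nrm_def by (intro nn_integral_cmult) auto
    also have "\<dots> \<le> ennreal (\<epsilon> / \<eta> * CC) * ennreal (\<epsilon> * \<rho>)" by (intro mult_left_mono B(4)[OF X]) auto
    also have "\<dots> = ennreal (\<epsilon> / \<eta> * CC * (\<epsilon> * \<rho>))"
      using \<epsilon> \<eta> \<rho> CC(2) by (intro ennreal_mult[symmetric]) auto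
    finally show ?thesis .
  qed
  have nF2: "nrm L (2 * \<rho>) (F i) \<le> ennreal ((2 * \<rho> / r)\<^sup>2 * N)" for i
  proof -
    have "nrm L (2 * \<rho>) (F i) \<le> ennreal ((2 * \<rho> / r)\<^sup>2) * nrm L r (F i)"
      by (rule nrm_scale) (use F \<rho> r in \<open>auto simp: good_def ord2_def\<close>)
    also have "\<dots> \<le> ennreal ((2 * \<rho> / r)\<^sup>2) * ennreal N" by (intro mult_left_mono N) auto
    finally show ?thesis using N by (simp add: ennreal_mult)
  qed
  have ncmp: "nrm L \<rho> (cmp (F i) (hh X)) \<le> ennreal ((2 * \<rho> / r)\<^sup>2 * N)" if "X \<in> B" for X i
    by (rule order_trans[OF nrm_cmp nF2]) (use nhh[OF that] \<rho> in auto)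
  have nD: "nrm L \<rho> (D X i) \<le> ennreal (d' * (\<epsilon> * \<rho>))" if X: "X \<in> B" for X i
  proof -
    have "nrm L \<rho> (D X i) \<le> ennreal (\<epsilon> / \<eta> * CC * (\<epsilon> * \<rho>)) + ennreal ((2 * \<rho> / r)\<^sup>2 * N)"
      unfolding D_def
    proof (rule order_trans[OF nrm_diff add_mono[OF _ ncmp[OF X]]])
      show "nrm L \<rho> (lcomb (X (True, i)) (dd X)) \<le> ennreal (\<epsilon> / \<eta> * CC * (\<epsilon> * \<rho>))"
        by (rule order_trans[OF nrm_lcomb nlc[OF X]]) (use \<rho> in simp)
    qed
    also have "\<dots> = ennreal (\<epsilon> / \<eta> * CC * (\<epsilon> * \<rho>) + (2 * \<rho> / r)\<^sup>2 * N)"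
      using \<epsilon> \<eta> \<rho> CC(2) N(1) by (intro ennreal_plus[symmetric]) auto
    also have "\<dots> \<le> ennreal (d' * (\<epsilon> * \<rho>))" by (rule ennreal_leI[OF small])
    finally show ?thesis .
  qed

  \<comment> \<open>Order, support and parameter dependence of \<open>D\<close>\<close>
  have D_ord2: "ord2 (D X i)" if "X \<in> B" for X i
  proof -
    have "ord2 (lcomb (X (True, i)) (dd X))" by (rule ord2_lcomb[OF B(1)[OF that]])
    moreover have "ord2 (cmp (F i) (hh X))" by (rule ord2_lcomb) (use F in \<open>simp add: good_def\<close>)
    ultimately show ?thesis by (simp add: ord2_def D_def)
  qed
  have D_supp: "supp M (emb (ei i)) (D X i)" if X: "X \<in> B" for X i
  proof -
    have hs: "supp M (emb (ei i)) (hh X i)" and gs: "supp M (emb (ei i)) (gg X i)" for i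
      unfolding hh_def gg_def by (rule supp_full[OF M]; use B(3)[OF X, of "(_, i)"] in simp)+
    have ls: "supp M (emb (ei i)) (lin \<mu> i)" for i
      using supp_full[OF M, of i "\<lambda>_ _ _. 0" \<mu>] by (simp add: full_def supp_def)
    show ?thesis
      unfolding D_def
    proof (intro supp_diff supp_lcomb[OF M])
      show "supp M (emb k) (dd X k)" for k
        using supp_diff[OF supp_pw[of M "gg X" "fst k" "snd k"] supp_pw[of M "lin \<mu>" "fst k" "snd k"]] M gs ls
        by (simp add: dd_def)
      show "supp M (emb k) (pw (hh X) (fst k) (snd k))" for k
        using supp_pw[of M "hh X" "fst k" "snd k"] M hs by simp
    qed (use F B(3)[OF X, of "(True, i)"] in \<open>auto simp: good_def\<close>)
  qed
  have D_A: "D X i k \<in> A" if X: "X \<in> B" for X i k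
    unfolding D_def hh_def dd_def gg_def
    by (intro diff lcomb pw full lin const \<mu>A B(2)[OF X]) (use F in \<open>auto simp: good_def\<close>)
  have pk_A: "pk k \<in> A" for k
    unfolding pk_def by (intro mult power \<mu>A)

  \<comment> \<open>Existence of the fixed point\<close>
  have "\<exists>X\<in>B. \<Phi> X = X"
    unfolding B_def
  proof (rule causal_fixpoint, fold B_def)
    fix X assume X: "X \<in> B"
    have "nrm L \<rho> (\<Phi> X c) \<le> ennreal (\<epsilon> * \<rho>)" for c
    proof -
      have "nrm L \<rho> (\<Phi> X c) \<le> ennreal (1 / d') * nrm L \<rho> (D X (snd c))"
      proof (rule nrm_bound)
        fix k l assume l: "l \<in> L"
        show "cmod (\<Phi> X c k l) \<le> 1 / d' * cmod (D X (snd c) k l)"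
        proof (cases "fst c = res (snd c) k \<and> D X (snd c) k l \<noteq> 0")
          case True
          then have k: "mdeg k \<ge> 2" "emb k - emb (ei (snd c)) \<in> M"
            using D_ord2[OF X, of "snd c"] D_supp[OF X, of "snd c"] by (auto simp: ord2_def supp_def not_le[symmetric])
          show ?thesis
          proof (cases "fst c")
            case c: True
            then have "d' \<le> cmod (\<mu> (snd c) l - pk k l)" using div[OF l k(1) _ k(2)] True d' by force
            then have "cmod (D X (snd c) k l) / cmod (\<mu> (snd c) l - pk k l) \<le> cmod (D X (snd c) k l) / d'"
              using d' by (intro divide_left_mono mult_pos_pos) auto
            then show ?thesis using True c by (simp add: \<Phi>_def norm_divide)
          next
            case c: False
            have "d' * cmod (D X (snd c) k l) \<le> 1 * cmod (D X (snd c) k l)"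
              using d' by (intro mult_right_mono) auto
            then show ?thesis using True c d' by (simp add: \<Phi>_def field_simps)
          qed
        next
          case False
          then have "\<Phi> X c k l = 0" by (auto simp: \<Phi>_def)
          then show ?thesis using d' by simp
        qed
      qed (use d' in simp)
      also have "\<dots> \<le> ennreal (1 / d') * ennreal (d' * (\<epsilon> * \<rho>))" by (intro mult_left_mono nD X) auto
      also have "\<dots> = ennreal (\<epsilon> * \<rho>)" using d' \<epsilon> \<rho> by (simp flip: ennreal_mult)
      finally show ?thesis .
    qed
    moreover have "P c k (\<Phi> X c k)" for c k
    proof -
      have "\<Phi> X c k \<in> A"
      proof (cases "fst c = res (snd c) k")
        case c: True
        show ?thesis
        \<comment> \<open>One nonzero value of \<open>D\<close> already places \<open>k\<close>
          where \<open>div\<close> bounds the divisor for all parameters in \<open>L\<close>. If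
          \<open>D\<close> vanishes identically, the quotient is 0, which is again
          \<open>- D\<close>.\<close>
        proof (cases "fst c \<and> (\<exists>l. D X (snd c) k l \<noteq> 0)")
          case True
          then have k: "mdeg k \<ge> 2" "emb k - emb (ei (snd c)) \<in> M"
            using D_ord2[OF X, of "snd c"] D_supp[OF X, of "snd c"] by (auto simp: ord2_def supp_def not_le[symmetric])
          have "(\<lambda>l. D X (snd c) k l / (\<mu> (snd c) l - pk k l)) \<in> A"
          proof (intro divide D_A X diff \<mu>A pk_A)
            fix l assume "l \<in> L"
            from div[OF this k(1) _ k(2)] show "\<mu> (snd c) l - pk k l \<noteq> 0" using True c d by force
          qed
          then show ?thesis using True c by (simp add: \<Phi>_def)
        next
          case False
          then have "\<Phi> X c k = (\<lambda>l. - D X (snd c) k l)" using c by (auto simp: \<Phi>_def)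
          then show ?thesis using minus[OF D_A[OF X]] by simp
        qed
      qed (simp add: \<Phi>_def const)
      moreover have "mdeg k \<ge> 2 \<and> emb k - emb (ei (snd c)) \<in> M \<and> fst c = res (snd c) k"
        if "\<Phi> X c k l \<noteq> 0" for l
      proof -
        have "fst c = res (snd c) k" "D X (snd c) k l \<noteq> 0"
          using that by (auto simp: \<Phi>_def split: if_splits)
        then show ?thesis
          using D_ord2[OF X, of "snd c"] D_supp[OF X, of "snd c"] by (auto simp: ord2_def supp_def not_le[symmetric])
      qed
      ultimately show ?thesis by (simp add: P_def)
    qed
    ultimately show "\<Phi> X \<in> B" by (simp add: B_def)
  next
    fix X Y n c k
    assume XY: "X \<in> B" "Y \<in> B" "\<And>c k. mdeg k < n \<Longrightarrow> X c k = Y c k" "mdeg k \<le> n"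
    have "lcomb (X (True, i)) (dd X) k l = lcomb (Y (True, i)) (dd Y) k l" for i l
      unfolding dd_def
    proof (rule lcomb_diff_agree[where n = n])
      show "gg X i k l = gg Y i k l" if "mdeg k < n" for i k
        using XY(3)[OF that] by (simp add: gg_def full_def)
      show "gg X i k l = lin \<mu> i k l" "gg Y i k l = lin \<mu> i k l" if "mdeg k < 2" for i k
        using B(1)[OF XY(1)] B(1)[OF XY(2)] that by (auto simp: gg_def full_def ord2_def)
    qed (use XY gg0 lin0 in \<open>auto intro!: B(1)\<close>)
    moreover have "cmp (F i) (hh X) k l = cmp (F i) (hh Y) k l" for i l
    proof (rule cmp_agree[where n = n])
      show "hh X i k l = hh Y i k l" if "mdeg k < n" for i k
        using XY(3)[OF that] by (simp add: hh_def full_def)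
    qed (use F XY hh0 in \<open>auto simp: good_def\<close>)
    ultimately have *: "D X i k l = D Y i k l" for i l by (simp add: D_def)
    show "\<Phi> X c k = \<Phi> Y c k" unfolding \<Phi>_def * by (rule refl)
  next
    show "P c k (\<lambda>_. 0)" for c k by (simp add: P_def const)
  qed
  then obtain X where X: "X \<in> B" "\<Phi> X = X" by blast
  define H where "H i = X (True, i)" for i
  define G where "G i = X (False, i)" for i
  have fin: "nrm L \<rho> (X c) < \<infinity>" for c using B(4)[OF X(1), of c] by (rule le_less_trans) simp

  \<comment> \<open>From the coefficient equations to the identity of maps\<close>
  have rel: "\<mu> i l * H i k l - pk k l * H i k l - G i k l = D X i k l" if l: "l \<in> L" for i k l
  proof (cases "D X i k l = 0")
    case True
    then have "\<Phi> X (True, i) k l = 0" "\<Phi> X (False, i) k l = 0" by (auto simp: \<Phi>_def)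
    then show ?thesis using True X(2) by (simp add: H_def G_def)
  next
    case False
    then have k: "mdeg k \<ge> 2" "emb k - emb (ei i) \<in> M"
      using D_ord2[OF X(1), of i] D_supp[OF X(1), of i] by (auto simp: ord2_def supp_def not_le[symmetric])
    have XX: "X c k l = \<Phi> X c k l" for c using X(2) by simp
    show ?thesis
    proof (cases "res i k")
      case True
      have "\<mu> i l - pk k l \<noteq> 0" using div[OF l k(1) True k(2)] d by force
      moreover have "H i k l = D X i k l / (\<mu> i l - pk k l)" "G i k l = 0"
        using True XX[of "(True, i)"] XX[of "(False, i)"] by (simp_all add: H_def G_def \<Phi>_def)
      ultimately show ?thesis by (simp add: field_simps)
    next
      case False
      have "H i k l = 0" "G i k l = - D X i k l"
        using False XX[of "(True, i)"] XX[of "(False, i)"] by (simp_all add: H_def G_def \<Phi>_def)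
      then show ?thesis by simp
    qed
  qed

  \<comment> \<open>\<open>g\<close> and its linear part enlarge a polydisk at most by the factor
    \<open>K\<close>. From radius \<open>\<sigma> = \<rho> / K\<close> both land in
    \<open>cpoly \<rho>\<close>, where \<open>H\<close> converges.\<close>
  define K where "K = 1 + m 1 + m 2 + \<eta>"
  have K: "K \<ge> 1" "m i + \<eta> \<le> K" for i
    using m[of 1] m[of 2] \<eta> exhaust_2[of i] by (auto simp: K_def)
  define \<sigma> where "\<sigma> = \<rho> / K"
  have \<sigma>: "\<sigma> > 0" "\<sigma> \<le> \<rho>"
    using K(1) \<rho>(1) divide_left_mono[of 1 K \<rho>] by (auto simp: \<sigma>_def)
  have m\<sigma>: "(m i + \<eta>) * \<sigma> \<le> \<rho>" for i
    using mult_right_mono[OF K(2)[of i], of \<sigma>] K(1) \<sigma>(1) by (simp add: \<sigma>_def)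
  have "emap \<mu> F l (emap ones H l x) = emap ones H l (emap \<mu> G l x)"
    if l: "l \<in> L" and x: "x \<in> cpoly \<sigma>" for l x
  proof -
    have x': "x \<in> cpoly \<rho>" using x \<sigma> by (auto simp: cpoly_def intro: order_trans)
    define y where "y = emap ones H l x"
    define z where "z = emap \<mu> G l x"
    define w where "w = (\<chi> i. \<mu> i l * x $ i)"
    have hX: "hh X = full ones H" and gX: "gg X = full \<mu> G"
      unfolding hh_def gg_def H_def[abs_def] G_def[abs_def] by (rule refl)+
    have y: "y \<in> cpoly (2 * \<rho>)"
      unfolding y_def hX[symmetric] by (rule EV_cpoly[OF nhh[OF X(1)] _ l x']) (use \<rho> in simp)
    have ngs: "nrm L \<sigma> (gg X i) \<le> ennreal \<rho>" for i
    proof -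
      have "nrm L \<sigma> (gg X i) \<le> ennreal ((\<sigma> / \<rho>) ^ 1) * nrm L \<rho> (gg X i)"
        by (rule nrm_scale) (use \<sigma> \<rho> gg0[OF X(1)] in auto)
      also have "\<dots> \<le> ennreal ((\<sigma> / \<rho>) ^ 1) * ennreal ((m i + \<eta>) * \<rho>)"
        by (intro mult_left_mono ngg X(1)) simp
      also have "\<dots> = ennreal ((m i + \<eta>) * \<sigma>)"
        using \<sigma> \<rho> m[of i] \<eta> by (simp flip: ennreal_mult)
      also have "\<dots> \<le> ennreal \<rho>" by (rule ennreal_leI[OF m\<sigma>])
      finally show ?thesis .
    qed
    have z: "z \<in> cpoly \<rho>"
      unfolding z_def gX[symmetric] by (rule EV_cpoly[OF ngs _ l x]) (use \<rho> in simp)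
    have w: "w \<in> cpoly \<rho>"
      unfolding cpoly_def
    proof (intro CollectI allI)
      fix i
      have "cmod (\<mu> i l) * cmod (x $ i) \<le> (m i + \<eta>) * \<sigma>"
        using \<mu>m[OF l, of i] m[of i] \<eta> x by (intro mult_mono) (auto simp: cpoly_def)
      then show "cmod (w $ i) \<le> \<rho>" using m\<sigma>[of i] by (simp add: w_def norm_mult)
    qed
    have mw: "mpow w k = pk k l * mpow x k" for k
      by (simp add: mpow_def w_def pk_def power_mult_distrib)
    have fing: "nrm L \<rho> (gg X i) < \<infinity>" and finl: "nrm L \<rho> (lin \<mu> i) < \<infinity>" for i
      using le_less_trans[OF ngg[OF X(1)]] le_less_trans[OF nlin] by auto
    have finF: "nrm L (2 * \<rho>) (F i) < \<infinity>" for i using nF2 by (rule le_less_trans) simp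
    have "emap \<mu> F l y $ i = emap ones H l z $ i" for i
    proof -
      have ev_dd: "ev (dd X k) l x = mpow z k - mpow w k" for k
      proof -
        have "ev (dd X k) l x = ev (pw (gg X) (fst k) (snd k)) l x - ev (pw (lin \<mu>) (fst k) (snd k)) l x"
          unfolding dd_def by (rule ev_diff[OF nrm_pw_finite nrm_pw_finite l x']) (use \<rho> fing finl in auto)
        also have "\<dots> = mpow z k - mpow w k"
          using ev_pw[where v = "gg X", OF _ fing l x'] ev_pw[where v = "lin \<mu>", OF _ finl l x'] \<rho>
          by (simp add: z_def w_def gX EV_def ev_lin)
        finally show ?thesis .
      qed
      have "((\<lambda>k. H i k l * ev (dd X k) l x) has_sum ev (lcomb (H i) (dd X)) l x) UNIV"
      proof (rule ev_lcomb[OF _ _ l x'])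
        show "nnsum (\<lambda>k. csup L (H i k) * nrm L \<rho> (dd X k)) < \<infinity>"
          unfolding H_def by (rule le_less_trans[OF nlc[OF X(1)]]) simp
        show "dd X k j l = 0" if "mdeg j < mdeg k" for k j
          using that pw_order[of "gg X" l j "fst k" "snd k"] pw_order[of "lin \<mu>" l j "fst k" "snd k"]
            gg0[OF X(1)] lin0 by (simp add: dd_def mdeg_def)
      qed
      moreover have "((\<lambda>k. H i k l * ev (dd X k) l x) has_sum ev (H i) l z - ev (H i) l w) UNIV"
        using has_sum_diff[OF ev_has_sum[of L \<rho> "H i" l z] ev_has_sum[of L \<rho> "H i" l w]]
          fin l z w by (simp add: H_def ev_dd right_diff_distrib)
      ultimately have 1: "ev (lcomb (H i) (dd X)) l x = ev (H i) l z - ev (H i) l w"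
        by (rule has_sum_unique)
      have 2: "ev (cmp (F i) (hh X)) l x = ev (F i) l y"
        unfolding y_def EV_def hX[symmetric]
        by (rule ev_cmp[where s = "2 * \<rho>"]) (use \<rho> nhh[OF X(1)] finF hh0[OF X(1)] l x' in auto)
      have 3: "ev (D X i) l x = ev (H i) l z - ev (H i) l w - ev (F i) l y"
        unfolding D_def
        by (subst ev_diff[OF _ _ l x'])
          (use le_less_trans[OF order_trans[OF nrm_lcomb nlc[OF X(1)]]] le_less_trans[OF ncmp[OF X(1)]] \<rho> 1 2
            in \<open>auto simp: H_def\<close>)
      \<comment> \<open>The value of \<open>D\<close> is computed a second time, from
        \<open>rel\<close>: the terms \<open>pk k l * H i k l\<close> add up to \<open>H\<close> at
        \<open>w\<close>, the image of \<open>x\<close> under the linear part.\<close>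
      have "((\<lambda>k. D X i k l * mpow x k) has_sum \<mu> i l * ev (H i) l x - ev (H i) l w - ev (G i) l x) UNIV"
        using has_sum_diff[OF has_sum_diff[OF has_sum_cmult_right[of _ _ _ "\<mu> i l",
          OF ev_has_sum[of L \<rho> "H i" l x]] ev_has_sum[of L \<rho> "H i" l w]] ev_has_sum[of L \<rho> "G i" l x]]
          fin l x' w by (simp add: H_def G_def mw algebra_simps flip: rel[OF l])
      then have "ev (D X i) l x = \<mu> i l * ev (H i) l x - ev (H i) l w - ev (G i) l x"
        unfolding ev_def[of "D X i"] by (rule infsumI)
      then have 4: "\<mu> i l * ev (H i) l x + ev (F i) l y = ev (H i) l z + ev (G i) l x"
        unfolding 3 by (simp add: algebra_simps)
      have "emap \<mu> F l y $ i = \<mu> i l * y $ i + ev (F i) l y"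
        by (rule EV_full[OF finF l y]) (use \<rho> in simp)
      also have "y $ i = 1 * x $ i + ev (H i) l x"
        unfolding y_def by (rule EV_full[of L, OF _ l x']) (use \<rho> fin in \<open>auto simp: H_def\<close>)
      also have "\<mu> i l * (1 * x $ i + ev (H i) l x) + ev (F i) l y =
          1 * (\<mu> i l * x $ i + ev (G i) l x) + ev (H i) l z"
        using 4 by (simp add: algebra_simps)
      also have "\<mu> i l * x $ i + ev (G i) l x = z $ i"
        unfolding z_def by (rule EV_full[of L, OF _ l x', symmetric]) (use \<rho> fin in \<open>auto simp: G_def\<close>)
      also have "1 * z $ i + ev (H i) l z = emap ones H l z $ i"
        by (rule EV_full[of L, OF _ l z, symmetric]) (use \<rho> fin in \<open>auto simp: H_def\<close>)
      finally show ?thesis .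
    qed
    then show ?thesis by (simp add: vec_eq_iff y_def z_def)
  qed
  moreover have "good M \<sigma> H"
  proof (rule good_mono)
    show "good M \<rho> H" unfolding good_def H_def using B[OF X(1), of "(True, _)"] fin by simp
  qed (use \<sigma> in auto)
  moreover have "good (M - S) \<sigma> G"
  proof (rule good_mono)
    have "emb k - emb (ei i) \<in> M - S" if "G i k l \<noteq> 0" for i k l
      using B(3)[OF X(1), of "(False, i)"] B(5)[OF X(1), of "(False, i)" k l] that
      by (auto simp: G_def res_def supp_def)
    then show "good (M - S) \<rho> G" unfolding good_def G_def using B[OF X(1), of "(False, _)"] fin
      by (simp add: supp_def)
  qed (use \<sigma> in auto)
  ultimately show ?thesis using \<sigma> that by blast
qed

end

lemma cpoly_mono: "\<rho> \<le> r \<Longrightarrow> cpoly \<rho> \<subseteq> cpoly r"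
  by (auto simp: cpoly_def intro: order_trans)

context coef_algebra
begin

text \<open>Without constant term, the norm at radius \<open>t\<close> is at most
  \<open>t / r\<close> times the norm at radius \<open>r\<close>, uniformly in the
  parameter.\<close>

lemma full_small:
  assumes F: "good M r F" and r: "r > 0" and \<mu>: "\<And>i l. l \<in> L \<Longrightarrow> cmod (\<mu> i l) \<le> m" and s: "s > 0"
  obtains t where "t > 0" "t \<le> r" "\<And>i. nrm L t (full \<mu> F i) \<le> ennreal s"
    "\<And>l x. l \<in> L \<Longrightarrow> x \<in> cpoly t \<Longrightarrow> emap \<mu> F l x \<in> cpoly s"
proof -
  have "nrm L r (full \<mu> F i) < \<infinity>" for i
  proof -
    have "nrm L r (lin \<mu> i) \<le> ennreal (max 0 m * r)"
      by (rule nrm_lin) (use \<mu> r in \<open>auto simp: le_max_iff_disj\<close>)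
    then have "nrm L r (full \<mu> F i) \<le> ennreal (max 0 m * r) + nrm L r (F i)"
      unfolding full_def by (rule order_trans[OF nrm_add add_right_mono])
    also have "\<dots> < \<infinity>" using F by (auto simp: good_def less_top)
    finally show ?thesis .
  qed
  then obtain N where N: "N > 0" "\<And>i. nrm L r (full \<mu> F i) \<le> ennreal N"
    using ennreal_bound_obtain[of "\<lambda>i. nrm L r (full \<mu> F i)"] by blast
  define t where "t = min r (s * r / N)"
  have t: "t > 0" "t \<le> r" using r s N by (auto simp: t_def)
  have "t \<le> s * r / N" by (simp add: t_def)
  then have tN: "t / r * N \<le> s" using r N by (simp add: field_simps)
  have *: "nrm L t (full \<mu> F i) \<le> ennreal s" for i
  proof -
    have "nrm L t (full \<mu> F i) \<le> ennreal ((t / r) ^ 1) * nrm L r (full \<mu> F i)"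
      by (rule nrm_scale) (use t r F in \<open>auto simp: good_def full_0\<close>)
    also have "\<dots> \<le> ennreal ((t / r) ^ 1) * ennreal N" by (intro mult_left_mono N) simp
    also have "\<dots> \<le> ennreal s" using tN N t r by (simp add: ennreal_leI flip: ennreal_mult)
    finally show ?thesis .
  qed
  show ?thesis by (rule that[OF t * EV_cpoly[OF *]]) (use s in auto)
qed

text \<open>\<open>(id + H1) \<circ> (id + H2) = id + (H2 + H1 \<circ> (id + H2))\<close>.\<close>

lemma compose_near_id:
  assumes H1: "good UNIV r1 H1" "r1 > 0" and H2: "good UNIV r2 H2" "r2 > 0"
  obtains \<rho> H where "\<rho> > 0" "\<rho> \<le> r2" "good UNIV \<rho> H"
    "\<And>l x. l \<in> L \<Longrightarrow> x \<in> cpoly \<rho> \<Longrightarrow>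
      emap ones H l x = emap ones H1 l (emap ones H2 l x)"
proof -
  obtain t where t: "t > 0" "t \<le> r2" "\<And>i. nrm L t (full ones H2 i) \<le> ennreal r1"
    and tE: "\<And>l x. l \<in> L \<Longrightarrow> x \<in> cpoly t \<Longrightarrow> emap ones H2 l x \<in> cpoly r1"
    by (rule full_small[OF H2, of ones 1 r1]) (use H1 in auto)
  define H where "H i = (\<lambda>k l. H2 i k l + cmp (H1 i) (full ones H2) k l)" for i
  have g: "good UNIV t H2" by (rule good_mono[OF H2(1)]) (use t in auto)
  have ncmp: "nrm L t (cmp (H1 i) (full ones H2)) < \<infinity>" for i
  proof -
    have "nrm L t (cmp (H1 i) (full ones H2)) \<le> nrm L r1 (H1 i)"
      by (rule nrm_cmp) (use t H1 in auto)
    also have "\<dots> < \<infinity>" using H1 by (simp add: good_def)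
    finally show ?thesis .
  qed
  have gH: "good UNIV t H"
    unfolding good_def
  proof (intro allI conjI)
    fix i
    have "ord2 (cmp (H1 i) (full ones H2))" using H1 by (intro ord2_lcomb) (auto simp: good_def)
    then show "ord2 (H i)" using H2 by (simp add: ord2_def H_def good_def)
    show "H i k \<in> A" for k
      unfolding H_def by (intro add lcomb pw full const) (use H1 H2 in \<open>auto simp: good_def\<close>)
    show "supp UNIV (emb (ei i)) (H i)" by (simp add: supp_def)
    have "nrm L t (H i) \<le> nrm L t (H2 i) + nrm L t (cmp (H1 i) (full ones H2))"
      unfolding H_def by (rule nrm_add)
    also have "\<dots> < \<infinity>" using g ncmp[of i] by (simp add: good_def)
    finally show "nrm L t (H i) < \<infinity>" .
  qed
  have "emap ones H l x = emap ones H1 l (emap ones H2 l x)" if l: "l \<in> L" and x: "x \<in> cpoly t" for l x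
  proof -
    let ?y = "emap ones H2 l x"
    have "emap ones H l x $ i = emap ones H1 l ?y $ i" for i
    proof -
      have "emap ones H l x $ i = 1 * x $ i + ev (H i) l x"
        by (rule EV_full[of L, OF _ l x]) (use gH t in \<open>auto simp: good_def\<close>)
      also have "ev (H i) l x = ev (H2 i) l x + ev (cmp (H1 i) (full ones H2)) l x"
        unfolding H_def by (rule ev_add[OF _ ncmp l x]) (use g in \<open>simp add: good_def\<close>)
      also have "ev (cmp (H1 i) (full ones H2)) l x = ev (H1 i) l ?y"
        unfolding EV_def by (rule ev_cmp[where s = r1]) (use t l x H1 H2 in \<open>auto simp: good_def full_0\<close>)
      also have "1 * x $ i + (ev (H2 i) l x + ev (H1 i) l ?y) = 1 * (1 * x $ i + ev (H2 i) l x) + ev (H1 i) l ?y"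
        by simp
      also have "1 * x $ i + ev (H2 i) l x = ?y $ i"
        by (rule EV_full[of L, OF _ l x, symmetric]) (use g t in \<open>auto simp: good_def\<close>)
      also have "1 * ?y $ i + ev (H1 i) l ?y = emap ones H1 l ?y $ i"
        by (rule EV_full[of L, OF _ l tE[OF l x], symmetric]) (use H1 in \<open>auto simp: good_def\<close>)
      finally show ?thesis .
    qed
    then show ?thesis by (simp add: vec_eq_iff)
  qed
  with t gH show ?thesis by (intro that[of t H]) auto
qed

text \<open>Right inverses suffice for both inversions. With \<open>h2 = id + H2\<close>, the
  relation \<open>\<Gamma> \<circ> G = id\<close> gives \<open>h2 = h2 \<circ> \<Gamma> \<circ> G =
  \<Phi> \<circ> h2 \<circ> G\<close>, and applying \<open>F1\<close>, of which
  \<open>\<Phi>\<close> is a right inverse, gives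
  \<open>F1 \<circ> h2 = h2 \<circ> G\<close>.\<close>

lemma normal_form:
  assumes M: "monoid_set M" and K: "monoid_set (M - S)"
    and F: "good UNIV r F" "r > 0" and \<mu>A: "\<And>i. \<mu> i \<in> A"
    and c1: "contracting L \<mu> (- M)" and c2: "contracting L (\<lambda>i l. inverse (\<mu> i l)) (M \<inter> S)"
    and \<mu>: "\<And>i l. l \<in> L \<Longrightarrow> \<kappa> \<le> cmod (\<mu> i l)" "\<And>i l. l \<in> L \<Longrightarrow> cmod (\<mu> i l) \<le> m" "\<kappa> > 0"
  obtains \<rho> H G where "\<rho> > 0" "good UNIV \<rho> H" "good (M - S) \<rho> G"
    "\<And>l x. l \<in> L \<Longrightarrow> x \<in> cpoly \<rho> \<Longrightarrow> emap \<mu> F l (emap ones H l x) =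
      emap ones H l (emap \<mu> G l x)"
proof -
  define \<iota> where "\<iota> = (\<lambda>i l. inverse (\<mu> i l))"
  have m: "m > 0" if "l \<in> L" for l using \<mu>(1,2)[OF that, of 1] \<mu>(3) by linarith
  have \<iota>A: "\<iota> i \<in> A" for i
    unfolding \<iota>_def
  proof (intro inv \<mu>A)
    show "\<mu> i l \<noteq> 0" if "l \<in> L" for l using \<mu>(1)[OF that, of i] \<mu>(3) by auto
  qed
  \<comment> \<open>\<open>m\<close> is known to be positive only when \<open>L\<close> is nonempty;
    \<open>\<bar>m\<bar> + 1\<close> is positive in any case.\<close>
  have \<iota>: "1 / (\<bar>m\<bar> + 1) \<le> cmod (\<iota> i l)" "cmod (\<iota> i l) \<le> 1 / \<kappa>" if "l \<in> L" for i l
  proof -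
    have "cmod (\<mu> i l) > 0" using \<mu>(1)[OF that, of i] \<mu>(3) by linarith
    then show "1 / (\<bar>m\<bar> + 1) \<le> cmod (\<iota> i l)" "cmod (\<iota> i l) \<le> 1 / \<kappa>"
      using \<mu>(1,2)[OF that, of i] \<mu>(3) m[OF that]
      by (auto simp: \<iota>_def norm_inverse inverse_eq_divide norm_divide intro!: frac_le)
  qed
  have U: "monoid_set UNIV" by (simp add: monoid_set_def)
  have c1': "contracting L \<mu> (UNIV \<inter> - M)" using c1 by simp
  obtain \<rho>1 H1 F1 where 1: "\<rho>1 > 0" "good UNIV \<rho>1 H1" "good (UNIV - - M) \<rho>1 F1"
    "\<And>l x. l \<in> L \<Longrightarrow> x \<in> cpoly \<rho>1 \<Longrightarrow> emap \<mu> F l (emap ones H1 l x) = emap ones H1 l (emap \<mu> F1 l x)"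
    by (rule normal_form_step[where \<mu> = \<mu>, OF U F \<mu>A c1']) blast
  have F1: "good M \<rho>1 F1" using 1(3) by (simp add: Diff_eq)
  obtain \<rho>2 \<Phi> where 2: "\<rho>2 > 0" "good M \<rho>2 \<Phi>"
    "\<And>l x. l \<in> L \<Longrightarrow> x \<in> cpoly \<rho>2 \<Longrightarrow> emap \<mu> F1 l (emap \<iota> \<Phi> l x) = x"
    using right_inverse[where \<mu> = \<mu>, OF M F1 1(1) \<mu>A \<mu>(1,3)] unfolding \<iota>_def by auto
  obtain \<rho>3 H2 \<Gamma> where 3: "\<rho>3 > 0" "good M \<rho>3 H2" "good (M - S) \<rho>3 \<Gamma>"
    "\<And>l x. l \<in> L \<Longrightarrow> x \<in> cpoly \<rho>3 \<Longrightarrow> emap \<iota> \<Phi> l (emap ones H2 l x) = emap ones H2 l (emap \<iota> \<Gamma> l x)"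
    by (rule normal_form_step[where \<mu> = \<iota>, OF M 2(2,1) \<iota>A c2[folded \<iota>_def]]) blast
  have m0: "1 / (\<bar>m\<bar> + 1) > 0" by (simp add: add_nonneg_pos)
  obtain \<rho>4 G where 4: "\<rho>4 > 0" "good (M - S) \<rho>4 G"
    "\<And>l x. l \<in> L \<Longrightarrow> x \<in> cpoly \<rho>4 \<Longrightarrow> emap \<iota> \<Gamma> l (emap \<mu> G l x) = x"
    using right_inverse[where \<mu> = \<iota>, OF K 3(3,1) \<iota>A \<iota>(1) m0] unfolding \<iota>_def by auto
  have H2: "good UNIV \<rho>3 H2" by (rule good_mono[OF 3(2)]) (use 3 in auto)
  obtain \<rho>5 H where 5: "\<rho>5 > 0" "\<rho>5 \<le> \<rho>3" "good UNIV \<rho>5 H"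
    "\<And>l x. l \<in> L \<Longrightarrow> x \<in> cpoly \<rho>5 \<Longrightarrow> emap ones H l x = emap ones H1 l (emap ones H2 l x)"
    by (rule compose_near_id[OF 1(2,1) H2 3(1)]) blast
  obtain t where t: "t > 0" "t \<le> \<rho>3"
    "\<And>l x. l \<in> L \<Longrightarrow> x \<in> cpoly t \<Longrightarrow> emap ones H2 l x \<in> cpoly (min \<rho>1 \<rho>2)"
    by (rule full_small[OF H2 3(1), of ones 1 "min \<rho>1 \<rho>2"]) (use 1 2 in auto)
  define s where "s = min t \<rho>5"
  have s: "s > 0" "s \<le> t" "s \<le> \<rho>5" using t 5 by (auto simp: s_def)
  \<comment> \<open>The conjugacies are evaluated at \<open>x\<close> and at its image under
    \<open>G\<close>, so this image has to stay in their common domain.\<close>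
  obtain v where v: "v > 0" "v \<le> \<rho>4" "\<And>l x. l \<in> L \<Longrightarrow> x \<in> cpoly v \<Longrightarrow> emap \<mu> G l x \<in> cpoly s"
    by (rule full_small[where \<mu> = \<mu>, OF 4(2,1) \<mu>(2) s(1)]) auto
  define \<rho> where "\<rho> = min v s"
  have \<rho>: "\<rho> > 0" "\<rho> \<le> v" "\<rho> \<le> s" using v s by (auto simp: \<rho>_def)
  show ?thesis
  proof (rule that[of \<rho> H G])
    fix l x assume l: "l \<in> L" and x: "x \<in> cpoly \<rho>"
    let ?y = "emap \<mu> G l x"
    have y: "?y \<in> cpoly s" using v(3)[OF l] cpoly_mono[OF \<rho>(2)] x by blast
    have x': "x \<in> cpoly t" "x \<in> cpoly \<rho>5" "x \<in> cpoly \<rho>4"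
      using x cpoly_mono[of \<rho> t] cpoly_mono[of \<rho> \<rho>5] cpoly_mono[of \<rho> \<rho>4] \<rho> s v by auto
    have y': "?y \<in> cpoly t" "?y \<in> cpoly \<rho>5" "?y \<in> cpoly \<rho>3"
      using y cpoly_mono[of s t] cpoly_mono[of s \<rho>5] cpoly_mono[of s \<rho>3] s t by auto
    have hy: "emap ones H2 l ?y \<in> cpoly \<rho>2" and hx: "emap ones H2 l x \<in> cpoly \<rho>1"
      using t(3)[OF l y'(1)] t(3)[OF l x'(1)] cpoly_mono[of "min \<rho>1 \<rho>2" \<rho>1] cpoly_mono[of "min \<rho>1 \<rho>2" \<rho>2]
      by auto
    have "emap ones H2 l x = emap ones H2 l (emap \<iota> \<Gamma> l ?y)" using 4(3)[OF l x'(3)] by simp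
    also have "\<dots> = emap \<iota> \<Phi> l (emap ones H2 l ?y)" using 3(4)[OF l y'(3)] by simp
    finally have "emap \<mu> F1 l (emap ones H2 l x) = emap ones H2 l ?y"
      using 2(3)[OF l hy] by simp
    then show "emap \<mu> F l (emap ones H l x) = emap ones H l ?y"
      using 5(4)[OF l x'(2)] 5(4)[OF l y'(2)] 1(4)[OF l hx] by simp
  qed (use \<rho> s v good_mono[OF 5(3)] good_mono[OF 4(2)] in auto)
qed

end

subsection \<open>Resonant exponents\<close>

lemma contracting_mono: "contracting L \<mu> T \<Longrightarrow> T' \<subseteq> T \<Longrightarrow> contracting L \<mu> T'"
  unfolding contracting_def by ((erule ex_forward)+) blast

text \<open>\<open>n\<close> stands for the modulus of \<open>mm\<close>: the degree grows at most
  linearly in \<open>n\<close>, while the monomial in the moduli \<open>t\<close> decays like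
  \<open>\<theta> ^ n\<close> relative to \<open>t i\<close>.\<close>

definition gain :: "(2 \<Rightarrow> real) \<Rightarrow> real \<Rightarrow> nat \<Rightarrow> (int \<times> int) set \<Rightarrow> bool" where
  "gain t \<theta> B T \<longleftrightarrow> (\<forall>i k. mdeg k \<ge> 2 \<and> emb k - emb (ei i) \<in> T \<longrightarrow>
     (\<exists>n\<ge>1. mdeg k \<le> n * B + 1 \<and> t 1 ^ fst k * t 2 ^ snd k \<le> t i * \<theta> ^ n))"

text \<open>Enlarging all moduli by a factor \<open>a\<close> costs at most
  \<open>a ^ (n * B + 1)\<close> by the degree bound, and \<open>\<theta> ^ n\<close> compensates
  this as soon as \<open>a ^ B * \<theta> \<le> 1\<close>. So the gain survives in a full
  neighbourhood of the moduli \<open>t\<close>.\<close>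

lemma contracting_if_gain:
  assumes g: "gain t \<theta> B T" and t: "\<And>i. t i > 0" and \<theta>: "0 < \<theta>" "\<theta> < 1"
  obtains \<eta> where "\<eta> > 0" "\<And>\<eta>' L \<mu>. 0 < \<eta>' \<Longrightarrow> \<eta>' \<le> \<eta> \<Longrightarrow>
    (\<And>i l. l \<in> L \<Longrightarrow> t i / (1 + \<eta>') \<le> cmod (\<mu> i l) \<and> cmod (\<mu> i l) \<le> t i * (1 + \<eta>')) \<Longrightarrow> contracting L \<mu> T"
proof -
  \<comment> \<open>Besides \<open>B\<close>, one factor comes from the \<open>+ 1\<close> in the
    degree bound and one from the lower bound \<open>t i / (1 + \<eta>')\<close> for the modulus of
    \<open>\<mu> i\<close>.\<close>
  have "((\<lambda>x. (1 + 2 * x) ^ (B + 2) * \<theta>) \<longlongrightarrow> (1 + 2 * 0) ^ (B + 2) * \<theta>) (at_right 0)"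
    by (intro tendsto_intros)
  then have "eventually (\<lambda>x. (1 + 2 * x) ^ (B + 2) * \<theta> < 1) (at_right 0)"
    by (rule order_tendstoD) (use \<theta> in simp)
  then have "eventually (\<lambda>x. x > 0 \<and> (1 + 2 * x) ^ (B + 2) * \<theta> < 1) (at_right 0)"
    using eventually_at_right_less by eventually_elim auto
  then obtain \<eta> :: real where \<eta>: "\<eta> > 0" "(1 + 2 * \<eta>) ^ (B + 2) * \<theta> < 1"
    using eventually_happens[of _ "at_right (0::real)"] by auto
  show ?thesis
  proof (rule that[OF \<eta>(1)])
    fix \<eta>' :: real and L :: "'l set" and \<mu>
    assume \<eta>': "0 < \<eta>'" "\<eta>' \<le> \<eta>"
      and \<mu>: "\<And>i l. l \<in> L \<Longrightarrow> t i / (1 + \<eta>') \<le> cmod (\<mu> i l) \<and> cmod (\<mu> i l) \<le> t i * (1 + \<eta>')"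
    \<comment> \<open>One \<open>\<eta>'\<close> is the variation of the moduli over
      \<open>L\<close>, the other accounts for the enlargement \<open>\<eta>' * tm\<close> required
      by \<open>contracting\<close>.\<close>
    define a where "a = 1 + 2 * \<eta>'"
    have a: "a > 1" "1 + \<eta>' < a" using \<eta>' by (auto simp: a_def)
    have a\<theta>: "a ^ (B + 2) * \<theta> < 1"
    proof -
      have "a ^ (B + 2) * \<theta> \<le> (1 + 2 * \<eta>) ^ (B + 2) * \<theta>"
        using \<eta>' \<theta> by (intro mult_right_mono power_mono) (auto simp: a_def)
      then show ?thesis using \<eta>(2) by linarith
    qed
    have aB: "a ^ B * \<theta> \<le> 1"
    proof -
      have "a ^ B * \<theta> \<le> a ^ (B + 2) * \<theta>" using a \<theta> by (intro mult_right_mono power_increasing) auto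
      then show ?thesis using a\<theta> by linarith
    qed
    define \<delta> where "\<delta> = 1 / (1 + \<eta>') - a ^ (B + 1) * \<theta>"
    have \<delta>: "\<delta> > 0"
    proof -
      have "a ^ (B + 1) * \<theta> * (1 + \<eta>') \<le> a ^ (B + 1) * \<theta> * a"
        using a \<theta> by (intro mult_left_mono) auto
      also have "\<dots> < 1" using a\<theta> by (simp add: mult_ac)
      finally show ?thesis using \<eta>' by (simp add: \<delta>_def field_simps)
    qed
    define tm where "tm = min (t 1) (t 2)"
    have tm: "tm > 0" "tm \<le> t i" for i using t exhaust_2[of i] by (auto simp: tm_def)
    show "contracting L \<mu> T"
      unfolding contracting_def
    proof (intro exI conjI allI ballI impI)
      show "\<eta>' * tm > 0" "tm * \<delta> > 0" using \<eta>' tm \<delta> by auto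
      fix i
      show "0 \<le> t i * (1 + \<eta>')" "0 \<le> t i * (a ^ (B + 1) * \<theta>)"
        using t[of i] \<eta>' a \<theta> by (auto intro!: mult_nonneg_nonneg)
      show "cmod (\<mu> i l) \<le> t i * (1 + \<eta>')" if "l \<in> L" for l using \<mu>[OF that] by blast
      show "t i * (a ^ (B + 1) * \<theta>) + tm * \<delta> \<le> cmod (\<mu> i l)" if "l \<in> L" for l
      proof -
        have "tm * \<delta> \<le> t i * \<delta>" using tm \<delta> by (intro mult_right_mono) auto
        also have "\<dots> = t i / (1 + \<eta>') - t i * (a ^ (B + 1) * \<theta>)" by (simp add: \<delta>_def algebra_simps)
        finally show ?thesis using \<mu>[OF that, of i] by linarith
      qed
      fix k assume k: "2 \<le> mdeg k \<and> emb k - emb (ei i) \<in> T"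
      then obtain n where n: "n \<ge> 1" "mdeg k \<le> n * B + 1" "t 1 ^ fst k * t 2 ^ snd k \<le> t i * \<theta> ^ n"
        using g unfolding gain_def by blast
      have le: "t j * (1 + \<eta>') + \<eta>' * tm \<le> a * t j" "0 \<le> t j * (1 + \<eta>') + \<eta>' * tm" for j
        using mult_left_mono[OF tm(2)[of j], of \<eta>'] \<eta>' t[of j] tm by (auto simp: a_def algebra_simps)
      have "(t 1 * (1 + \<eta>') + \<eta>' * tm) ^ fst k * (t 2 * (1 + \<eta>') + \<eta>' * tm) ^ snd k \<le>
          (a * t 1) ^ fst k * (a * t 2) ^ snd k"
        using a t[of 1] t[of 2] by (intro mult_mono power_mono le zero_le_power mult_nonneg_nonneg) auto
      also have "\<dots> = a ^ mdeg k * (t 1 ^ fst k * t 2 ^ snd k)"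
        by (simp add: mdeg_def power_mult_distrib power_add)
      also have "\<dots> \<le> a ^ (n * B + 1) * (t i * \<theta> ^ n)"
        using a n t[of 1] t[of 2] t[of i] \<theta>
        by (intro mult_mono power_increasing n(3)) auto
      also have "\<dots> = t i * a * (a ^ B * \<theta>) ^ n"
        by (simp add: power_mult_distrib power_mult[symmetric] mult_ac)
      also have "\<dots> \<le> t i * a * (a ^ B * \<theta>) ^ 1"
        using aB a \<theta> t[of i] n by (intro mult_left_mono power_decreasing) auto
      also have "\<dots> = t i * (a ^ (B + 1) * \<theta>)" by (simp add: mult_ac)
      finally show "(t 1 * (1 + \<eta>') + \<eta>' * tm) ^ fst k * (t 2 * (1 + \<eta>') + \<eta>' * tm) ^ snd k \<le>
          t i * (a ^ (B + 1) * \<theta>)" .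
    qed
  qed
qed

locale resonance =
  fixes p q N r0 s0 r1 s1 :: nat
  assumes pq: "p > 0" "q > 0"
    and \<alpha>0: "int q * int r0 - int p * int s0 = 1" "r0 \<le> p" "s0 \<le> q"
    and \<alpha>1: "r1 = p - r0" "s1 = q - s0"
begin

text \<open>Every \<open>\<nu>\<close> is \<open>mm \<nu> *\<^sub>R \<alpha>\<^sub>0 + jj \<nu> *\<^sub>R (p, q)\<close>, and \<open>jj \<nu> + mm \<nu>\<close> is the coefficient of \<open>(p, q)\<close>
  when \<open>- mm \<nu>\<close> multiples of \<open>\<alpha>\<^sub>1\<close> are split off instead.\<close>
definition mm :: "int \<times> int \<Rightarrow> int" where
  "mm \<nu> = int q * fst \<nu> - int p * snd \<nu>"

definition jj :: "int \<times> int \<Rightarrow> int" where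
  "jj \<nu> = int r0 * snd \<nu> - int s0 * fst \<nu>"

text \<open>\<open>Ha\<close> and \<open>Hb\<close> require the exponent of \<open>u\<close> to be
  at least \<open>1 + N * \<bar>mm \<nu>\<bar>\<close> after multiples of \<open>\<alpha>0\<close>
  or \<open>\<alpha>1\<close>, respectively, are split off. For \<open>mm \<nu> > 0\<close> the
  condition of \<open>Ha\<close> implies that of \<open>Hb\<close>, and conversely for
  \<open>mm \<nu> < 0\<close>; so \<open>Ha \<inter> Hb\<close> consists of 0 and the exponents of
  the normal form.\<close>

definition Ha :: "(int \<times> int) set" where
  "Ha = {\<nu>. \<nu> = 0 \<or> jj \<nu> \<ge> 1 + int N * mm \<nu>}"

definition Hb :: "(int \<times> int) set" where
  "Hb = {\<nu>. \<nu> = 0 \<or> jj \<nu> \<ge> 1 - (int N + 1) * mm \<nu>}"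

lemma mm_add [simp]: "mm (\<nu> + \<omega>) = mm \<nu> + mm \<omega>" and jj_add [simp]: "jj (\<nu> + \<omega>) = jj \<nu> + jj \<omega>"
  by (simp_all add: mm_def jj_def algebra_simps)

lemma monoid_halfplane: "monoid_set {\<nu>. \<nu> = 0 \<or> 1 \<le> jj \<nu> + c * mm \<nu>}"
proof -
  have *: "1 \<le> jj (\<nu> + \<omega>) + c * mm (\<nu> + \<omega>)"
    if "1 \<le> jj \<nu> + c * mm \<nu>" "1 \<le> jj \<omega> + c * mm \<omega>" for \<nu> \<omega>
    using that by (simp add: distrib_left)
  show ?thesis
    unfolding monoid_set_def
  proof (intro conjI ballI)
    fix \<nu> \<omega> assume "\<nu> \<in> {\<nu>. \<nu> = 0 \<or> 1 \<le> jj \<nu> + c * mm \<nu>}" "\<omega> \<in> {\<nu>. \<nu> = 0 \<or> 1 \<le> jj \<nu> + c * mm \<nu>}"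
    then show "\<nu> + \<omega> \<in> {\<nu>. \<nu> = 0 \<or> 1 \<le> jj \<nu> + c * mm \<nu>}"
      using *[of \<nu> \<omega>] by (elim CollectE disjE) simp_all
  qed simp
qed

lemma monoid_Ha: "monoid_set Ha"
  using monoid_halfplane[of "- int N"] by (simp add: Ha_def algebra_simps)

lemma monoid_Hb: "monoid_set Hb"
  using monoid_halfplane[of "int N + 1"] by (simp add: Hb_def algebra_simps)

lemma monoid_Ha_Hb: "monoid_set (Ha \<inter> Hb)"
  using monoid_Ha monoid_Hb by (auto simp: monoid_set_def)

text \<open>Cramer's rule for the lattice basis \<open>(p, q)\<close>, \<open>(r0, s0)\<close>,
  whose determinant \<open>q r0 - p s0\<close> is 1.\<close>

lemma fst_eq: "fst \<nu> = int p * jj \<nu> + mm \<nu> * int r0"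
proof -
  have "int p * jj \<nu> + mm \<nu> * int r0 = fst \<nu> * (int q * int r0 - int p * int s0)"
    by (simp add: jj_def mm_def algebra_simps)
  then show ?thesis using \<alpha>0 by simp
qed

lemma snd_eq: "snd \<nu> = int q * jj \<nu> + mm \<nu> * int s0"
proof -
  have "int q * jj \<nu> + mm \<nu> * int s0 = snd \<nu> * (int q * int r0 - int p * int s0)"
    by (simp add: jj_def mm_def algebra_simps)
  then show ?thesis using \<alpha>0 by simp
qed

lemma fst_eq': "fst \<nu> = int p * (jj \<nu> + mm \<nu>) - mm \<nu> * int r1"
  using fst_eq[of \<nu>] \<alpha>0 \<alpha>1 by (simp add: algebra_simps of_nat_diff)

lemma snd_eq': "snd \<nu> = int q * (jj \<nu> + mm \<nu>) - mm \<nu> * int s1"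
  using snd_eq[of \<nu>] \<alpha>0 \<alpha>1 by (simp add: algebra_simps of_nat_diff)

text \<open>The components of \<open>\<nu>\<close> add up to \<open>mdeg k - 1\<close>, which is at
  least 1. Upper bounds proportional to \<open>n\<close> therefore force \<open>n > 0\<close> and
  bound the degree linearly in \<open>n\<close>.\<close>

lemma removed_exponent:
  assumes k: "mdeg k \<ge> 2" and \<nu>: "\<nu> = emb k - emb (ei i)"
    and le: "fst \<nu> \<le> n * (int p * int N + int r)" "snd \<nu> \<le> n * (int q * int N + int s)"
    and rsup: "r \<le> p" "s \<le> q"
  shows "n > 0" "mdeg k \<le> nat n * ((p + q) * (N + 1)) + 1"
proof -
  have sum: "fst \<nu> + snd \<nu> = int (mdeg k) - 1" using k by (auto simp: \<nu> emb_def ei_def mdeg_def)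
  show n: "n > 0"
  proof (rule ccontr)
    assume "\<not> n > 0"
    then have "n * (int p * int N + int r) \<le> 0" "n * (int q * int N + int s) \<le> 0"
      by (auto intro!: mult_nonpos_nonneg)
    then show False using le sum k by linarith
  qed
  have "n * (int p * int N + int r) \<le> n * (int p * int N + int p)"
    "n * (int q * int N + int s) \<le> n * (int q * int N + int q)"
    using n rsup by (auto intro!: mult_left_mono)
  then have "int (mdeg k) \<le> n * ((int p + int q) * (int N + 1)) + 1"
    using le sum by (simp add: algebra_simps)
  also have "\<dots> = int (nat n * ((p + q) * (N + 1)) + 1)" using n by (simp add: algebra_simps)
  finally show "mdeg k \<le> nat n * ((p + q) * (N + 1)) + 1" by (simp only: of_nat_le_iff)
qed

lemma not_Ha:
  assumes "mdeg k \<ge> 2" "\<nu> = emb k - emb (ei i)" "\<nu> \<notin> Ha"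
  shows "mm \<nu> > 0" "mdeg k \<le> nat (mm \<nu>) * ((p + q) * (N + 1)) + 1"
proof -
  have j: "jj \<nu> \<le> int N * mm \<nu>" using assms(3) by (auto simp: Ha_def)
  have "fst \<nu> \<le> mm \<nu> * (int p * int N + int r0)" "snd \<nu> \<le> mm \<nu> * (int q * int N + int s0)"
    unfolding fst_eq[of \<nu>] snd_eq[of \<nu>]
    using mult_left_mono[OF j, of "int p"] mult_left_mono[OF j, of "int q"] by (simp_all add: algebra_simps)
  from removed_exponent[OF assms(1,2) this \<alpha>0(2,3)]
  show "mm \<nu> > 0" "mdeg k \<le> nat (mm \<nu>) * ((p + q) * (N + 1)) + 1" .
qed

lemma not_Hb:
  assumes "mdeg k \<ge> 2" "\<nu> = emb k - emb (ei i)" "\<nu> \<notin> Hb"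
  shows "- mm \<nu> > 0" "mdeg k \<le> nat (- mm \<nu>) * ((p + q) * (N + 1)) + 1"
proof -
  have j: "jj \<nu> + mm \<nu> \<le> - int N * mm \<nu>" using assms(3) by (auto simp: Hb_def algebra_simps)
  have "fst \<nu> \<le> - mm \<nu> * (int p * int N + int r1)" "snd \<nu> \<le> - mm \<nu> * (int q * int N + int s1)"
    unfolding fst_eq'[of \<nu>] snd_eq'[of \<nu>]
    using mult_left_mono[OF j, of "int p"] mult_left_mono[OF j, of "int q"] by (simp_all add: algebra_simps)
  from removed_exponent[OF assms(1,2) this] \<alpha>1
  show "- mm \<nu> > 0" "mdeg k \<le> nat (- mm \<nu>) * ((p + q) * (N + 1)) + 1" by simp_all
qed

text \<open>Resonance in modulus means \<open>t 1 = exp (q \<tau>)\<close> and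
  \<open>t 2 = exp (- p \<tau>)\<close> for a common \<open>\<tau>\<close>, so the monomial with
  exponent \<open>\<nu>\<close> is \<open>exp (\<tau> (q \<nu>_1 - p \<nu>_2))\<close>.\<close>

lemma modulus_eq:
  fixes t :: "2 \<Rightarrow> real"
  assumes t: "\<And>i. t i > 0" and \<tau>: "ln (t 1) = of_nat q * \<tau>" "ln (t 2) = - of_nat p * \<tau>"
    and \<nu>: "\<nu> = emb k - emb (ei i)"
  shows "t 1 ^ fst k * t 2 ^ snd k = t i * exp (\<tau> * of_int (mm \<nu>))"
proof -
  have t1: "t 1 = exp (of_nat q * \<tau>)" and t2: "t 2 = exp (- of_nat p * \<tau>)"
    using t[of 1] t[of 2] \<tau> by (metis exp_ln)+
  have "t 1 ^ fst k * t 2 ^ snd k = exp (of_nat (fst k) * (of_nat q * \<tau>) + of_nat (snd k) * (- of_nat p * \<tau>))"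
    unfolding t1 t2 exp_of_nat_mult[symmetric] exp_add[symmetric] by (rule refl)
  moreover have "t i = exp (if i = 1 then of_nat q * \<tau> else - of_nat p * \<tau>)"
    using exhaust_2[of i] t1 t2 by auto
  ultimately show ?thesis
    by (auto simp: \<nu> mm_def emb_def ei_def algebra_simps simp flip: exp_add)
qed

text \<open>\<open>exp \<tau>\<close> is below 1 only for \<open>\<tau> < 0\<close>. For
  \<open>\<tau> > 0\<close> the lemma is applied to the inverse moduli, which turns
  \<open>\<tau>\<close> into \<open>- \<tau>\<close>.\<close>

lemma gain_Ha:
  fixes t :: "2 \<Rightarrow> real"
  assumes t: "\<And>i. t i > 0" and \<tau>: "ln (t 1) = of_nat q * \<tau>" "ln (t 2) = - of_nat p * \<tau>"
  shows "gain t (exp \<tau>) ((p + q) * (N + 1)) (- Ha)"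
  unfolding gain_def
proof (intro allI impI)
  fix i k assume k: "2 \<le> mdeg k \<and> emb k - emb (ei i) \<in> - Ha"
  define \<nu> where "\<nu> = emb k - emb (ei i)"
  have "mm \<nu> > 0" "mdeg k \<le> nat (mm \<nu>) * ((p + q) * (N + 1)) + 1"
    by (rule not_Ha[OF _ \<nu>_def]; use k \<nu>_def in simp)+
  moreover from this have "exp \<tau> ^ nat (mm \<nu>) = exp (\<tau> * of_int (mm \<nu>))"
    by (simp add: mult.commute flip: exp_of_nat_mult)
  ultimately show "\<exists>n\<ge>1. mdeg k \<le> n * ((p + q) * (N + 1)) + 1 \<and> t 1 ^ fst k * t 2 ^ snd k \<le> t i * exp \<tau> ^ n"
    using modulus_eq[OF t \<tau> \<nu>_def] by (intro exI[of _ "nat (mm \<nu>)"]) auto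
qed

lemma gain_Hb:
  fixes t :: "2 \<Rightarrow> real"
  assumes t: "\<And>i. t i > 0" and \<tau>: "ln (t 1) = of_nat q * \<tau>" "ln (t 2) = - of_nat p * \<tau>"
  shows "gain t (exp (- \<tau>)) ((p + q) * (N + 1)) (- Hb)"
  unfolding gain_def
proof (intro allI impI)
  fix i k assume k: "2 \<le> mdeg k \<and> emb k - emb (ei i) \<in> - Hb"
  define \<nu> where "\<nu> = emb k - emb (ei i)"
  have m: "- mm \<nu> > 0" "mdeg k \<le> nat (- mm \<nu>) * ((p + q) * (N + 1)) + 1"
    by (rule not_Hb[OF _ \<nu>_def]; use k \<nu>_def in simp)+
  moreover from m(1) have "exp (- \<tau>) ^ nat (- mm \<nu>) = exp (\<tau> * of_int (mm \<nu>))"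
    by (simp add: mult.commute flip: exp_of_nat_mult)
  ultimately show "\<exists>n\<ge>1. mdeg k \<le> n * ((p + q) * (N + 1)) + 1 \<and> t 1 ^ fst k * t 2 ^ snd k \<le> t i * exp (- \<tau>) ^ n"
    using modulus_eq[OF t \<tau> \<nu>_def] by (intro exI[of _ "nat (- mm \<nu>)"]) auto
qed

definition ex0 :: "nat \<Rightarrow> nat \<times> nat" where
  "ex0 j = (p * j, q * j)"

text \<open>The exponent of \<open>u ^ (1 + N * k + j)\<close> times the \<open>k\<close>-th power
  of the monomial with exponent \<open>\<alpha>0\<close>; \<open>j\<close> is the Taylor index of
  the coefficient function.\<close>

definition exA :: "nat \<times> nat \<Rightarrow> nat \<times> nat" where
  "exA = (\<lambda>(k, j). (p * (1 + N * k + j) + k * r0, q * (1 + N * k + j) + k * s0))"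

definition exB :: "nat \<times> nat \<Rightarrow> nat \<times> nat" where
  "exB = (\<lambda>(k, j). (p * (1 + N * k + j) + k * r1, q * (1 + N * k + j) + k * s1))"

lemma mm_ex0: "mm (emb (ex0 j)) = 0" and jj_ex0: "jj (emb (ex0 j)) = int j"
proof -
  show "mm (emb (ex0 j)) = 0" by (simp add: mm_def ex0_def emb_def)
  have "jj (emb (ex0 j)) = int j * (int q * int r0 - int p * int s0)"
    by (simp add: jj_def ex0_def emb_def algebra_simps)
  then show "jj (emb (ex0 j)) = int j" using \<alpha>0 by simp
qed

lemma mm_exA: "mm (emb (exA (k, j))) = int k" and jj_exA: "jj (emb (exA (k, j))) = 1 + int N * int k + int j"
proof -
  have "mm (emb (exA (k, j))) = int k * (int q * int r0 - int p * int s0)"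
    by (simp add: mm_def exA_def emb_def algebra_simps)
  then show "mm (emb (exA (k, j))) = int k" using \<alpha>0 by simp
  have "jj (emb (exA (k, j))) = (1 + int N * int k + int j) * (int q * int r0 - int p * int s0)"
    by (simp add: jj_def exA_def emb_def algebra_simps)
  then show "jj (emb (exA (k, j))) = 1 + int N * int k + int j" using \<alpha>0 by simp
qed

lemma mm_exB: "mm (emb (exB (k, j))) = - int k"
  and jj_exB: "jj (emb (exB (k, j))) = 1 + int N * int k + int j + int k"
proof -
  have r1: "int r1 = int p - int r0" "int s1 = int q - int s0" using \<alpha>0 \<alpha>1 by auto
  have "mm (emb (exB (k, j))) = - int k * (int q * int r0 - int p * int s0)"
    by (simp add: mm_def exB_def emb_def r1 algebra_simps)
  then show "mm (emb (exB (k, j))) = - int k" using \<alpha>0 by simp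
  have "jj (emb (exB (k, j))) = (1 + int N * int k + int j + int k) * (int q * int r0 - int p * int s0)"
    by (simp add: jj_def exB_def emb_def r1 algebra_simps)
  then show "jj (emb (exB (k, j))) = 1 + int N * int k + int j + int k" using \<alpha>0 by simp
qed

lemma emb_eqI: "mm \<nu> = mm \<omega> \<Longrightarrow> jj \<nu> = jj \<omega> \<Longrightarrow> \<nu> = \<omega>"
  using fst_eq snd_eq by (metis prod.collapse)

lemma inj_emb: "emb k = emb k' \<Longrightarrow> k = k'"
  by (cases k; cases k') (simp add: emb_def)

lemma inj_ex0: "inj ex0" and inj_exA: "inj exA" and inj_exB: "inj exB"
proof -
  show "inj ex0" by (rule injI) (metis jj_ex0 of_nat_eq_iff)
  show "inj exA"
  proof (rule injI, clarify)
    fix k j k' j' assume *: "exA (k, j) = exA (k', j')"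
    have "mm (emb (exA (k, j))) = mm (emb (exA (k', j')))" by (simp only: *)
    then have k: "k = k'" unfolding mm_exA by simp
    have "jj (emb (exA (k, j))) = jj (emb (exA (k', j')))" by (simp only: *)
    then have "j = j'" unfolding jj_exA by (simp add: k)
    with k show "k = k' \<and> j = j'" ..
  qed
  show "inj exB"
  proof (rule injI, clarify)
    fix k j k' j' assume *: "exB (k, j) = exB (k', j')"
    have "mm (emb (exB (k, j))) = mm (emb (exB (k', j')))" by (simp only: *)
    then have k: "k = k'" unfolding mm_exB by simp
    have "jj (emb (exB (k, j))) = jj (emb (exB (k', j')))" by (simp only: *)
    then have "j = j'" unfolding jj_exB by (simp add: k)
    with k show "k = k' \<and> j = j'" ..
  qed
qed

text \<open>The sign of \<open>mm \<nu>\<close> selects the family and its absolute value is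
  \<open>k\<close>; the half-plane inequality says exactly that the remaining power \<open>j\<close>
  of \<open>u\<close> is nonnegative (at least 1 for \<open>mm \<nu> = 0\<close>).\<close>

lemma kept_exponents:
  assumes k: "mdeg k \<ge> 2" and kept: "emb k - emb (ei i) \<in> Ha \<inter> Hb"
  shows "k \<in> (\<lambda>e. ei i + e) ` (ex0 ` {1..} \<union> exA ` ({1..} \<times> UNIV) \<union> exB ` ({1..} \<times> UNIV))"
proof -
  define \<nu> where "\<nu> = emb k - emb (ei i)"
  have "\<nu> \<noteq> 0"
  proof
    assume "\<nu> = 0"
    then have "k = ei i" by (intro inj_emb) (simp add: \<nu>_def)
    then show False using k by simp
  qed
  then have j: "jj \<nu> \<ge> 1 + int N * mm \<nu>" "jj \<nu> \<ge> 1 - (int N + 1) * mm \<nu>"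
    using kept by (auto simp: Ha_def Hb_def \<nu>_def)
  have *: "k = ei i + e" if "mm \<nu> = mm (emb e)" "jj \<nu> = jj (emb e)" for e
  proof -
    have "emb k - emb (ei i) = emb e" using emb_eqI[OF that] by (simp add: \<nu>_def)
    then have "emb k = emb (ei i + e)" unfolding emb_add by (simp add: algebra_simps)
    then show ?thesis by (rule inj_emb)
  qed
  consider "mm \<nu> = 0" | "mm \<nu> > 0" | "mm \<nu> < 0" by linarith
  then show ?thesis
  proof cases
    case 1
    then have "k = ei i + ex0 (nat (jj \<nu>))" "nat (jj \<nu>) \<in> {1..}"
      using j by (auto intro!: * simp: mm_ex0 jj_ex0)
    then show ?thesis by blast
  next
    case 2
    let ?x = "(nat (mm \<nu>), nat (jj \<nu> - 1 - int N * mm \<nu>))"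
    have "k = ei i + exA ?x" "?x \<in> {1..} \<times> UNIV"
      using j 2 by (auto intro!: * simp: mm_exA jj_exA)
    then show ?thesis by blast
  next
    case 3
    let ?x = "(nat (- mm \<nu>), nat (jj \<nu> - 1 + (int N + 1) * mm \<nu>))"
    have "k = ei i + exB ?x" "?x \<in> {1..} \<times> UNIV"
      using j 3 by (auto intro!: * simp: mm_exB jj_exB algebra_simps)
    then show ?thesis by blast
  qed
qed

lemma disjoint_exponents:
  "ex0 ` J \<inter> exA ` ({1..} \<times> UNIV) = {}" "ex0 ` J \<inter> exB ` ({1..} \<times> UNIV) = {}"
  "exA ` ({1..} \<times> UNIV) \<inter> exB ` ({1..} \<times> UNIV) = {}"
proof -
  have 0: "mm (emb e) = 0" if "e \<in> ex0 ` J" for e using that by (auto simp: mm_ex0)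
  have A: "mm (emb e) > 0" if "e \<in> exA ` ({1..} \<times> UNIV)" for e using that by (auto simp: mm_exA)
  have B: "mm (emb e) < 0" if "e \<in> exB ` ({1..} \<times> UNIV)" for e using that by (auto simp: mm_exB)
  show "ex0 ` J \<inter> exA ` ({1..} \<times> UNIV) = {}"
    using less_irrefl 0 A by (metis disjoint_iff)
  show "ex0 ` J \<inter> exB ` ({1..} \<times> UNIV) = {}"
    using less_irrefl 0 B by (metis disjoint_iff)
  show "exA ` ({1..} \<times> UNIV) \<inter> exB ` ({1..} \<times> UNIV) = {}"
    using less_asym A B by (metis disjoint_iff)
qed

end

subsection \<open>Analyticity of maps given by power series\<close>

text \<open>Caratheodory's criterion: a factorisation of the increment with factors continuous at
  \<open>x\<close> yields the derivative, with gradient \<open>G i x\<close>. The same criterion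
  later differentiates the inverse map.\<close>

lemma caratheodory_derivative:
  fixes F :: "complex^2 \<Rightarrow> complex" and G :: "2 \<Rightarrow> complex^2 \<Rightarrow> complex" and x :: "complex^2"
  assumes S: "open S" "x \<in> S"
    and F: "\<And>y. y \<in> S \<Longrightarrow> F y - F x = (\<Sum>i\<in>UNIV. (y $ i - x $ i) * G i y)"
    and G: "\<And>i. isCont (G i) x"
  shows "(F has_derivative (\<lambda>v. \<Sum>i\<in>UNIV. G i x * v $ i)) (at x)"
proof -
  have summand: "((\<lambda>y. (y $ i - x $ i) * G i y) has_derivative (\<lambda>v. G i x * v $ i)) (at x)" for i
  proof (rule has_derivativeI)
    show "bounded_linear (\<lambda>v::complex^2. G i x * v $ i)"
      by (intro bounded_linear_mult_right[THEN bounded_linear_compose] bounded_linear_vec_nth)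
    have "((\<lambda>y. G i y - G i x) \<longlongrightarrow> 0) (at x)"
      using G[of i] by (simp add: isCont_def LIM_zero)
    then show "((\<lambda>y. ((y $ i - x $ i) * G i y - (x $ i - x $ i) * G i x - G i x * (y - x) $ i) /\<^sub>R norm (y - x))
        \<longlongrightarrow> 0) (at x)"
    proof (rule Lim_null_comparison[rotated, OF tendsto_norm_zero], intro always_eventually allI)
      fix y
      have bound: "cmod ((y $ i - x $ i) * (G i y - G i x)) \<le> norm (y - x) * cmod (G i y - G i x)"
      proof -
        have "cmod ((y - x) $ i) \<le> norm (y - x)" by (rule Finite_Cartesian_Product.norm_nth_le)
        then show ?thesis by (simp add: norm_mult mult_right_mono)
      qed
      then show "norm (((y $ i - x $ i) * G i y - (x $ i - x $ i) * G i x - G i x * (y - x) $ i) /\<^sub>R norm (y - x))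
          \<le> cmod (G i y - G i x)"
      proof -
        have "(y $ i - x $ i) * G i y - (x $ i - x $ i) * G i x - G i x * (y - x) $ i =
            (y $ i - x $ i) * (G i y - G i x)"
          by (simp add: algebra_simps)
        then show ?thesis
          using bound by (cases "y = x") (simp_all add: inverse_eq_divide pos_divide_le_eq mult.commute)
      qed
    qed
  qed
  have "((\<lambda>y. F x + (\<Sum>i\<in>UNIV. (y $ i - x $ i) * G i y)) has_derivative (\<lambda>v. 0 + (\<Sum>i\<in>UNIV. G i x * v $ i))) (at x)"
    by (intro has_derivative_add has_derivative_const has_derivative_sum summand)
  then have "(F has_derivative (\<lambda>v. 0 + (\<Sum>i\<in>UNIV. G i x * v $ i))) (at x)"
    by (rule has_derivative_transform_within_open[OF _ S]) (use F in \<open>simp flip: F\<close>)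
  then show ?thesis by simp
qed

text \<open>Divided differences of a monomial along the path that changes the second coordinate from
  \<open>x\<close> to \<open>y\<close> while the first is that of \<open>x\<close>, and then the
  first.\<close>

definition quot :: "2 \<Rightarrow> complex^2 \<Rightarrow> complex^2 \<Rightarrow> nat \<times> nat \<Rightarrow> complex" where
  "quot i x y k = (if i = 1
     then (\<Sum>t<fst k. (x $ 1) ^ (fst k - Suc t) * (y $ 1) ^ t) * (y $ 2) ^ snd k
     else (x $ 1) ^ fst k * (\<Sum>t<snd k. (x $ 2) ^ (snd k - Suc t) * (y $ 2) ^ t))"

lemma mpow_diff: "mpow y k - mpow x k = (\<Sum>i\<in>UNIV. (y $ i - x $ i) * quot i x y k)"
proof -
  have "mpow y k - mpow x k = ((y $ 1) ^ fst k - (x $ 1) ^ fst k) * (y $ 2) ^ snd k +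
      (x $ 1) ^ fst k * ((y $ 2) ^ snd k - (x $ 2) ^ snd k)"
    by (simp add: mpow_def algebra_simps)
  then show ?thesis
    unfolding power_diff_sumr2[of "y $ 1"] power_diff_sumr2[of "y $ 2"] UNIV_2
    by (simp add: quot_def algebra_simps)
qed

lemma geometric_bound:
  fixes a b :: complex
  assumes "cmod a \<le> \<rho>" "cmod b \<le> \<rho>"
  shows "cmod (\<Sum>t<n. a ^ (n - Suc t) * b ^ t) \<le> real n * \<rho> ^ (n - 1)"
proof -
  have \<rho>: "\<rho> \<ge> 0" using assms norm_ge_zero order_trans by blast
  have "cmod (\<Sum>t<n. a ^ (n - Suc t) * b ^ t) \<le> (\<Sum>t<n. \<rho> ^ (n - 1))"
  proof (rule sum_norm_le)
    fix t assume "t \<in> {..<n}"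
    then have "\<rho> ^ (n - 1) = \<rho> ^ (n - Suc t) * \<rho> ^ t" by (simp flip: power_add)
    then show "cmod (a ^ (n - Suc t) * b ^ t) \<le> \<rho> ^ (n - 1)"
      using assms \<rho> by (auto simp: norm_mult norm_power intro!: mult_mono power_mono)
  qed
  then show ?thesis by simp
qed

lemma quot_bound:
  assumes "x \<in> cpoly \<rho>" "y \<in> cpoly \<rho>"
  shows "cmod (quot i x y k) \<le> real (mdeg k) * \<rho> ^ (mdeg k - 1)"
proof -
  have b: "cmod (x $ j) \<le> \<rho>" "cmod (y $ j) \<le> \<rho>" for j using assms by (auto simp: cpoly_def)
  have \<rho>: "\<rho> \<ge> 0" using b(1)[of 1] norm_ge_zero order_trans by blast
  have pw: "cmod (z ^ n) \<le> \<rho> ^ n" if "cmod z \<le> \<rho>" for z n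
    unfolding norm_power using that by (intro power_mono) auto
  have *: "real a * \<rho> ^ (a - 1) * \<rho> ^ b \<le> real (a + b) * \<rho> ^ (a + b - 1)" for a b
  proof (cases "a = 0")
    case False
    then have "\<rho> ^ (a - 1) * \<rho> ^ b = \<rho> ^ (a + b - 1)" by (simp flip: power_add)
    then have "real a * \<rho> ^ (a - 1) * \<rho> ^ b = real a * \<rho> ^ (a + b - 1)" by (simp only: mult.assoc)
    also have "\<dots> \<le> real (a + b) * \<rho> ^ (a + b - 1)" using \<rho> by (intro mult_right_mono) auto
    finally show ?thesis .
  qed (use \<rho> in simp)
  show ?thesis
  proof (cases "i = 1")
    case True
    have "cmod (quot i x y k) \<le> real (fst k) * \<rho> ^ (fst k - 1) * \<rho> ^ snd k"
    proof -
      have "quot i x y k = (\<Sum>t<fst k. (x $ 1) ^ (fst k - Suc t) * (y $ 1) ^ t) * (y $ 2) ^ snd k"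
        using True by (simp add: quot_def)
      then show ?thesis
        using \<rho> by (simp only: norm_mult) (intro mult_mono geometric_bound pw b; simp)
    qed
    also have "\<dots> \<le> real (mdeg k) * \<rho> ^ (mdeg k - 1)" unfolding mdeg_def by (rule *)
    finally show ?thesis .
  next
    case False
    have "cmod (quot i x y k) \<le> \<rho> ^ fst k * (real (snd k) * \<rho> ^ (snd k - 1))"
    proof -
      have "quot i x y k = (x $ 1) ^ fst k * (\<Sum>t<snd k. (x $ 2) ^ (snd k - Suc t) * (y $ 2) ^ t)"
        using False by (simp add: quot_def)
      then show ?thesis
        using \<rho> by (simp only: norm_mult) (intro mult_mono geometric_bound pw b; simp)
    qed
    also have "\<dots> \<le> real (mdeg k) * \<rho> ^ (mdeg k - 1)"
      using *[of "snd k" "fst k"] by (simp add: mdeg_def mult_ac add.commute)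
    finally show ?thesis .
  qed
qed

lemma nat_le_two_power: "real n \<le> 2 ^ n"
  using less_exp[of n] by (metis of_nat_less_iff of_nat_numeral of_nat_power less_imp_le)

text \<open>Halving the radius pays for the factor \<open>n\<close> through
  \<open>n \<le> 2 ^ n\<close>; since \<open>n \<ge> 2\<close>, a factor \<open>\<rho>\<close> is
  left, which makes the divided differences small.\<close>

lemma weight_bound:
  assumes "0 \<le> \<rho>" "\<rho> \<le> r / 2" "r > 0" "n \<ge> 2"
  shows "real n * \<rho> ^ (n - 1) \<le> 4 * \<rho> / r\<^sup>2 * r ^ n"
proof -
  define m where "m = n - 2"
  have m: "n = Suc (Suc m)" using assms by (simp add: m_def)
  have "real n * \<rho> ^ (n - 1) = \<rho> * (real n * \<rho> ^ m)" by (simp add: m)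
  also have "\<dots> \<le> \<rho> * (real n * (r / 2) ^ m)"
    using assms by (intro mult_left_mono power_mono) auto
  also have "\<dots> = 4 * \<rho> / r\<^sup>2 * (real n * (r / 2) ^ n)"
    using assms by (simp add: m power2_eq_square)
  also have "\<dots> \<le> 4 * \<rho> / r\<^sup>2 * (2 ^ n * (r / 2) ^ n)"
    using nat_le_two_power assms by (intro mult_left_mono mult_right_mono) auto
  also have "2 ^ n * (r / 2) ^ n = r ^ n" by (simp flip: power_mult_distrib)
  finally show ?thesis .
qed

definition evq :: "'l ser \<Rightarrow> 'l \<Rightarrow> 2 \<Rightarrow> complex^2 \<Rightarrow> complex^2 \<Rightarrow> complex" where
  "evq X l i x y = (\<Sum>\<^sub>\<infinity>k. X k l * quot i x y k)"

lemma weights_summable: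
  assumes N: "nrm L r X \<le> ennreal N" "N \<ge> 0" "l \<in> L" "r > 0"
  shows "(\<lambda>k. cmod (X k l) * r ^ mdeg k) summable_on UNIV"
    and "(\<Sum>\<^sub>\<infinity>k. cmod (X k l) * r ^ mdeg k) \<le> N"
proof -
  let ?x = "(\<chi> i. of_real r) :: complex^2"
  have x: "?x \<in> cpoly r" using assms by (simp add: cpoly_def)
  have "mpow ?x k = of_real r ^ mdeg k" for k by (simp add: mpow_def mdeg_def power_add)
  then have eq: "cmod (X k l * mpow ?x k) = cmod (X k l) * r ^ mdeg k" for k
    using assms by (simp add: norm_mult norm_power)
  have "nnsum (\<lambda>k. ennreal (norm (X k l * mpow ?x k))) \<le> ennreal N"
    using nnsum_ev[OF assms(3) x] N(1) by (rule order_trans)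
  note * = abs_summable_if_nnsum[OF this N(2)]
  show "(\<lambda>k. cmod (X k l) * r ^ mdeg k) summable_on UNIV"
    "(\<Sum>\<^sub>\<infinity>k. cmod (X k l) * r ^ mdeg k) \<le> N"
    using * unfolding eq by auto
qed

lemma evq_term_bound:
  assumes "ord2 X" "r > 0" "\<rho> \<le> r / 2" "x \<in> cpoly \<rho>" "y \<in> cpoly \<rho>"
  shows "cmod (X k l * quot i x y k) \<le> 4 * \<rho> / r\<^sup>2 * (cmod (X k l) * r ^ mdeg k)"
proof (cases "mdeg k < 2")
  case True
  then show ?thesis using assms(1) by (simp add: ord2_def)
next
  case False
  have \<rho>: "\<rho> \<ge> 0" using assms(4) norm_ge_zero order_trans unfolding cpoly_def by blast
  have "cmod (quot i x y k) \<le> 4 * \<rho> / r\<^sup>2 * r ^ mdeg k"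
    using order_trans[OF quot_bound[OF assms(4,5)] weight_bound[OF \<rho> assms(3,2)]] False by simp
  then have "cmod (X k l) * cmod (quot i x y k) \<le> cmod (X k l) * (4 * \<rho> / r\<^sup>2 * r ^ mdeg k)"
    by (rule mult_left_mono) simp
  then show ?thesis by (simp add: norm_mult mult_ac)
qed

lemma evq_summable:
  assumes N: "ord2 X" "nrm L r X < \<infinity>" "l \<in> L" "r > 0" "x \<in> cpoly (r / 2)" "y \<in> cpoly (r / 2)"
  shows "(\<lambda>k. X k l * quot i x y k) abs_summable_on UNIV"
proof (rule summable_on_comparison_test)
  show "(\<lambda>k. 4 * (r / 2) / r\<^sup>2 * (cmod (X k l) * r ^ mdeg k)) summable_on UNIV"
    using weights_summable(1)[of L r X "enn2real (nrm L r X)" l] assms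
    by (intro summable_on_cmult_right) (simp add: less_top)
  show "norm (X k l * quot i x y k) \<le> 4 * (r / 2) / r\<^sup>2 * (cmod (X k l) * r ^ mdeg k)" for k
    by (intro evq_term_bound assms) simp
qed simp

lemma ev_diff_quot:
  assumes N: "ord2 X" "nrm L r X < \<infinity>" "l \<in> L" "r > 0" and x: "x \<in> cpoly (r / 2)" and y: "y \<in> cpoly (r / 2)"
  shows "ev X l y - ev X l x = (\<Sum>i\<in>UNIV. (y $ i - x $ i) * evq X l i x y)"
proof -
  have xy: "x \<in> cpoly r" "y \<in> cpoly r" using x y cpoly_mono[of "r / 2" r] N by auto
  have "((\<lambda>k. X k l * mpow y k - X k l * mpow x k) has_sum (ev X l y - ev X l x)) UNIV"
    by (intro has_sum_diff ev_has_sum[OF N(2,3)] xy)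
  moreover have s: "((\<lambda>k. X k l * quot i x y k) has_sum evq X l i x y) UNIV" for i
    unfolding evq_def by (rule has_sum_infsum[OF abs_summable_summable[OF evq_summable[OF N x y]]])
  have "((\<lambda>k. \<Sum>i\<in>UNIV. (y $ i - x $ i) * (X k l * quot i x y k)) has_sum
      (\<Sum>i\<in>UNIV. (y $ i - x $ i) * evq X l i x y)) UNIV"
    unfolding sum_2 by (intro has_sum_add has_sum_cmult_right s)
  moreover have "X k l * mpow y k - X k l * mpow x k =
      (\<Sum>i\<in>UNIV. (y $ i - x $ i) * (X k l * quot i x y k))" for k
    unfolding right_diff_distrib[symmetric] mpow_diff by (simp add: sum_distrib_left mult_ac)
  ultimately show ?thesis by (simp only: has_sum_unique)
qed

lemma evq_small:
  assumes N: "nrm L r X \<le> ennreal N" "N \<ge> 0" and l: "l \<in> L" and r: "r > 0" and X: "ord2 X"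
    and \<rho>: "\<rho> \<le> r / 2" and xy: "x \<in> cpoly \<rho>" "y \<in> cpoly \<rho>"
  shows "cmod (evq X l i x y) \<le> 4 * \<rho> / r\<^sup>2 * N"
proof -
  have \<rho>0: "\<rho> \<ge> 0" using xy(1) norm_ge_zero order_trans unfolding cpoly_def by blast
  note bound = evq_term_bound[OF X r \<rho> xy]
  have xy': "x \<in> cpoly (r / 2)" "y \<in> cpoly (r / 2)" using xy cpoly_mono[OF \<rho>] by auto
  have fin: "nrm L r X < \<infinity>" using N(1) by (rule le_less_trans) simp
  have s: "(\<lambda>k. X k l * quot i x y k) abs_summable_on UNIV" by (rule evq_summable[OF X fin l r xy'])
  have "cmod (evq X l i x y) \<le> (\<Sum>\<^sub>\<infinity>k. cmod (X k l * quot i x y k))"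
    unfolding evq_def by (rule norm_infsum_bound[OF s])
  also have "\<dots> \<le> (\<Sum>\<^sub>\<infinity>k. 4 * \<rho> / r\<^sup>2 * (cmod (X k l) * r ^ mdeg k))"
    using weights_summable(1)[OF N l r] by (intro infsum_mono s summable_on_cmult_right bound)
  also have "\<dots> = 4 * \<rho> / r\<^sup>2 * (\<Sum>\<^sub>\<infinity>k. cmod (X k l) * r ^ mdeg k)" by (rule infsum_cmult_right')
  also have "\<dots> \<le> 4 * \<rho> / r\<^sup>2 * N"
    using weights_summable(2)[OF N l r] \<rho>0 r by (intro mult_left_mono) auto
  finally show ?thesis .
qed

lemma continuous_evq:
  assumes N: "ord2 X" "nrm L r X < \<infinity>" "l \<in> L" "r > 0" and x: "x \<in> cpoly (r / 2)"
  shows "continuous_on (cpoly (r / 2)) (evq X l i x)"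
proof -
  have "uniform_limit (cpoly (r / 2)) (\<lambda>F y. \<Sum>k\<in>F. X k l * quot i x y k) (evq X l i x)
      (finite_subsets_at_top UNIV)"
    unfolding evq_def[abs_def]
  proof (rule Weierstrass_m_test_general)
    show "norm (X k l * quot i x y k) \<le> 4 * (r / 2) / r\<^sup>2 * (cmod (X k l) * r ^ mdeg k)"
      if "y \<in> cpoly (r / 2)" for k y
      by (intro evq_term_bound N x that) simp
    show "(\<lambda>k. 4 * (r / 2) / r\<^sup>2 * (cmod (X k l) * r ^ mdeg k)) summable_on UNIV"
      using weights_summable(1)[of L r X "enn2real (nrm L r X)" l] N
      by (intro summable_on_cmult_right) (simp add: less_top)
  qed
  moreover have "continuous_on A (\<lambda>y. quot i x y k)" for A k
    unfolding quot_def by (cases "i = 1") (simp_all; intro continuous_intros)+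
  then have "\<forall>\<^sub>F F in finite_subsets_at_top UNIV.
      continuous_on (cpoly (r / 2)) (\<lambda>y. \<Sum>k\<in>F. X k l * quot i x y k)"
    by (intro always_eventually allI continuous_intros)
  ultimately show ?thesis by (intro uniform_limit_theorem) auto
qed

lemma open_polydisk: "open (polydisk R)"
proof -
  have "polydisk R = (\<Inter>i. {x. cmod (x $ i) < R $ i})" by (auto simp: polydisk_def)
  also have "open \<dots>" by (intro open_INT ballI open_Collect_less continuous_intros) simp
  finally show ?thesis .
qed

lemma polydisk_subset_cpoly: "polydisk (\<chi> i. \<rho>) \<subseteq> cpoly \<rho>"
  by (auto simp: polydisk_def cpoly_def intro: less_imp_le)

text \<open>Divided differences give \<open>f y - f x = P (y - x)\<close> with a matrix
  \<open>P\<close>, depending on \<open>x\<close> and \<open>y\<close>, that is close to the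
  identity and hence invertible. This yields injectivity, and through Caratheodory's criterion the
  derivative of \<open>f\<close> from \<open>P\<close> and that of the inverse from the inverse
  matrix.\<close>

lemma near_identity_diffeo:
  fixes H :: "2 \<Rightarrow> 'l ser"
  assumes H: "\<And>i. ord2 (H i)" "\<And>i. nrm L r (H i) < \<infinity>" and r: "r > 0"
  obtains \<rho>0 where "\<rho>0 > 0" "\<rho>0 \<le> r"
    "\<And>\<rho> l. 0 < \<rho> \<Longrightarrow> \<rho> \<le> \<rho>0 \<Longrightarrow> l \<in> L \<Longrightarrow>
      analytic_diffeo_on (emap ones H l) (polydisk (\<chi> i. \<rho>))"
proof -
  obtain N where N: "N > 0" "\<And>i. nrm L r (H i) \<le> ennreal N"
    using H(2) ennreal_bound_obtain[of "\<lambda>i. nrm L r (H i)"] by blast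
  \<comment> \<open>The number 32 makes every divided difference of the nonlinear part at most
    \<open>1 / 8\<close>.\<close>
  define \<rho>0 where "\<rho>0 = min (r / 2) (r\<^sup>2 / (32 * N))"
  have \<rho>0: "\<rho>0 > 0" "\<rho>0 \<le> r / 2" "\<rho>0 \<le> r\<^sup>2 / (32 * N)" using r N by (auto simp: \<rho>0_def)
  show ?thesis
  proof (rule that[of \<rho>0])
    fix \<rho> :: real and l assume \<rho>: "0 < \<rho>" "\<rho> \<le> \<rho>0" and l: "l \<in> L"
    define f where "f = emap ones H l"
    define U where "U = polydisk (\<chi> i. \<rho>)"
    define P where "P i j x y = (if i = j then 1 else 0) + evq (H i) l j x y" for i j x y
    have U: "x \<in> cpoly \<rho>" "x \<in> cpoly (r / 2)" "x \<in> cpoly r" if "x \<in> U" for x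
      using that polydisk_subset_cpoly[of \<rho>] cpoly_mono[of \<rho> "r / 2"] cpoly_mono[of \<rho> r] \<rho> \<rho>0 r
      by (auto simp: U_def)
    have openU: "open U" by (simp add: U_def open_polydisk)
    have small: "4 * \<rho> / r\<^sup>2 * N \<le> 1 / 8"
    proof -
      have "\<rho> \<le> r\<^sup>2 / (32 * N)" using \<rho> \<rho>0 by linarith
      then have "32 * N * \<rho> \<le> r\<^sup>2" using N by (simp add: field_simps)
      then show ?thesis using r by (simp add: field_simps)
    qed
    have A: "cmod (evq (H i) l j x y) \<le> 1 / 8" if "x \<in> U" "y \<in> U" for i j x y
      using order_trans[OF evq_small[OF N(2) _ l r H(1) _ U(1)[OF that(1)] U(1)[OF that(2)]] small] N \<rho> \<rho>0
      by simp
    have diff: "f y $ i - f x $ i = (\<Sum>j\<in>UNIV. (y $ j - x $ j) * P i j x y)" if "x \<in> U" "y \<in> U" for x y i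
    proof -
      have *: "f x $ i = 1 * x $ i + ev (H i) l x" if "x \<in> U" for x
        unfolding f_def by (rule EV_full[OF H(2) l U(3)[OF that]]) (use r in simp)
      have "f y $ i - f x $ i = (y $ i - x $ i) + (ev (H i) l y - ev (H i) l x)"
        using *[OF that(1)] *[OF that(2)] by simp
      also have "\<dots> = (y $ i - x $ i) + (\<Sum>j\<in>UNIV. (y $ j - x $ j) * evq (H i) l j x y)"
        using ev_diff_quot[OF H(1) H(2) l r U(2)[OF that(1)] U(2)[OF that(2)]] by simp
      also have "\<dots> = (\<Sum>j\<in>UNIV. (y $ j - x $ j) * P i j x y)"
        using exhaust_2[of i] by (auto simp: sum_2 P_def algebra_simps)
      finally show ?thesis .
    qed
    define dt where "dt x y = P 1 1 x y * P 2 2 x y - P 1 2 x y * P 2 1 x y" for x y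
    \<comment> \<open>The determinant differs from 1 by at most
      \<open>1/8 + 1/8 + 1/64 + 1/64 = 9/32\<close>.\<close>
    have dt: "dt x y \<noteq> 0" if "x \<in> U" "y \<in> U" for x y
    proof
      have AA: "cmod (evq (H i) l j x y * evq (H i') l j' x y) \<le> 1 / 8 * (1 / 8)" for i j i' j'
        unfolding norm_mult by (intro mult_mono A that) auto
      assume "dt x y = 0"
      then have "1 = - evq (H 1) l 1 x y - evq (H 2) l 2 x y - evq (H 1) l 1 x y * evq (H 2) l 2 x y
          + evq (H 1) l 2 x y * evq (H 2) l 1 x y"
        by (simp add: dt_def P_def algebra_simps)
      also have "cmod \<dots> \<le> 1 / 8 + 1 / 8 + 1 / 8 * (1 / 8) + 1 / 8 * (1 / 8)"
        by (intro order_trans[OF norm_triangle_ineq add_mono] order_trans[OF norm_triangle_ineq4 add_mono])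
          (simp_all only: norm_minus_cancel AA A[OF that])
      finally show False by simp
    qed
    have solve: "(y $ 1 - x $ 1) * dt x y = (f y $ 1 - f x $ 1) * P 2 2 x y - (f y $ 2 - f x $ 2) * P 1 2 x y"
      "(y $ 2 - x $ 2) * dt x y = (f y $ 2 - f x $ 2) * P 1 1 x y - (f y $ 1 - f x $ 1) * P 2 1 x y"
      if "x \<in> U" "y \<in> U" for x y
      unfolding diff[OF that] sum_2 by (simp_all add: dt_def algebra_simps)
    have inj: "inj_on f U"
    proof (rule inj_onI)
      fix x y assume xy: "x \<in> U" "y \<in> U" and eq: "f x = f y"
      then have "(y $ 1 - x $ 1) * dt x y = 0" "(y $ 2 - x $ 2) * dt x y = 0"
        using solve[OF xy] eq by simp_all
      then show "x = y" using dt[OF xy] by (simp add: vec_eq_iff forall_2)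
    qed
    have contP: "isCont (P i j x) x" if "x \<in> U" for i j x
    proof -
      have "continuous_on U (P i j x)"
        unfolding P_def[abs_def]
        using continuous_on_subset[OF continuous_evq[OF H(1) H(2) l r U(2)[OF that]], of U] U(2)
        by (intro continuous_intros) blast
      then show ?thesis using openU that by (simp add: continuous_on_eq_continuous_at)
    qed
    have der: "((\<lambda>x. f x $ i) has_derivative (\<lambda>v. \<Sum>j\<in>UNIV. P i j x x * v $ j)) (at x)" if "x \<in> U" for i x
      by (rule caratheodory_derivative[OF openU that diff[OF that] contP[OF that]])
    have contf: "continuous_on U f"
    proof -
      have "continuous_on U (\<lambda>x. \<chi> i. f x $ i)"
        by (intro continuous_on_vec_lambda continuous_at_imp_continuous_on ballI)
          (rule has_derivative_continuous[OF der])
      then show ?thesis by simp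
    qed
    \<comment> \<open>Invariance of domain provides the open image and, below, the continuity of the
      inverse, without which its divided differences could not be shown to be continuous.\<close>
    have openV: "open (f ` U)" by (rule invariance_of_domain[OF contf openU inj])
    define g where "g = inv_into U f"
    have gf: "g (f x) = x" if "x \<in> U" for x using that inj by (simp add: g_def)
    have contg: "continuous_on (f ` U) g"
    proof -
      obtain g' where g': "homeomorphism U (f ` U) f g'"
        by (rule invariance_of_domain_homeomorphism[OF openU contf _ inj]) auto
      then have "continuous_on (f ` U) g'" by (simp add: homeomorphism_def)
      then show ?thesis
        by (rule continuous_on_eq) (use g' gf in \<open>auto simp: homeomorphism_def\<close>)
    qed
    have mvf: "mv_analytic_on (\<lambda>x. f x $ i) U" for i
      unfolding mv_analytic_on_def
    proof (intro conjI ballI openU)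
      fix x assume "x \<in> U"
      from der[OF this, of i]
      show "\<exists>D. ((\<lambda>x. f x $ i) has_derivative (\<lambda>v. \<Sum>j\<in>UNIV. D $ j * v $ j)) (at x)"
        by (intro exI[of _ "\<chi> j. P i j x x"]) simp
    qed
    have mvg: "mv_analytic_on (\<lambda>y. g y $ i) (f ` U)" for i
      unfolding mv_analytic_on_def
    proof (intro conjI ballI openV)
      fix z assume z: "z \<in> f ` U"
      then obtain x where x: "x \<in> U" "z = f x" by blast
      \<comment> \<open>Row \<open>i\<close> of the inverse of the matrix \<open>P\<close> at the
        points \<open>x\<close> and \<open>g w\<close>, by Cramer's rule.\<close>
      define B where "B j w = (if i = 1
          then if j = 1 then P 2 2 x (g w) / dt x (g w) else - P 1 2 x (g w) / dt x (g w)
          else if j = 1 then - P 2 1 x (g w) / dt x (g w) else P 1 1 x (g w) / dt x (g w))" for j :: 2 and w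
      have Pc: "isCont (\<lambda>w. P i j x (g w)) z" for i j
      proof (rule isCont_o2[where g = "P i j x"])
        show "isCont g z" using contg openV z by (metis continuous_on_eq_continuous_at)
        show "isCont (P i j x) (g z)" using contP[OF x(1)] gf[OF x(1)] x(2) by simp
      qed
      have dtz: "dt x (g z) \<noteq> 0" using dt[OF x(1) x(1)] gf[OF x(1)] x(2) by simp
      have dtc: "isCont (\<lambda>w. dt x (g w)) z" unfolding dt_def by (intro continuous_intros Pc)
      have "((\<lambda>y. g y $ i) has_derivative (\<lambda>v. \<Sum>j\<in>UNIV. B j z * v $ j)) (at z)"
      proof (rule caratheodory_derivative[OF openV z])
        fix w assume "w \<in> f ` U"
        then obtain y where y: "y \<in> U" "w = f y" by blast
        have "(g w $ i - g z $ i) * dt x y = (\<Sum>j\<in>UNIV. (w $ j - z $ j) * B j w) * dt x y"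
          unfolding x(2) y(2) gf[OF x(1)] gf[OF y(1)]
          using exhaust_2[of i] solve[OF x(1) y(1)] dt[OF x(1) y(1)]
          by (auto simp: sum_2 B_def gf[OF y(1)] distrib_right)
        then show "g w $ i - g z $ i = (\<Sum>j\<in>UNIV. (w $ j - z $ j) * B j w)"
          using dt[OF x(1) y(1)] by simp
      next
        show "isCont (B j) z" for j
          unfolding B_def[abs_def]
          by (cases "i = 1"; cases "j = 1"; simp only: if_True if_False simp_thms)
            (intro continuous_intros Pc dtc dtz)+
      qed
      then show "\<exists>D. ((\<lambda>y. g y $ i) has_derivative (\<lambda>v. \<Sum>j\<in>UNIV. D $ j * v $ j)) (at z)"
        by (intro exI[of _ "\<chi> j. B j z"]) simp
    qed
    show "analytic_diffeo_on (emap ones H l) (polydisk (\<chi> i. \<rho>))"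
      using inj mvf mvg unfolding analytic_diffeo_on_def g_def f_def U_def by simp
  qed (use \<rho>0 r in auto)
qed

subsection \<open>Assembling the normal form\<close>

lemma mv_analytic_const: "open U \<Longrightarrow> mv_analytic_on (\<lambda>l. c) U"
  unfolding mv_analytic_on_def by (auto intro!: exI[of _ 0])

lemma mv_analytic_add:
  assumes "mv_analytic_on c U" "mv_analytic_on d U"
  shows "mv_analytic_on (\<lambda>l. c l + d l) U"
  unfolding mv_analytic_on_def
proof (intro conjI ballI)
  fix z assume "z \<in> U"
  with assms obtain C D where "(c has_derivative (\<lambda>v. \<Sum>i\<in>UNIV. C $ i * v $ i)) (at z)"
    "(d has_derivative (\<lambda>v. \<Sum>i\<in>UNIV. D $ i * v $ i)) (at z)"
    unfolding mv_analytic_on_def by blast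
  from has_derivative_add[OF this]
  show "\<exists>D. ((\<lambda>l. c l + d l) has_derivative (\<lambda>v. \<Sum>i\<in>UNIV. D $ i * v $ i)) (at z)"
    by (intro exI[of _ "C + D"]) (simp add: sum.distrib distrib_right)
qed (use assms in \<open>simp add: mv_analytic_on_def\<close>)

lemma mv_analytic_mult:
  assumes "mv_analytic_on c U" "mv_analytic_on d U"
  shows "mv_analytic_on (\<lambda>l. c l * d l) U"
  unfolding mv_analytic_on_def
proof (intro conjI ballI)
  fix z assume "z \<in> U"
  with assms obtain C D where "(c has_derivative (\<lambda>v. \<Sum>i\<in>UNIV. C $ i * v $ i)) (at z)"
    "(d has_derivative (\<lambda>v. \<Sum>i\<in>UNIV. D $ i * v $ i)) (at z)"
    unfolding mv_analytic_on_def by blast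
  from has_derivative_mult[OF this]
  show "\<exists>D. ((\<lambda>l. c l * d l) has_derivative (\<lambda>v. \<Sum>i\<in>UNIV. D $ i * v $ i)) (at z)"
    by (intro exI[of _ "\<chi> i. c z * D $ i + C $ i * d z"])
      (simp add: sum.distrib sum_distrib_left algebra_simps)
qed (use assms in \<open>simp add: mv_analytic_on_def\<close>)

lemma mv_analytic_inverse:
  assumes "mv_analytic_on c U" "\<And>l. l \<in> U \<Longrightarrow> c l \<noteq> 0"
  shows "mv_analytic_on (\<lambda>l. inverse (c l)) U"
  unfolding mv_analytic_on_def
proof (intro conjI ballI)
  fix z assume z: "z \<in> U"
  with assms obtain C where "(c has_derivative (\<lambda>v. \<Sum>i\<in>UNIV. C $ i * v $ i)) (at z)"
    unfolding mv_analytic_on_def by blast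
  from Deriv.has_derivative_inverse[OF assms(2)[OF z] this]
  show "\<exists>D. ((\<lambda>l. inverse (c l)) has_derivative (\<lambda>v. \<Sum>i\<in>UNIV. D $ i * v $ i)) (at z)"
    by (intro exI[of _ "\<chi> i. - (inverse (c z) * C $ i * inverse (c z))"])
      (simp add: sum_distrib_left sum_distrib_right sum_negf mult_ac)
qed (use assms in \<open>simp add: mv_analytic_on_def\<close>)

lemma mv_analytic_subset: "mv_analytic_on c U \<Longrightarrow> V \<subseteq> U \<Longrightarrow> open V \<Longrightarrow> mv_analytic_on c V"
  unfolding mv_analytic_on_def by blast

lemma coef_algebra_UNIV: "coef_algebra UNIV L"
  by unfold_locales auto

lemma coef_algebra_analytic: "open L \<Longrightarrow> coef_algebra {c. mv_analytic_on c L} L"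
  by unfold_locales (auto intro: mv_analytic_const mv_analytic_add mv_analytic_mult mv_analytic_inverse)

lemma has_sum_vec:
  fixes f :: "'k \<Rightarrow> ('b::topological_comm_monoid_add)^'n"
  assumes "\<And>i. ((\<lambda>k. f k $ i) has_sum (v $ i)) K"
  shows "(f has_sum v) K"
  using assms unfolding has_sum_def by (intro vec_tendstoI) (simp add: sum_component)

text \<open>\<open>enn2real\<close> sends infinity to 0, so this is an upper bound only where
  \<open>csup\<close> is finite.\<close>

definition rsup :: "'l set \<Rightarrow> ('l \<Rightarrow> complex) \<Rightarrow> real" where
  "rsup L c = enn2real (csup L c)"

lemma csup_finite:
  assumes "nrm L \<rho> X < \<infinity>" "\<rho> > 0"
  shows "csup L (X k) < \<infinity>"
proof -
  have "csup L (X k) * ennreal (\<rho> ^ mdeg k) \<le> nrm L \<rho> X"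
    using sum_le_nnsum[of "{k}" "\<lambda>k. csup L (X k) * ennreal (\<rho> ^ mdeg k)"] by (simp add: nrm_def)
  then have "csup L (X k) * ennreal (\<rho> ^ mdeg k) < \<infinity>" using assms(1) by (rule le_less_trans)
  then show ?thesis using assms(2) by (auto simp: ennreal_mult_less_top)
qed

lemma rsup_upper:
  assumes "nrm L \<rho> X < \<infinity>" "\<rho> > 0" "l \<in> L"
  shows "cmod (X k l) \<le> rsup L (X k)"
proof -
  have "ennreal (cmod (X k l)) \<le> ennreal (rsup L (X k))"
    using csup_upper[OF assms(3), of "X k"] csup_finite[OF assms(1,2), of k] by (simp add: rsup_def less_top)
  then show ?thesis by (simp add: rsup_def)
qed

lemma rsup_summable:
  assumes "nrm L \<rho> X < \<infinity>" "\<rho> > 0"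
  shows "(\<lambda>k. rsup L (X k) * \<rho> ^ mdeg k) summable_on UNIV"
proof -
  have "ennreal (norm (rsup L (X k) * \<rho> ^ mdeg k)) = csup L (X k) * ennreal (\<rho> ^ mdeg k)" for k
    using csup_finite[OF assms, of k] assms(2) by (simp add: rsup_def ennreal_mult less_top abs_mult)
  then have "(\<lambda>k. rsup L (X k) * \<rho> ^ mdeg k) abs_summable_on UNIV"
    using assms(1) by (intro abs_summable_if_nnsum_finite) (simp add: nrm_def)
  then show ?thesis using summable_on_iff_abs_summable_on_real by blast
qed

lemma abs_convI:
  fixes c :: "'k \<Rightarrow> 'l \<Rightarrow> 'b::real_normed_vector"
  assumes L: "L \<noteq> {}" and b: "\<And>k l. k \<in> K \<Longrightarrow> l \<in> L \<Longrightarrow> norm (c k l) \<le> C k"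
    and s: "(\<lambda>k. C k * \<rho> ^ mdeg (e k)) summable_on K"
  shows "abs_conv L (\<chi> i. \<rho>) K e c"
  unfolding abs_conv_def
proof (intro conjI ballI)
  show "bounded (c k ` L)" if "k \<in> K" for k
    using b[OF that] by (intro boundedI[where B = "C k"]) auto
  fix x :: "complex^2" assume "x \<in> polydisk (\<chi> i. \<rho>)"
  then have x: "x \<in> cpoly \<rho>" using polydisk_subset_cpoly by blast
  show "(\<lambda>k. (SUP l\<in>L. norm (c k l)) * cmod (mpow x (e k))) summable_on K"
  proof (rule summable_on_comparison_test[OF s])
    fix k assume k: "k \<in> K"
    obtain l where l: "l \<in> L" using L by blast
    have bdd: "bdd_above ((\<lambda>l. norm (c k l)) ` L)" using b[OF k] by (intro bdd_aboveI2[where M = "C k"])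
    have S: "(SUP l\<in>L. norm (c k l)) \<le> C k" using L b[OF k] by (rule cSUP_least)
    have S0: "0 \<le> (SUP l\<in>L. norm (c k l))"
      using cSUP_upper[OF l bdd] norm_ge_zero[of "c k l"] by linarith
    show "(SUP l\<in>L. norm (c k l)) * cmod (mpow x (e k)) \<le> C k * \<rho> ^ mdeg (e k)"
      using S S0 mpow_bound[OF x, of "e k"] by (intro mult_mono) auto
    show "0 \<le> (SUP l\<in>L. norm (c k l)) * cmod (mpow x (e k))" using S0 by simp
  qed
qed

lemma power_series_family_EV:
  assumes L: "L \<noteq> {}" and v: "\<And>i. nrm L \<rho> (v i) < \<infinity>" and \<rho>: "\<rho> > 0"
  shows "power_series_family L (\<chi> i. \<rho>) (EV v) (\<lambda>k l. \<chi> i. v i k l)"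
  unfolding power_series_family_def
proof (intro conjI ballI)
  show "abs_conv L (\<chi> i. \<rho>) UNIV (\<lambda>k. k) (\<lambda>k l. \<chi> i. v i k l)"
  proof (rule abs_convI[OF L])
    show "norm (\<chi> i. v i k l) \<le> rsup L (v 1 k) + rsup L (v 2 k)" if "l \<in> L" for k l
    proof -
      have "norm (\<chi> i. v i k l) \<le> (\<Sum>i\<in>UNIV. norm ((\<chi> i. v i k l) $ i))"
        unfolding norm_vec_def by (rule L2_set_le_sum) simp
      also have "\<dots> \<le> rsup L (v 1 k) + rsup L (v 2 k)"
        using rsup_upper[OF v \<rho> that] by (simp add: sum_2 add_mono)
      finally show ?thesis .
    qed
    show "(\<lambda>k. (rsup L (v 1 k) + rsup L (v 2 k)) * \<rho> ^ mdeg k) summable_on UNIV"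
      unfolding distrib_right by (intro summable_on_add rsup_summable v \<rho>)
  qed
  fix l x assume l: "l \<in> L" and x: "x \<in> polydisk (\<chi> i. \<rho>)"
  then have x: "x \<in> cpoly \<rho>" using polydisk_subset_cpoly by blast
  have "((\<lambda>k. mpow x k *s (\<chi> i. v i k l)) has_sum EV v l x) UNIV"
    by (rule has_sum_vec) (use ev_has_sum[OF v l x] in \<open>simp add: EV_def mult.commute\<close>)
  then show "EV v l x = (\<Sum>\<^sub>\<infinity>k. mpow x k *s (\<chi> i. v i k l))" by (rule infsumI[symmetric])
qed

text \<open>Dividing a component by \<open>x_i\<close> costs only the constant factor
  \<open>1 / \<rho>\<close>.\<close>

lemma summable_shifted:
  assumes s: "(\<lambda>k. C k * \<rho> ^ mdeg k) summable_on UNIV" and \<rho>: "\<rho> > 0" and inj: "inj_on e K"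
  shows "(\<lambda>k. (C (ei i + e k) :: real) * \<rho> ^ mdeg (e k)) summable_on K"
proof -
  have inj': "inj_on (\<lambda>k. ei i + e k) K" using inj by (auto simp: inj_on_def)
  have "(\<lambda>k. C k * \<rho> ^ mdeg k) summable_on (\<lambda>k. ei i + e k) ` K"
    using s by (rule summable_on_subset_banach) simp
  then have "(\<lambda>k. C (ei i + e k) * \<rho> ^ mdeg (ei i + e k)) summable_on K"
    unfolding summable_on_reindex[OF inj'] by (simp add: o_def)
  then have "(\<lambda>k. 1 / \<rho> * (C (ei i + e k) * \<rho> ^ mdeg (ei i + e k))) summable_on K"
    by (rule summable_on_cmult_right)
  then show ?thesis using \<rho> by (simp add: mult_ac)
qed

lemma analytic_in_u_power_series:
  assumes b: "\<And>j l. l \<in> L \<Longrightarrow> cmod (\<beta> j l) \<le> C j" and s: "(\<lambda>j. C j * \<delta> ^ j) summable_on UNIV"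
  shows "analytic_in_u L \<delta> (\<lambda>u l. \<Sum>\<^sub>\<infinity>j. \<beta> j l * u ^ j) \<beta>"
  unfolding analytic_in_u_def
proof (intro ballI conjI)
  fix l assume l: "l \<in> L"
  show hs: "((\<lambda>j. \<beta> j l * u ^ j) has_sum (\<Sum>\<^sub>\<infinity>j. \<beta> j l * u ^ j)) UNIV" if "u \<in> ball 0 \<delta>" for u
  proof (rule has_sum_infsum[OF abs_summable_summable], rule summable_on_comparison_test[OF s])
    fix j
    have "0 \<le> C j" using b[OF l, of j] norm_ge_zero[of "\<beta> j l"] by linarith
    then show "norm (\<beta> j l * u ^ j) \<le> C j * \<delta> ^ j"
      using b[OF l, of j] that by (auto simp: norm_mult norm_power intro!: mult_mono power_mono)
  qed simp
  have "(\<lambda>u. \<Sum>\<^sub>\<infinity>j. \<beta> j l * u ^ j) holomorphic_on ball 0 \<delta>"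
    by (rule power_series_holomorphic[where a = "\<lambda>j. \<beta> j l"]) (use has_sum_imp_sums[OF hs] in simp)
  then show "(\<lambda>u. \<Sum>\<^sub>\<infinity>j. \<beta> j l * u ^ j) analytic_on ball 0 \<delta>"
    by (simp add: analytic_on_open)
qed

text \<open>At the point \<open>(r, r)\<close> of the open polydisk the monomials become the weights
  \<open>r ^ mdeg k\<close>, so convergence there is finiteness of the norm of radius
  \<open>r\<close>.\<close>

lemma nrm_of_abs_conv:
  fixes a :: "nat \<times> nat \<Rightarrow> 'l \<Rightarrow> complex^2"
  assumes conv: "abs_conv \<Lambda> R {k. mdeg k \<ge> 2} (\<lambda>k. k) a" and L: "L \<subseteq> \<Lambda>"
    and r: "0 \<le> r" "\<And>i. r < R $ i"
  shows "nrm L r (\<lambda>k l. if mdeg k \<ge> 2 then a k l $ i else 0) < \<infinity>"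
proof -
  let ?F = "\<lambda>k l. if mdeg k \<ge> 2 then a k l $ i else 0"
  let ?K = "{k. mdeg k \<ge> 2}"
  define s where "s k = (SUP l\<in>\<Lambda>. norm (a k l)) * r ^ mdeg k" for k
  let ?x = "(\<chi> i. of_real r) :: complex^2"
  have "mpow ?x k = of_real r ^ mdeg k" for k by (simp add: mpow_def mdeg_def power_add)
  then have x: "cmod (mpow ?x k) = r ^ mdeg k" for k using r by (simp add: norm_power)
  have "?x \<in> polydisk R" using r by (simp add: polydisk_def)
  then have s: "s summable_on ?K"
    using conv unfolding abs_conv_def s_def x[symmetric] by blast
  have le: "cmod (a k l $ i) * r ^ mdeg k \<le> s k" if "k \<in> ?K" "l \<in> L" for k l
  proof -
    have "bounded (a k ` \<Lambda>)" using conv that(1) unfolding abs_conv_def by blast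
    then obtain b where "\<And>l. l \<in> \<Lambda> \<Longrightarrow> norm (a k l) \<le> b" unfolding bounded_iff by blast
    then have "bdd_above ((\<lambda>l. norm (a k l)) ` \<Lambda>)" by (rule bdd_aboveI2)
    then have "norm (a k l) \<le> (SUP l\<in>\<Lambda>. norm (a k l))" using that L by (intro cSUP_upper) auto
    then have "cmod (a k l $ i) \<le> (SUP l\<in>\<Lambda>. norm (a k l))"
      using Finite_Cartesian_Product.norm_nth_le[of "a k l" i] by linarith
    then show ?thesis unfolding s_def using r by (intro mult_right_mono) auto
  qed
  show ?thesis
  proof (cases "L = {}")
    case True
    then show ?thesis by (simp add: nrm_def csup_def bot_ennreal)
  next
    case False
    then obtain l0 where l0: "l0 \<in> L" by blast
    have s0: "0 \<le> s k" if "k \<in> ?K" for k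
      using le[OF that l0] r by (meson mult_nonneg_nonneg norm_ge_zero order_trans zero_le_power)
    have summand: "csup L (?F k) * ennreal (r ^ mdeg k) \<le> (if k \<in> ?K then ennreal (s k) else 0)" for k
    proof (cases "k \<in> ?K")
      case True
      have "csup L (?F k) * ennreal (r ^ mdeg k) = (SUP l\<in>L. ennreal (cmod (?F k l)) * ennreal (r ^ mdeg k))"
        unfolding csup_def by (rule SUP_mult_right_ennreal)
      also have "\<dots> \<le> ennreal (s k)"
        using le[OF True] True r by (intro SUP_least) (auto intro!: ennreal_leI simp flip: ennreal_mult)
      finally show ?thesis using True by simp
    qed simp
    have "nrm L r ?F \<le> ennreal (infsum s ?K)"
      unfolding nrm_def
    proof (rule nnsum_le)
      fix n
      have "(\<Sum>k | mdeg k \<le> n. csup L (?F k) * ennreal (r ^ mdeg k)) \<le>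
          (\<Sum>k | mdeg k \<le> n. if k \<in> ?K then ennreal (s k) else 0)"
        by (rule sum_mono) (rule summand)
      also have "\<dots> = (\<Sum>k\<in>{k. mdeg k \<le> n} \<inter> ?K. ennreal (s k))"
        by (simp add: sum.inter_restrict)
      also have "\<dots> = ennreal (\<Sum>k\<in>{k. mdeg k \<le> n} \<inter> ?K. s k)"
        using s0 by (intro sum_ennreal) auto
      also have "\<dots> \<le> ennreal (infsum s ?K)"
        using s0 by (intro ennreal_leI finite_sum_le_infsum s) auto
      finally show "(\<Sum>k | mdeg k \<le> n. csup L (?F k) * ennreal (r ^ mdeg k)) \<le> ennreal (infsum s ?K)" .
    qed
    also have "\<dots> < \<infinity>" by simp
    finally show ?thesis .
  qed
qed

context resonance
begin

text \<open>For \<open>\<tau> > 0\<close> the side with \<open>mm < 0\<close> is contracted by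
  \<open>\<mu>\<close>, so \<open>M = Hb\<close> and the complement of \<open>Ha\<close> is left to
  the inverse multipliers; for \<open>\<tau> < 0\<close> the roles are exchanged. The smaller of the
  two tolerances serves both.\<close>

lemma splitting:
  fixes t :: "2 \<Rightarrow> real"
  assumes t: "\<And>i. t i > 0" and \<tau>: "ln (t 1) = of_nat q * \<tau>" "ln (t 2) = - of_nat p * \<tau>" "\<tau> \<noteq> 0"
  obtains \<eta> M S where "\<eta> > 0" "monoid_set M" "M - S = Ha \<inter> Hb"
    "\<And>(L :: 'l set) \<mu>. (\<And>i l. l \<in> L \<Longrightarrow> t i / (1 + \<eta>) \<le> cmod (\<mu> i l) \<and> cmod (\<mu> i l) \<le> t i * (1 + \<eta>)) \<Longrightarrow>
      contracting L \<mu> (- M) \<and> contracting L (\<lambda>i l. inverse (\<mu> i l)) (M \<inter> S)"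
proof -
  let ?t = "\<lambda>i. inverse (t i)" and ?B = "(p + q) * (N + 1)"
  have t': "?t i > 0" for i using t by simp
  have \<tau>': "ln (?t 1) = of_nat q * - \<tau>" "ln (?t 2) = - of_nat p * - \<tau>"
    using t[of 1] t[of 2] \<tau> by (simp_all add: ln_inverse)
  have "\<exists>M S \<theta>. monoid_set M \<and> M - S = Ha \<inter> Hb \<and> 0 < \<theta> \<and> \<theta> < 1 \<and> gain t \<theta> ?B (- M) \<and> gain ?t \<theta> ?B (- (- S))"
  proof (cases "\<tau> > 0")
    case True
    then show ?thesis
      using gain_Hb[OF t \<tau>(1,2)] gain_Ha[OF t' \<tau>'] monoid_Hb
      by (intro exI[of _ Hb] exI[of _ "- Ha"] exI[of _ "exp (- \<tau>)"]) auto
  next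
    case False
    then show ?thesis
      using gain_Ha[OF t \<tau>(1,2)] gain_Hb[OF t' \<tau>'] monoid_Ha \<tau>(3)
      by (intro exI[of _ Ha] exI[of _ "- Hb"] exI[of _ "exp \<tau>"]) auto
  qed
  then obtain M S \<theta> where M: "monoid_set M" "M - S = Ha \<inter> Hb" and \<theta>: "0 < \<theta>" "\<theta> < 1"
    and g: "gain t \<theta> ?B (- M)" "gain ?t \<theta> ?B S"
    by auto
  obtain \<eta>1 where 1: "\<eta>1 > 0" "\<And>\<eta>' (L :: 'l set) \<mu>. 0 < \<eta>' \<Longrightarrow> \<eta>' \<le> \<eta>1 \<Longrightarrow>
    (\<And>i l. l \<in> L \<Longrightarrow> t i / (1 + \<eta>') \<le> cmod (\<mu> i l) \<and> cmod (\<mu> i l) \<le> t i * (1 + \<eta>')) \<Longrightarrow> contracting L \<mu> (- M)"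
    by (rule contracting_if_gain[OF g(1) t \<theta>]) blast
  obtain \<eta>2 where 2: "\<eta>2 > 0" "\<And>\<eta>' (L :: 'l set) \<mu>. 0 < \<eta>' \<Longrightarrow> \<eta>' \<le> \<eta>2 \<Longrightarrow>
    (\<And>i l. l \<in> L \<Longrightarrow> ?t i / (1 + \<eta>') \<le> cmod (\<mu> i l) \<and> cmod (\<mu> i l) \<le> ?t i * (1 + \<eta>')) \<Longrightarrow> contracting L \<mu> S"
    by (rule contracting_if_gain[OF g(2) t' \<theta>]) blast
  show ?thesis
  proof (rule that[of "min \<eta>1 \<eta>2" M S])
    fix L :: "'l set" and \<mu>
    let ?\<eta> = "min \<eta>1 \<eta>2"
    assume *: "\<And>i l. l \<in> L \<Longrightarrow> t i / (1 + ?\<eta>) \<le> cmod (\<mu> i l) \<and> cmod (\<mu> i l) \<le> t i * (1 + ?\<eta>)"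
    have \<eta>: "?\<eta> > 0" using 1 2 by simp
    have "contracting L \<mu> (- M)" by (rule 1(2)[OF \<eta> _ *]) auto
    moreover have "contracting L (\<lambda>i l. inverse (\<mu> i l)) S"
    proof (rule 2(2)[OF \<eta>])
      fix i l assume l: "l \<in> L"
      have pos: "0 < t i / (1 + ?\<eta>)" using t[of i] \<eta> by (intro divide_pos_pos add_pos_pos) auto
      then have pos': "0 < cmod (\<mu> i l)" using *[OF l, of i] by linarith
      have "inverse (t i * (1 + ?\<eta>)) \<le> inverse (cmod (\<mu> i l))"
        "inverse (cmod (\<mu> i l)) \<le> inverse (t i / (1 + ?\<eta>))"
        using *[OF l, of i] pos pos' by (blast intro: le_imp_inverse_le)+
      then show "?t i / (1 + ?\<eta>) \<le> cmod (inverse (\<mu> i l)) \<and> cmod (inverse (\<mu> i l)) \<le> ?t i * (1 + ?\<eta>)"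
        by (simp add: norm_inverse divide_inverse)
    qed simp
    ultimately show "contracting L \<mu> (- M) \<and> contracting L (\<lambda>i l. inverse (\<mu> i l)) (M \<inter> S)"
      by (auto intro: contracting_mono)
  qed (use 1 2 M in auto)
qed

lemma mpow_ex0: "mpow x (ex0 j) = (x $ 1 ^ p * x $ 2 ^ q) ^ j"
  by (simp add: mpow_def ex0_def power_mult power_mult_distrib)

lemma mpow_exA: "mpow x (exA (k, j)) = (x $ 1 ^ p * x $ 2 ^ q) *
    ((x $ 1 ^ p * x $ 2 ^ q) ^ (N * k) * mpow x (k * r0, k * s0) * (x $ 1 ^ p * x $ 2 ^ q) ^ j)"
  by (simp add: mpow_def exA_def power_mult power_mult_distrib power_add mult_ac)

lemma mpow_exB: "mpow x (exB (k, j)) = (x $ 1 ^ p * x $ 2 ^ q) *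
    ((x $ 1 ^ p * x $ 2 ^ q) ^ (N * k) * mpow x (k * r1, k * s1) * (x $ 1 ^ p * x $ 2 ^ q) ^ j)"
  by (simp add: mpow_def exB_def power_mult power_mult_distrib power_add mult_ac)

end

context resonance
begin

text \<open>For \<open>j = 0\<close> the monomial is \<open>x_i\<close> itself, whose coefficient is
  the eigenvalue.\<close>

definition coef0 :: "'l ser \<Rightarrow> 2 \<Rightarrow> nat \<Rightarrow> 'l \<Rightarrow> complex" where
  "coef0 G i j = (if j = 0 then (\<lambda>l. 0) else G (ei i + ex0 j))"

definition coefA :: "'l ser \<Rightarrow> 2 \<Rightarrow> nat \<Rightarrow> nat \<Rightarrow> 'l \<Rightarrow> complex" where
  "coefA G i k j = G (ei i + exA (k, j))"

definition coefB :: "'l ser \<Rightarrow> 2 \<Rightarrow> nat \<Rightarrow> nat \<Rightarrow> 'l \<Rightarrow> complex" where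
  "coefB G i k j = G (ei i + exB (k, j))"

text \<open>After division by \<open>x_i\<close> the absolutely convergent series is regrouped along
  the three disjoint families of exponents, with the powers of \<open>u\<close> collected in the
  inner sums.\<close>

lemma kept_expansion:
  assumes G: "ord2 G" "supp (Ha \<inter> Hb) (emb (ei i)) G" "nrm L \<sigma> G < \<infinity>" "\<sigma> > 0"
    and l: "l \<in> L" and x: "x \<in> cpoly \<sigma>"
  defines "u \<equiv> x $ 1 ^ p * x $ 2 ^ q"
  shows "ev G l x = x $ i * ((\<Sum>\<^sub>\<infinity>j. coef0 G i j l * u ^ j) +
    u * (\<Sum>\<^sub>\<infinity>k\<in>{1..}. u ^ (N * k) *
      (mpow x (k * r0, k * s0) * (\<Sum>\<^sub>\<infinity>j. coefA G i k j l * u ^ j) +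
       mpow x (k * r1, k * s1) * (\<Sum>\<^sub>\<infinity>j. coefB G i k j l * u ^ j))))"
proof -
  let ?K = "{1::nat..} \<times> (UNIV :: nat set)"
  define w where "w e = G (ei i + e) l * mpow x e" for e
  have w: "w summable_on E" for E
  proof -
    have "(\<lambda>e. rsup L (G (ei i + e)) * \<sigma> ^ mdeg e) summable_on UNIV"
      using summable_shifted[where e = "\<lambda>e. e", OF rsup_summable[OF G(3,4)] G(4)] by simp
    then have "w abs_summable_on UNIV"
    proof (rule summable_on_comparison_test)
      fix e
      show "norm (w e) \<le> rsup L (G (ei i + e)) * \<sigma> ^ mdeg e"
        unfolding w_def norm_mult using rsup_upper[OF G(3,4) l, of "ei i + e"] mpow_bound[OF x, of e]
        by (intro mult_mono) (auto intro: order_trans[OF norm_ge_zero])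
    qed simp
    then have "w summable_on UNIV" by (rule abs_summable_summable)
    then show ?thesis by (rule summable_on_subset_banach) simp
  qed
  have row_summable: "(\<lambda>(k, j). w (e (k, j))) summable_on ?K" if "inj e" for e
    using w[of "e ` ?K"] summable_on_reindex[OF inj_on_subset[OF that], of ?K w]
    by (simp add: o_def case_prod_unfold)
  have row: "infsum w (e ` ?K) = (\<Sum>\<^sub>\<infinity>k\<in>{1..}. \<Sum>\<^sub>\<infinity>j. w (e (k, j)))" if "inj e" for e
    using infsum_Sigma'_banach[OF row_summable[OF that]]
    by (subst infsum_reindex) (auto intro: inj_on_subset[OF that] simp: o_def case_prod_unfold)
  let ?E = "ex0 ` {1..} \<union> exA ` ?K \<union> exB ` ?K"
  have "ev G l x = (\<Sum>\<^sub>\<infinity>k\<in>(\<lambda>e. ei i + e) ` ?E. G k l * mpow x k)"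
    unfolding ev_def
  proof (rule infsum_cong_neutral)
    fix k assume k: "k \<in> UNIV - (\<lambda>e. ei i + e) ` ?E"
    have "G k l = 0"
    proof (rule ccontr)
      assume "G k l \<noteq> 0"
      then have "mdeg k \<ge> 2" "emb k - emb (ei i) \<in> Ha \<inter> Hb" using G(1,2) by (auto simp: ord2_def supp_def not_le[symmetric])
      from kept_exponents[OF this] show False using k by blast
    qed
    then show "G k l * mpow x k = 0" by simp
  qed auto
  also have "\<dots> = (\<Sum>\<^sub>\<infinity>e\<in>?E. G (ei i + e) l * mpow x (ei i + e))"
    by (subst infsum_reindex) (auto simp: inj_on_def o_def)
  also have "\<dots> = x $ i * infsum w ?E"
    unfolding infsum_cmult_right'[symmetric] by (rule infsum_cong) (simp add: w_def mpow_add mult_ac)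
  also have "infsum w ?E = infsum w (ex0 ` {1..}) + infsum w (exA ` ?K) + infsum w (exB ` ?K)"
  proof -
    have "infsum w ?E = infsum w (ex0 ` {1..} \<union> exA ` ?K) + infsum w (exB ` ?K)"
      by (rule infsum_Un_disjoint[OF w w]) (simp only: Int_Un_distrib2 disjoint_exponents Un_empty_left)
    also have "infsum w (ex0 ` {1..} \<union> exA ` ?K) = infsum w (ex0 ` {1..}) + infsum w (exA ` ?K)"
      by (rule infsum_Un_disjoint[OF w w]) (rule disjoint_exponents)
    finally show ?thesis .
  qed
  also have "infsum w (ex0 ` {1..}) = (\<Sum>\<^sub>\<infinity>j. coef0 G i j l * u ^ j)"
  proof -
    have "infsum w (ex0 ` {1..}) = (\<Sum>\<^sub>\<infinity>j\<in>{1..}. w (ex0 j))"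
      by (subst infsum_reindex) (auto intro: inj_on_subset[OF inj_ex0] simp: o_def)
    also have "\<dots> = (\<Sum>\<^sub>\<infinity>j. coef0 G i j l * u ^ j)"
      by (rule infsum_cong_neutral) (auto simp: coef0_def w_def mpow_ex0 u_def)
    finally show ?thesis .
  qed
  also have "infsum w (exA ` ?K) = (\<Sum>\<^sub>\<infinity>k\<in>{1..}. \<Sum>\<^sub>\<infinity>j. w (exA (k, j)))" by (rule row[OF inj_exA])
  also have "infsum w (exB ` ?K) = (\<Sum>\<^sub>\<infinity>k\<in>{1..}. \<Sum>\<^sub>\<infinity>j. w (exB (k, j)))" by (rule row[OF inj_exB])
  also have "(\<Sum>\<^sub>\<infinity>j. coef0 G i j l * u ^ j) + (\<Sum>\<^sub>\<infinity>k\<in>{1..}. \<Sum>\<^sub>\<infinity>j. w (exA (k, j))) + (\<Sum>\<^sub>\<infinity>k\<in>{1..}. \<Sum>\<^sub>\<infinity>j. w (exB (k, j))) =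
     (\<Sum>\<^sub>\<infinity>j. coef0 G i j l * u ^ j) + (\<Sum>\<^sub>\<infinity>k\<in>{1..}. (\<Sum>\<^sub>\<infinity>j. w (exA (k, j))) + (\<Sum>\<^sub>\<infinity>j. w (exB (k, j))))"
    unfolding infsum_add[OF row_summable[OF inj_exA, THEN summable_on_Sigma_banach]
      row_summable[OF inj_exB, THEN summable_on_Sigma_banach]]
    by (simp only: add.assoc)
  also have "(\<Sum>\<^sub>\<infinity>k\<in>{1..}. (\<Sum>\<^sub>\<infinity>j. w (exA (k, j))) + (\<Sum>\<^sub>\<infinity>j. w (exB (k, j)))) =
    u * (\<Sum>\<^sub>\<infinity>k\<in>{1..}. u ^ (N * k) *
      (mpow x (k * r0, k * s0) * (\<Sum>\<^sub>\<infinity>j. coefA G i k j l * u ^ j) +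
       mpow x (k * r1, k * s1) * (\<Sum>\<^sub>\<infinity>j. coefB G i k j l * u ^ j)))"
    unfolding infsum_cmult_right'[symmetric]
  proof (rule infsum_cong)
    fix k
    have A: "w (exA (k, j)) = u * (u ^ (N * k) * (mpow x (k * r0, k * s0) * (coefA G i k j l * u ^ j)))" for j
      by (simp add: w_def coefA_def mpow_exA u_def mult_ac)
    have B: "w (exB (k, j)) = u * (u ^ (N * k) * (mpow x (k * r1, k * s1) * (coefB G i k j l * u ^ j)))" for j
      by (simp add: w_def coefB_def mpow_exB u_def mult_ac)
    show "(\<Sum>\<^sub>\<infinity>j. w (exA (k, j))) + (\<Sum>\<^sub>\<infinity>j. w (exB (k, j))) =
      u * (u ^ (N * k) *
        ((\<Sum>\<^sub>\<infinity>j. mpow x (k * r0, k * s0) * (coefA G i k j l * u ^ j)) +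
         (\<Sum>\<^sub>\<infinity>j. mpow x (k * r1, k * s1) * (coefB G i k j l * u ^ j))))"
      unfolding A B infsum_cmult_right' by (simp add: algebra_simps)
  qed
  finally show ?thesis .
qed

text \<open>All coefficient families are reindexed injectively from the coefficients of
  \<open>G\<close>, so they inherit its weighted summability. On the polydisk of radius
  \<open>\<sigma>\<close> the variable \<open>u\<close> is bounded by
  \<open>\<delta>\<close>.\<close>

lemma coef_convergence:
  assumes G: "nrm L \<sigma> G < \<infinity>" "\<sigma> > 0" and L: "L \<noteq> {}"
  defines "\<delta> \<equiv> \<sigma> ^ p * \<sigma> ^ q"
  shows "abs_conv L (\<chi> i. \<sigma>) UNIV ex0 (coef0 G i)"
    and "abs_conv L (\<chi> i. \<sigma>) ({1..} \<times> UNIV) exA (\<lambda>(k, j). coefA G i k j)"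
    and "abs_conv L (\<chi> i. \<sigma>) ({1..} \<times> UNIV) exB (\<lambda>(k, j). coefB G i k j)"
    and "analytic_in_u L \<delta> (\<lambda>u l. \<Sum>\<^sub>\<infinity>j. coef0 G i j l * u ^ j) (coef0 G i)"
    and "analytic_in_u L \<delta> (\<lambda>u l. \<Sum>\<^sub>\<infinity>j. coefA G i k j l * u ^ j) (coefA G i k)"
    and "analytic_in_u L \<delta> (\<lambda>u l. \<Sum>\<^sub>\<infinity>j. coefB G i k j l * u ^ j) (coefB G i k)"
proof -
  note ub = rsup_upper[OF G] and sm = summable_shifted[OF rsup_summable[OF G] G(2)]
  have nn: "0 \<le> rsup L (G k)" for k by (simp add: rsup_def)
  have s0: "(\<lambda>j. rsup L (G (ei i + ex0 j)) * \<sigma> ^ mdeg (ex0 j)) summable_on UNIV" by (rule sm[OF inj_ex0])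
  have sA: "(\<lambda>e. rsup L (G (ei i + exA e)) * \<sigma> ^ mdeg (exA e)) summable_on K" for K
    by (rule sm) (rule inj_on_subset[OF inj_exA], simp)
  have sB: "(\<lambda>e. rsup L (G (ei i + exB e)) * \<sigma> ^ mdeg (exB e)) summable_on K" for K
    by (rule sm) (rule inj_on_subset[OF inj_exB], simp)
  have c0: "cmod (coef0 G i j l) \<le> rsup L (G (ei i + ex0 j))" if "l \<in> L" for j l
    using ub[OF that] nn by (simp add: coef0_def)
  show "abs_conv L (\<chi> i. \<sigma>) UNIV ex0 (coef0 G i)"
    by (rule abs_convI[OF L _ s0]) (rule c0)
  show "abs_conv L (\<chi> i. \<sigma>) ({1..} \<times> UNIV) exA (\<lambda>(k, j). coefA G i k j)"
    by (rule abs_convI[OF L _ sA]) (auto simp: coefA_def intro: ub)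
  show "abs_conv L (\<chi> i. \<sigma>) ({1..} \<times> UNIV) exB (\<lambda>(k, j). coefB G i k j)"
    by (rule abs_convI[OF L _ sB]) (auto simp: coefB_def intro: ub)
  have d0: "\<sigma> ^ mdeg (ex0 j) = \<delta> ^ j" for j
    by (simp add: mdeg_def ex0_def \<delta>_def power_add power_mult power_mult_distrib)
  show "analytic_in_u L \<delta> (\<lambda>u l. \<Sum>\<^sub>\<infinity>j. coef0 G i j l * u ^ j) (coef0 G i)"
    by (rule analytic_in_u_power_series[OF c0 s0[unfolded d0]])
  \<comment> \<open>For fixed \<open>k\<close> the degree is affine in \<open>j\<close> with slope
    \<open>p + q\<close>; dividing by the constant \<open>\<sigma> ^ c\<close> leaves the powers of
    \<open>\<delta>\<close>.\<close>
  have row: "(\<lambda>j. rsup L (G (ei i + e (k, j))) * \<delta> ^ j) summable_on UNIV"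
    if s: "\<And>K. (\<lambda>e'. rsup L (G (ei i + e e')) * \<sigma> ^ mdeg (e e')) summable_on K"
      and d: "\<And>j. mdeg (e (k, j)) = c + (p + q) * j" for e c
  proof -
    have "(\<lambda>e'. rsup L (G (ei i + e e')) * \<sigma> ^ mdeg (e e')) summable_on Pair k ` UNIV" by (rule s)
    then have "(\<lambda>j. rsup L (G (ei i + e (k, j))) * (\<sigma> ^ c * \<delta> ^ j)) summable_on UNIV"
      by (subst (asm) summable_on_reindex)
        (auto simp: inj_on_def o_def d power_add power_mult \<delta>_def)
    then have "(\<lambda>j. 1 / \<sigma> ^ c * (rsup L (G (ei i + e (k, j))) * (\<sigma> ^ c * \<delta> ^ j))) summable_on UNIV"
      by (rule summable_on_cmult_right)
    then show ?thesis using G(2) by (simp add: mult_ac)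
  qed
  have dA: "mdeg (exA (k, j)) = ((p + q) * (1 + N * k) + k * r0 + k * s0) + (p + q) * j" for j
    by (simp add: mdeg_def exA_def algebra_simps)
  show "analytic_in_u L \<delta> (\<lambda>u l. \<Sum>\<^sub>\<infinity>j. coefA G i k j l * u ^ j) (coefA G i k)"
    by (rule analytic_in_u_power_series[OF _ row[OF sA dA]]) (auto simp: coefA_def intro: ub)
  have dB: "mdeg (exB (k, j)) = ((p + q) * (1 + N * k) + k * r1 + k * s1) + (p + q) * j" for j
    by (simp add: mdeg_def exB_def algebra_simps)
  show "analytic_in_u L \<delta> (\<lambda>u l. \<Sum>\<^sub>\<infinity>j. coefB G i k j l * u ^ j) (coefB G i k)"
    by (rule analytic_in_u_power_series[OF _ row[OF sB dB]]) (auto simp: coefB_def intro: ub)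
qed

end

theorem theorem2p1:
  fixes p q N r0 s0 r1 s1 :: nat
    and \<Lambda> :: "(complex^'m) set" and l0 :: "complex^'m"
    and R :: "real^2"
    and \<mu> :: "2 \<Rightarrow> complex^'m \<Rightarrow> complex"
    and a :: "nat \<times> nat \<Rightarrow> complex^'m \<Rightarrow> complex^2"
    and f :: "complex^'m \<Rightarrow> complex^2 \<Rightarrow> complex^2"
  assumes pq: "p > 0" "q > 0" "coprime p q"
    and nbhd: "l0 \<in> interior \<Lambda>"
    and R_pos: "\<forall>i. R $ i > 0"
    and conv: "abs_conv \<Lambda> R {k. mdeg k \<ge> 2} (\<lambda>k. k) a"
    and f_eq: "\<forall>l\<in>\<Lambda>. \<forall>x\<in>polydisk R.
      f l x = (\<chi> i. \<mu> i l * x $ i) + (\<Sum>\<^sub>\<infinity>k\<in>{k. mdeg k \<ge> 2}. mpow x k *s a k l)"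
    and diffeo: "\<forall>l\<in>\<Lambda>. \<exists>U \<subseteq> polydisk R. 0 \<in> U \<and> analytic_diffeo_on (f l) U"
    and \<mu>_cont: "\<forall>i. isCont (\<mu> i) l0"
    and \<mu>_distinct: "\<forall>l\<in>\<Lambda>. \<mu> 1 l \<noteq> \<mu> 2 l"
    and hyperbolic: "\<forall>i. cmod (\<mu> i l0) \<noteq> 1"
    and resonance: "cmod (\<mu> 1 l0) ^ p = cmod (\<mu> 2 l0) powi (- int q)"
    and \<alpha>0: "int q * int r0 - int p * int s0 = 1" "r0 \<le> p" "s0 \<le> q"
    and \<alpha>1: "r1 = p - r0" "s1 = q - s0"
  shows "\<exists>\<Lambda>' \<rho> \<sigma> h hc g gc b0 b0k b1k \<beta>0 \<beta>0k \<beta>1k.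
    open \<Lambda>' \<and> l0 \<in> \<Lambda>' \<and> \<Lambda>' \<subseteq> \<Lambda> \<and>
    (\<forall>i. 0 < \<sigma> $ i \<and> \<sigma> $ i \<le> \<rho> $ i) \<and>
    power_series_family \<Lambda>' \<rho> h hc \<and>
    (\<forall>l\<in>\<Lambda>'. h l 0 = 0 \<and> analytic_diffeo_on (h l) (polydisk \<rho>)) \<and>
    power_series_family \<Lambda>' \<sigma> g gc \<and>
    (\<forall>l\<in>\<Lambda>'. \<forall>x\<in>polydisk \<sigma>.
       h l x \<in> polydisk R \<and> f l (h l x) \<in> h l ` polydisk \<rho> \<and>
       g l x = inv_into (polydisk \<rho>) (h l) (f l (h l x))) \<and>
    (\<forall>l\<in>\<Lambda>'. \<forall>x\<in>polydisk \<sigma>. \<forall>i.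
       let u = x $ 1 ^ p * x $ 2 ^ q in
       g l x $ i = x $ i * (\<mu> i l + b0 i u l +
         u * (\<Sum>\<^sub>\<infinity>k\<in>{1..}. u ^ (N * k) *
           (mpow x (k * r0, k * s0) * b0k i k u l + mpow x (k * r1, k * s1) * b1k i k u l)))) \<and>
    (\<forall>i. analytic_in_u \<Lambda>' (\<sigma> $ 1 ^ p * \<sigma> $ 2 ^ q) (b0 i) (\<beta>0 i) \<and>
       (\<forall>k\<ge>1. analytic_in_u \<Lambda>' (\<sigma> $ 1 ^ p * \<sigma> $ 2 ^ q) (b0k i k) (\<beta>0k i k) \<and>
              analytic_in_u \<Lambda>' (\<sigma> $ 1 ^ p * \<sigma> $ 2 ^ q) (b1k i k) (\<beta>1k i k))) \<and>
    (\<forall>i. abs_conv \<Lambda>' \<sigma> UNIV (\<lambda>j. (p * j, q * j)) (\<beta>0 i) \<and>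
       abs_conv \<Lambda>' \<sigma> ({1..} \<times> UNIV)
         (\<lambda>(k, j). (p * (1 + N * k + j) + k * r0, q * (1 + N * k + j) + k * s0))
         (\<lambda>(k, j). \<beta>0k i k j) \<and>
       abs_conv \<Lambda>' \<sigma> ({1..} \<times> UNIV)
         (\<lambda>(k, j). (p * (1 + N * k + j) + k * r1, q * (1 + N * k + j) + k * s1))
         (\<lambda>(k, j). \<beta>1k i k j)) \<and>
    (coeffs_analytic_near l0 UNIV \<mu> \<and>
     coeffs_analytic_near l0 ({k. mdeg k \<ge> 2} \<times> UNIV) (\<lambda>(k, i) l. a k l $ i) \<longrightarrow>
       coeffs_analytic_near l0 UNIV (\<lambda>(k, i) l. hc k l $ i) \<and>
       coeffs_analytic_near l0 UNIV (\<lambda>(k, i) l. gc k l $ i) \<and>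
       coeffs_analytic_near l0 UNIV (\<lambda>(i, j). \<beta>0 i j) \<and>
       coeffs_analytic_near l0 (UNIV \<times> {1..} \<times> UNIV) (\<lambda>(i, k, j). \<beta>0k i k j) \<and>
       coeffs_analytic_near l0 (UNIV \<times> {1..} \<times> UNIV) (\<lambda>(i, k, j). \<beta>1k i k j))"
proof -
  interpret res: resonance p q N r0 s0 r1 s1
    by unfold_locales (use pq \<alpha>0 \<alpha>1 in auto)

  \<comment> \<open>Moduli of the eigenvalues and splitting of the exponents\<close>
  have l0: "l0 \<in> \<Lambda>" using nbhd interior_subset by blast
  define t where "t i = cmod (\<mu> i l0)" for i
  \<comment> \<open>As 0 to a negative power is 0 by convention, the resonance equation makes both
    eigenvalues vanish or neither; both vanishing contradicts that they are distinct.\<close>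
  have "\<mu> 1 l0 \<noteq> 0" "\<mu> 2 l0 \<noteq> 0"
    using resonance \<mu>_distinct l0 pq by (auto simp: power_int_minus power_int_0_left_if power_0_left)
  then have t: "t i > 0" for i using exhaust_2[of i] by (auto simp: t_def)
  define \<tau> where "\<tau> = ln (t 1) / of_nat q"
  have \<tau>1: "ln (t 1) = of_nat q * \<tau>" using pq by (simp add: \<tau>_def)
  have \<tau>2: "ln (t 2) = - of_nat p * \<tau>"
  proof -
    have "t 1 ^ p = inverse (t 2 ^ q)"
      using resonance by (simp add: t_def power_int_minus)
    then have "ln (t 1 ^ p) = ln (inverse (t 2 ^ q))" by simp
    then have "of_nat p * ln (t 1) = - (of_nat q * ln (t 2))"
      using t[of 1] t[of 2] by (simp add: ln_realpow ln_inverse)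
    then have "of_nat q * (ln (t 2) + of_nat p * \<tau>) = 0" by (simp add: \<tau>1 algebra_simps)
    then show ?thesis using pq by (simp add: eq_neg_iff_add_eq_0)
  qed
  have \<tau>0: "\<tau> \<noteq> 0" using hyperbolic t[of 1] pq by (auto simp: \<tau>_def t_def)
  obtain \<eta> M S where \<eta>: "\<eta> > 0" and M: "monoid_set M" "M - S = res.Ha \<inter> res.Hb"
    and contr: "\<And>(L :: (complex^'m) set) \<mu>.
      (\<And>i l. l \<in> L \<Longrightarrow> t i / (1 + \<eta>) \<le> cmod (\<mu> i l) \<and> cmod (\<mu> i l) \<le> t i * (1 + \<eta>)) \<Longrightarrow>
      contracting L \<mu> (- M) \<and> contracting L (\<lambda>i l. inverse (\<mu> i l)) (M \<inter> S)"
    by (rule res.splitting[OF t \<tau>1 \<tau>2 \<tau>0, where 'l = "complex^'m"]) blast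

  \<comment> \<open>The parameter neighbourhood\<close>
  have "eventually (\<lambda>l. t i / (1 + \<eta>) \<le> cmod (\<mu> i l) \<and> cmod (\<mu> i l) \<le> t i * (1 + \<eta>)) (nhds l0)" for i
  proof -
    have "((\<lambda>l. cmod (\<mu> i l)) \<longlongrightarrow> t i) (at l0)"
      unfolding t_def using \<mu>_cont by (intro tendsto_norm) (simp add: isCont_def)
    then have lim: "((\<lambda>l. cmod (\<mu> i l)) \<longlongrightarrow> t i) (nhds l0)"
      using tendsto_at_iff_tendsto_nhds[of "\<lambda>l. cmod (\<mu> i l)" l0] by (simp add: t_def)
    have "t i / (1 + \<eta>) < t i" "t i < t i * (1 + \<eta>)" using t[of i] \<eta> by (auto simp: field_simps)
    from order_tendstoD(1)[OF lim this(1)] order_tendstoD(2)[OF lim this(2)]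
    show ?thesis by eventually_elim auto
  qed
  then have "eventually (\<lambda>l. \<forall>i. t i / (1 + \<eta>) \<le> cmod (\<mu> i l) \<and> cmod (\<mu> i l) \<le> t i * (1 + \<eta>)) (nhds l0)"
    by (rule eventually_all_finite)
  then obtain W1 where W1: "open W1" "l0 \<in> W1"
    "\<And>l i. l \<in> W1 \<Longrightarrow> t i / (1 + \<eta>) \<le> cmod (\<mu> i l) \<and> cmod (\<mu> i l) \<le> t i * (1 + \<eta>)"
    unfolding eventually_nhds by blast
  \<comment> \<open>Claim (iii) is an implication about witnesses that are chosen once. Its premise
    is therefore decided before the construction and selects the coefficient algebra
    \<open>A\<close>.\<close>
  define an where "an \<longleftrightarrow> coeffs_analytic_near l0 UNIV \<mu> \<and>
     coeffs_analytic_near l0 ({k. mdeg k \<ge> 2} \<times> UNIV) (\<lambda>(k, i) l. a k l $ i)"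
  have "\<exists>W. open W \<and> l0 \<in> W \<and> (an \<longrightarrow> (\<forall>i. mv_analytic_on (\<mu> i) W) \<and>
      (\<forall>k i. mdeg k \<ge> 2 \<longrightarrow> mv_analytic_on (\<lambda>l. a k l $ i) W))"
  proof (cases an)
    case True
    then obtain U V where "open U" "l0 \<in> U" "\<forall>i. mv_analytic_on (\<mu> i) U" "open V" "l0 \<in> V"
      "\<forall>k\<in>{k. mdeg k \<ge> 2} \<times> UNIV. mv_analytic_on ((\<lambda>(k, i) l. a k l $ i) k) V"
      unfolding an_def coeffs_analytic_near_def by blast
    then show ?thesis
      by (intro exI[of _ "U \<inter> V"]) (auto intro: mv_analytic_subset[where U = U] mv_analytic_subset[where U = V])
  qed (auto intro: exI[of _ UNIV])
  then obtain W2 where W2: "open W2" "l0 \<in> W2"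
    "\<And>i. an \<Longrightarrow> mv_analytic_on (\<mu> i) W2"
    "\<And>k i. an \<Longrightarrow> mdeg k \<ge> 2 \<Longrightarrow> mv_analytic_on (\<lambda>l. a k l $ i) W2"
    by blast
  define L where "L = interior \<Lambda> \<inter> W1 \<inter> W2"
  have L: "open L" "l0 \<in> L" "L \<subseteq> \<Lambda>" "L \<subseteq> W1" "L \<subseteq> W2" "L \<noteq> {}"
    using nbhd W1 W2 interior_subset[of \<Lambda>] by (auto simp: L_def)
  define A where "A = (if an then {c. mv_analytic_on c L} else UNIV)"
  interpret ca: coef_algebra A L
    using coef_algebra_UNIV[of L] coef_algebra_analytic[OF L(1)] by (cases an) (simp_all add: A_def)

  \<comment> \<open>The given family as a weighted power series\<close>
  define r where "r = min (R $ 1) (R $ 2) / 2"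
  have r: "r > 0" "r < R $ i" for i
  proof -
    have "R $ 1 > 0" "R $ 2 > 0" using R_pos by blast+
    then show "r > 0" "r < R $ i" using exhaust_2[of i] by (auto simp: r_def min_def)
  qed
  define F where "F i = (\<lambda>k l. if mdeg k \<ge> 2 then a k l $ i else 0)" for i
  have \<mu>A: "\<mu> i \<in> A" for i
    using mv_analytic_subset[OF W2(3) L(5,1)] by (auto simp: A_def)
  have F: "ca.good UNIV r F"
    unfolding ca.good_def
  proof (intro allI conjI)
    fix i
    show "ord2 (F i)" by (simp add: ord2_def F_def)
    show "F i k \<in> A" for k
      using mv_analytic_subset[OF W2(4)[of k i] L(5,1)] mv_analytic_const[OF L(1)]
      by (cases "mdeg k \<ge> 2") (simp_all add: A_def F_def)
    show "supp UNIV (emb (ei i)) (F i)" by (simp add: supp_def)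
    show "nrm L r (F i) < \<infinity>" unfolding F_def by (rule nrm_of_abs_conv[OF conv L(3)]) (use r in auto)
  qed
  have f: "f l x = emap \<mu> F l x" if l: "l \<in> L" and x: "x \<in> cpoly r" for l x
  proof -
    have xR: "x \<in> polydisk R" using x r by (auto simp: cpoly_def polydisk_def intro: le_less_trans)
    have fin: "nrm L r (F i) < \<infinity>" for i using F by (simp add: ca.good_def)
    have "((\<lambda>k. mpow x k *s a k l) has_sum (\<chi> i. ev (F i) l x)) {k. mdeg k \<ge> 2}"
    proof (rule has_sum_vec)
      fix i
      have "((\<lambda>k. F i k l * mpow x k) has_sum ev (F i) l x) UNIV" by (rule ev_has_sum[OF fin l x])
      then show "((\<lambda>k. (mpow x k *s a k l) $ i) has_sum (\<chi> i. ev (F i) l x) $ i) {k. mdeg k \<ge> 2}"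
        by (subst has_sum_cong_neutral[where T = UNIV and g = "\<lambda>k. F i k l * mpow x k"])
          (auto simp: F_def mult.commute)
    qed
    from infsumI[OF this] have "f l x = (\<chi> i. \<mu> i l * x $ i) + (\<chi> i. ev (F i) l x)"
      using f_eq[rule_format, OF subsetD[OF L(3) l] xR] by simp
    then show ?thesis
      using EV_full[OF fin l x, of \<mu>] r(1) by (simp add: vec_eq_iff)
  qed

  \<comment> \<open>Application of the normal form\<close>
  have near: "t i / (1 + \<eta>) \<le> cmod (\<mu> i l) \<and> cmod (\<mu> i l) \<le> t i * (1 + \<eta>)" if "l \<in> L" for i l
    using W1(3) that L(4) by blast
  define m where "m = max (t 1) (t 2) * (1 + \<eta>)"
  have m: "cmod (\<mu> i l) \<le> m" if "l \<in> L" for i l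
  proof -
    have "t i \<le> max (t 1) (t 2)" using exhaust_2[of i] by auto
    then have "t i * (1 + \<eta>) \<le> m" unfolding m_def using \<eta> by (intro mult_right_mono) auto
    then show ?thesis using near[OF that, of i] by linarith
  qed
  define \<kappa> where "\<kappa> = min (t 1) (t 2) / (1 + \<eta>)"
  have \<kappa>: "\<kappa> > 0" using t[of 1] t[of 2] \<eta> by (simp add: \<kappa>_def)
  have \<kappa>': "\<kappa> \<le> cmod (\<mu> i l)" if "l \<in> L" for i l
  proof -
    have "min (t 1) (t 2) \<le> t i" using exhaust_2[of i] by auto
    then have "\<kappa> \<le> t i / (1 + \<eta>)" unfolding \<kappa>_def using \<eta> by (intro divide_right_mono) auto
    then show ?thesis using near[OF that, of i] by linarith
  qed
  have K: "monoid_set (M - S)" unfolding M(2) by (rule res.monoid_Ha_Hb)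
  have c1: "contracting L \<mu> (- M)" and c2: "contracting L (\<lambda>i l. inverse (\<mu> i l)) (M \<inter> S)"
    using contr[OF near] by auto
  obtain \<rho>1 H G where \<rho>1: "\<rho>1 > 0" and H: "ca.good UNIV \<rho>1 H" and G: "ca.good (res.Ha \<inter> res.Hb) \<rho>1 G"
    and conj: "\<And>l x. l \<in> L \<Longrightarrow> x \<in> cpoly \<rho>1 \<Longrightarrow>
      emap \<mu> F l (emap ones H l x) = emap ones H l (emap \<mu> G l x)"
    using ca.normal_form[where \<mu> = \<mu>, OF M(1) K F r(1) \<mu>A c1 c2 \<kappa>' m \<kappa>] unfolding M(2) by blast

  \<comment> \<open>Radii for \<open>h\<close> and \<open>g\<close>\<close>
  have Hfin: "nrm L \<rho>1 (H i) < \<infinity>" and Hnl: "ord2 (H i)" for i using H by (auto simp: ca.good_def)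
  have Gfin: "nrm L \<rho>1 (G i) < \<infinity>" and Gnl: "ord2 (G i)" for i using G by (auto simp: ca.good_def)
  obtain \<rho> where \<rho>: "\<rho> > 0" "\<rho> \<le> \<rho>1"
    and diffeo': "\<And>l. l \<in> L \<Longrightarrow> analytic_diffeo_on (emap ones H l) (polydisk (\<chi> i. \<rho>))"
    by (rule near_identity_diffeo[where H = H, OF Hnl Hfin \<rho>1]) (use order_refl in blast)
  obtain t1 where t1: "t1 > 0" "t1 \<le> \<rho>1" "\<And>l x. l \<in> L \<Longrightarrow> x \<in> cpoly t1 \<Longrightarrow> emap ones H l x \<in> cpoly r"
    by (rule ca.full_small[OF H \<rho>1, of ones 1 r]) (use r in auto)
  \<comment> \<open>Half the radius puts the image of \<open>g\<close> into the open polydisk of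
    radius \<open>\<rho>\<close>, on which \<open>h\<close> is injective, so that
    \<open>inv_into\<close> returns \<open>g\<close>.\<close>
  have \<rho>half: "\<rho> / 2 > 0" using \<rho> by simp
  obtain t2 where t2: "t2 > 0" "t2 \<le> \<rho>1" "\<And>l x. l \<in> L \<Longrightarrow> x \<in> cpoly t2 \<Longrightarrow> emap \<mu> G l x \<in> cpoly (\<rho> / 2)"
    by (rule ca.full_small[where \<mu> = \<mu>, OF G \<rho>1 m \<rho>half]) auto
  define \<sigma> where "\<sigma> = min \<rho> (min t1 t2)"
  have \<sigma>: "\<sigma> > 0" "\<sigma> \<le> \<rho>" "\<sigma> \<le> t1" "\<sigma> \<le> t2" "\<sigma> \<le> \<rho>1" using \<rho> t1 t2 by (auto simp: \<sigma>_def)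
  have vfin: "nrm L s (full \<nu> X i) < \<infinity>"
    if X: "nrm L \<rho>1 (X i) < \<infinity>" and s: "0 < s" "s \<le> \<rho>1" and \<nu>: "\<And>l. l \<in> L \<Longrightarrow> cmod (\<nu> i l) \<le> c" "c \<ge> 0"
    for s \<nu> X i c
  proof -
    have "nrm L s (full \<nu> X i) \<le> nrm L s (lin \<nu> i) + nrm L s (X i)" unfolding full_def by (rule nrm_add)
    also have "\<dots> \<le> ennreal (c * s) + nrm L \<rho>1 (X i)"
      by (intro add_mono nrm_lin nrm_mono) (use s \<nu> in auto)
    also have "\<dots> < \<infinity>" using X by (simp add: less_top)
    finally show ?thesis .
  qed
  have m0: "m \<ge> 0" using order_trans[OF norm_ge_zero m[OF L(2)]] .
  have hfin: "nrm L \<rho> (full ones H i) < \<infinity>" for i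
    by (rule vfin[of H i \<rho> ones 1]) (use Hfin \<rho> in auto)
  have gfin: "nrm L \<sigma> (full \<mu> G i) < \<infinity>" for i
    by (rule vfin[of G i \<sigma> \<mu> m]) (use Gfin \<sigma> m m0 in auto)
  have Gs: "nrm L \<sigma> (G i) < \<infinity>" for i
    using nrm_mono[of \<sigma> \<rho>1 L "G i"] Gfin[of i] \<sigma> by (auto intro: le_less_trans)
  have Gspt: "supp (res.Ha \<inter> res.Hb) (emb (ei i)) (G i)" for i using G by (simp add: ca.good_def)
  have ex: "(\<lambda>j. (p * j, q * j)) = res.ex0"
    "(\<lambda>(k, j). (p * (1 + N * k + j) + k * r0, q * (1 + N * k + j) + k * s0)) = res.exA"
    "(\<lambda>(k, j). (p * (1 + N * k + j) + k * r1, q * (1 + N * k + j) + k * s1)) = res.exB"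
    by (simp_all add: fun_eq_iff res.ex0_def res.exA_def res.exB_def)

  \<comment> \<open>Witnesses and verification of the claims\<close>
  let ?b0 = "\<lambda>i u l. \<Sum>\<^sub>\<infinity>j. res.coef0 (G i) i j l * u ^ j"
  let ?bA = "\<lambda>i k u l. \<Sum>\<^sub>\<infinity>j. res.coefA (G i) i k j l * u ^ j"
  let ?bB = "\<lambda>i k u l. \<Sum>\<^sub>\<infinity>j. res.coefB (G i) i k j l * u ^ j"
  let ?h = "emap ones H" and ?g = "emap \<mu> G"
  show ?thesis
    unfolding ex
  proof (rule exI[of _ L], rule exI[of _ "\<chi> i. \<rho>"], rule exI[of _ "\<chi> i. \<sigma>"],
      rule exI[of _ "?h"], rule exI[of _ "\<lambda>k l. \<chi> i. full ones H i k l"],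
      rule exI[of _ "?g"], rule exI[of _ "\<lambda>k l. \<chi> i. full \<mu> G i k l"],
      rule exI[of _ ?b0],
      rule exI[of _ ?bA],
      rule exI[of _ ?bB],
      rule exI[of _ "\<lambda>i. res.coef0 (G i) i"], rule exI[of _ "\<lambda>i. res.coefA (G i) i"],
      rule exI[of _ "\<lambda>i. res.coefB (G i) i"], intro conjI)
    show "open L" "l0 \<in> L" "L \<subseteq> \<Lambda>" by (fact L)+
    show "\<forall>i. 0 < (\<chi> i. \<sigma>) $ i \<and> (\<chi> i. \<sigma>) $ i \<le> (\<chi> i. \<rho>) $ i" using \<sigma> by simp
    show "power_series_family L (\<chi> i. \<rho>) (?h) (\<lambda>k l. \<chi> i. full ones H i k l)"
      by (rule power_series_family_EV[where v = "full ones H", OF L(6) hfin \<rho>(1)])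
    show "power_series_family L (\<chi> i. \<sigma>) (?g) (\<lambda>k l. \<chi> i. full \<mu> G i k l)"
      by (rule power_series_family_EV[where v = "full \<mu> G", OF L(6) gfin \<sigma>(1)])
    show "\<forall>l\<in>L. ?h l 0 = 0 \<and> analytic_diffeo_on (?h l) (polydisk (\<chi> i. \<rho>))"
    proof (intro ballI conjI diffeo')
      fix l assume l: "l \<in> L"
      have "ev (H i) l 0 = 0" for i
      proof -
        have "H i k l * mpow 0 k = 0" for k
        proof (cases "mdeg k = 0")
          case True
          then show ?thesis using Hnl[of i] by (simp add: ord2_def del: mdeg_eq_0)
        next
          case False
          then show ?thesis by (auto simp: mpow_def mdeg_def power_0_left simp del: mdeg_eq_0)
        qed
        then show ?thesis unfolding ev_def by (intro infsum_0)
      qed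
      then show "?h l 0 = 0"
        using EV_full[OF Hfin l, of 0 ones] \<rho>1 by (simp add: vec_eq_iff cpoly_def)
    qed
    show "\<forall>l\<in>L. \<forall>x\<in>polydisk (\<chi> i. \<sigma>). ?h l x \<in> polydisk R \<and>
      f l (?h l x) \<in> ?h l ` polydisk (\<chi> i. \<rho>) \<and>
      ?g l x = inv_into (polydisk (\<chi> i. \<rho>)) (?h l) (f l (?h l x))"
    proof (intro ballI)
      fix l x assume l: "l \<in> L" and "x \<in> polydisk (\<chi> i. \<sigma>)"
      then have "x \<in> cpoly \<sigma>" using polydisk_subset_cpoly by blast
      then have x: "x \<in> cpoly t1" "x \<in> cpoly t2" "x \<in> cpoly \<rho>1" using cpoly_mono \<sigma> by blast+
      have hr: "?h l x \<in> cpoly r" by (rule t1(3)[OF l x(1)])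
      then have hR: "?h l x \<in> polydisk R" using r by (auto simp: cpoly_def polydisk_def intro: le_less_trans)
      have "cmod (?g l x $ i) \<le> \<rho> / 2" for i using t2(3)[OF l x(2)] by (simp add: cpoly_def)
      then have "cmod (?g l x $ i) < \<rho>" for i by (rule le_less_trans) (use \<rho> in simp)
      then have g: "?g l x \<in> polydisk (\<chi> i. \<rho>)" by (simp add: polydisk_def)
      have fh: "f l (?h l x) = ?h l (?g l x)" using f[OF l hr] conj[OF l x(3)] by simp
      have "inj_on (?h l) (polydisk (\<chi> i. \<rho>))" using diffeo'[OF l] by (simp add: analytic_diffeo_on_def)
      then show "?h l x \<in> polydisk R \<and> f l (?h l x) \<in> ?h l ` polydisk (\<chi> i. \<rho>) \<and>
          ?g l x = inv_into (polydisk (\<chi> i. \<rho>)) (?h l) (f l (?h l x))"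
        unfolding fh using hR g by simp
    qed
    show "\<forall>l\<in>L. \<forall>x\<in>polydisk (\<chi> i. \<sigma>). \<forall>i. let u = x $ 1 ^ p * x $ 2 ^ q in
      ?g l x $ i = x $ i * (\<mu> i l + ?b0 i u l +
         u * (\<Sum>\<^sub>\<infinity>k\<in>{1..}. u ^ (N * k) *
           (mpow x (k * r0, k * s0) * ?bA i k u l +
            mpow x (k * r1, k * s1) * ?bB i k u l)))"
    proof (intro ballI allI)
      fix l x i assume l: "l \<in> L" and "x \<in> polydisk (\<chi> i. \<sigma>)"
      then have x: "x \<in> cpoly \<sigma>" using polydisk_subset_cpoly by blast
      have "?g l x $ i = \<mu> i l * x $ i + ev (G i) l x"
        by (rule EV_full[OF Gs l x]) (use \<sigma> in simp)
      then show "let u = x $ 1 ^ p * x $ 2 ^ q in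
        ?g l x $ i = x $ i * (\<mu> i l + ?b0 i u l +
         u * (\<Sum>\<^sub>\<infinity>k\<in>{1..}. u ^ (N * k) *
           (mpow x (k * r0, k * s0) * ?bA i k u l +
            mpow x (k * r1, k * s1) * ?bB i k u l)))"
        unfolding Let_def res.kept_expansion[OF Gnl Gspt Gs \<sigma>(1) l x] by (simp only: distrib_left add.assoc mult.commute)
    qed
    note cv = res.coef_convergence[OF Gs \<sigma>(1) L(6)]
    show "\<forall>i. analytic_in_u L ((\<chi> i. \<sigma>) $ 1 ^ p * (\<chi> i. \<sigma>) $ 2 ^ q)
          (?b0 i) (res.coef0 (G i) i) \<and>
        (\<forall>k\<ge>1. analytic_in_u L ((\<chi> i. \<sigma>) $ 1 ^ p * (\<chi> i. \<sigma>) $ 2 ^ q)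
            (?bA i k) (res.coefA (G i) i k) \<and>
          analytic_in_u L ((\<chi> i. \<sigma>) $ 1 ^ p * (\<chi> i. \<sigma>) $ 2 ^ q)
            (?bB i k) (res.coefB (G i) i k))"
      unfolding vec_lambda_beta by (intro allI impI conjI cv)
    show "\<forall>i. abs_conv L (\<chi> i. \<sigma>) UNIV res.ex0 (res.coef0 (G i) i) \<and>
        abs_conv L (\<chi> i. \<sigma>) ({1..} \<times> UNIV) res.exA (\<lambda>(k, j). res.coefA (G i) i k j) \<and>
        abs_conv L (\<chi> i. \<sigma>) ({1..} \<times> UNIV) res.exB (\<lambda>(k, j). res.coefB (G i) i k j)"
      by (intro allI conjI cv)
    show "coeffs_analytic_near l0 UNIV \<mu> \<and>
        coeffs_analytic_near l0 ({k. mdeg k \<ge> 2} \<times> UNIV) (\<lambda>(k, i) l. a k l $ i) \<longrightarrow>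
      coeffs_analytic_near l0 UNIV (\<lambda>(k, i) l. (\<chi> i. full ones H i k l) $ i) \<and>
      coeffs_analytic_near l0 UNIV (\<lambda>(k, i) l. (\<chi> i. full \<mu> G i k l) $ i) \<and>
      coeffs_analytic_near l0 UNIV (\<lambda>(i, j). res.coef0 (G i) i j) \<and>
      coeffs_analytic_near l0 (UNIV \<times> {1..} \<times> UNIV) (\<lambda>(i, k, j). res.coefA (G i) i k j) \<and>
      coeffs_analytic_near l0 (UNIV \<times> {1..} \<times> UNIV) (\<lambda>(i, k, j). res.coefB (G i) i k j)"
      unfolding an_def[symmetric]
    proof
      assume an
      then have A: "mv_analytic_on c L" if "c \<in> A" for c using that by (simp add: A_def)
      have HA: "mv_analytic_on (full ones H i k) L" and GA: "mv_analytic_on (full \<mu> G i k) L"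
        and gA: "mv_analytic_on (G i k) L" for i k
        using H G by (auto intro!: A ca.full ca.const \<mu>A simp: ca.good_def)
      have zA: "mv_analytic_on (\<lambda>l. 0) L" by (rule mv_analytic_const[OF L(1)])
      show "coeffs_analytic_near l0 UNIV (\<lambda>(k, i) l. (\<chi> i. full ones H i k l) $ i) \<and>
        coeffs_analytic_near l0 UNIV (\<lambda>(k, i) l. (\<chi> i. full \<mu> G i k l) $ i) \<and>
        coeffs_analytic_near l0 UNIV (\<lambda>(i, j). res.coef0 (G i) i j) \<and>
        coeffs_analytic_near l0 (UNIV \<times> {1..} \<times> UNIV) (\<lambda>(i, k, j). res.coefA (G i) i k j) \<and>
        coeffs_analytic_near l0 (UNIV \<times> {1..} \<times> UNIV) (\<lambda>(i, k, j). res.coefB (G i) i k j)"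
        unfolding coeffs_analytic_near_def
        by (intro conjI exI[of _ L] L ballI)
          (use HA GA gA zA in \<open>auto simp: res.coef0_def res.coefA_def res.coefB_def split: prod.splits\<close>)
    qed
  qed
qed

end
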